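(* Let $G$ be a countable discrete group and let $G\curvearrowright \partial_p G$ be its universal minimal proximal action. Then the kernel $\ker(G\curvearrowright\partial_p G)=\{g\in G : gx=x \text{ for all } x\in\partial_p G\}$ is equal to the hyper-FC-subgroup of $G$.
   Context: All actions are continuous actions on nonempty compact Hausdorff spaces. An action $G\curvearrowright X$ is proximal if for all $x,y\in X$ there exists a net $\{g_i\}$ in $G$ such that $\lim_i g_i x=\lim_i g_i y$; it is minimal if every orbit is dense. The universal minimal proximal action $G\curvearrowright\partial_p G$ (Glasner) is the unique (up to isomorphism) minimal proximal action of $G$ which has every minimal proximal action of $G$ as a factor (i.e. for each minimal proximal action $G\curvearrowright X$ there is a continuous $G$-equivariant surjection $\partial_pG\to X$). The FC-series of $G$ is the transfinite increasing series of normal subgroups $1=F_0\le F_1\le F_2\le\cdots\le F_\alpha\le\cdots\le G$, where $F_{\alpha+1}/F_\alpha$ is the normal subgroup of $G/F_\alpha$ consisting of the elements with finite conjugacy class in $G/F_\alpha$, and $F_\beta=\bigcup_{\alpha<\beta}F_\alpha$ for $\beta$ a limit ordinal. The hyper-FC-subgroup of $G$ is $\bigcup_\alpha F_\alpha$. *)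

theory Defs
  imports "HOL-Algebra.Group_Action" "HOL-Analysis.T1_Spaces"
begin

section \<open>Actions on compact Hausdorff spaces\<close>

text \<open>The group is discrete, so an action is continuous iff each group element acts continuously.\<close>

definition compact_action ::
    "('a, 'm) monoid_scheme \<Rightarrow> 'x topology \<Rightarrow> ('a \<Rightarrow> 'x \<Rightarrow> 'x) \<Rightarrow> bool" where
  "compact_action G X \<phi> \<longleftrightarrow>
     topspace X \<noteq> {} \<and> compact_space X \<and> Hausdorff_space X \<and>
     group_action G (topspace X) \<phi> \<and>
     (\<forall>g\<in>carrier G. continuous_map X X (\<phi> g))"

definition minimal_action ::
    "('a, 'm) monoid_scheme \<Rightarrow> 'x topology \<Rightarrow> ('a \<Rightarrow> 'x \<Rightarrow> 'x) \<Rightarrow> bool" where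
  "minimal_action G X \<phi> \<longleftrightarrow>
     (\<forall>x\<in>topspace X. X closure_of (orbit G \<phi> x) = topspace X)"

text \<open>Nets in \<open>G\<close> are rendered by proper filters on \<open>G\<close>: a net \<open>g\<^sub>i\<close> and the filter generated by
  its tails give the same limits of \<open>g\<^sub>i x\<close>, and every proper filter arises from a net.\<close>

definition proximal_action ::
    "('a, 'm) monoid_scheme \<Rightarrow> 'x topology \<Rightarrow> ('a \<Rightarrow> 'x \<Rightarrow> 'x) \<Rightarrow> bool" where
  "proximal_action G X \<phi> \<longleftrightarrow>
     (\<forall>x\<in>topspace X. \<forall>y\<in>topspace X. \<exists>F z. F \<noteq> bot \<and> (\<forall>\<^sub>F g in F. g \<in> carrier G) \<and>
        limitin X (\<lambda>g. \<phi> g x) z F \<and> limitin X (\<lambda>g. \<phi> g y) z F)"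

definition minimal_proximal_action ::
    "('a, 'm) monoid_scheme \<Rightarrow> 'x topology \<Rightarrow> ('a \<Rightarrow> 'x \<Rightarrow> 'x) \<Rightarrow> bool" where
  "minimal_proximal_action G X \<phi> \<longleftrightarrow>
     compact_action G X \<phi> \<and> minimal_action G X \<phi> \<and> proximal_action G X \<phi>"

definition factor_map ::
    "('a, 'm) monoid_scheme \<Rightarrow> 'x topology \<Rightarrow> ('a \<Rightarrow> 'x \<Rightarrow> 'x) \<Rightarrow>
     'y topology \<Rightarrow> ('a \<Rightarrow> 'y \<Rightarrow> 'y) \<Rightarrow> ('x \<Rightarrow> 'y) \<Rightarrow> bool" where
  "factor_map G X \<phi> Y \<psi> p \<longleftrightarrow>
     continuous_map X Y p \<and> p ` topspace X = topspace Y \<and>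
     (\<forall>g\<in>carrier G. \<forall>x\<in>topspace X. p (\<phi> g x) = \<psi> g (p x))"

text \<open>HOL cannot quantify over all types inside a definition, so \<open>Y\<close> ranges over spaces whose points
  lie in the type \<^typ>\<open>'a set set\<close>.  This loses nothing: a minimal action of \<open>G\<close> has a dense orbit,
  hence at most \<open>2 ^ (2 ^ |G|)\<close> points; see \<open>universal_minimal_proximal_actionD\<close> below.\<close>

definition universal_minimal_proximal_action ::
    "('a, 'm) monoid_scheme \<Rightarrow> 'x topology \<Rightarrow> ('a \<Rightarrow> 'x \<Rightarrow> 'x) \<Rightarrow> bool" where
  "universal_minimal_proximal_action G X \<phi> \<longleftrightarrow>
     minimal_proximal_action G X \<phi> \<and>
     (\<forall>(Y :: 'a set set topology) \<psi>. minimal_proximal_action G Y \<psi> \<longrightarrow>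
        (\<exists>p. factor_map G X \<phi> Y \<psi> p))"

lemma minimal_action_embeds:
  fixes Y :: "'y topology" and G :: "('a, 'm) monoid_scheme"
  assumes Y: "compact_action G Y \<psi>" "minimal_action G Y \<psi>"
  shows "\<exists>e :: 'y \<Rightarrow> 'a set set. inj_on e (topspace Y)"
proof -
  obtain y0 where y0: "y0 \<in> topspace Y" 
    using Y(1) by (metis compact_action_def ex_in_conv)
  define e where "e y = {A. A \<subseteq> carrier G \<and> y \<in> Y closure_of ((\<lambda>g. \<psi> g y0) ` A)}" for y
  have dense: "Y closure_of (orbit G \<psi> y0) = topspace Y"
    using Y(2) y0 by (auto simp: minimal_action_def)
  have "inj_on e (topspace Y)"
  proof (rule inj_onI, rule ccontr)
    fix y z assume yz: "y \<in> topspace Y" "z \<in> topspace Y" "e y = e z" "y \<noteq> z"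
    from Y(1) have "Hausdorff_space Y" by (simp add: compact_action_def)
    then obtain U V where UV: "openin Y U" "openin Y V" "y \<in> U" "z \<in> V" "disjnt U V"
      using yz unfolding Hausdorff_space_def by metis
    define A where "A = {g \<in> carrier G. \<psi> g y0 \<in> U}"
    have "y \<in> Y closure_of ((\<lambda>g. \<psi> g y0) ` A)"
      unfolding in_closure_of
    proof (intro conjI allI impI)
      fix T assume T: "y \<in> T \<and> openin Y T"
      have "y \<in> Y closure_of (orbit G \<psi> y0)" using dense yz by simp
      moreover have "openin Y (T \<inter> U)" "y \<in> T \<inter> U" using T UV by auto
      ultimately obtain w where "w \<in> orbit G \<psi> y0" "w \<in> T \<inter> U"
        unfolding in_closure_of by metis
      then show "\<exists>w. w \<in> (\<lambda>g. \<psi> g y0) ` A \<and> w \<in> T"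
        by (auto simp: orbit_def A_def)
    qed (use yz in auto)
    then have "A \<in> e y" by (simp add: e_def A_def)
    moreover have "z \<notin> Y closure_of ((\<lambda>g. \<psi> g y0) ` A)"
      using UV unfolding in_closure_of A_def disjnt_def by blast
    then have "A \<notin> e z" by (simp add: e_def)
    ultimately show False using yz by simp
  qed
  then show ?thesis by blast
qed

lemma minimal_proximal_action_transport:
  fixes Y :: "'y topology" and G :: "('a, 'm) monoid_scheme" and Z :: "'z topology"
  assumes Y: "minimal_proximal_action G Y \<psi>" and e: "homeomorphic_maps Y Z e e'"
  shows "minimal_proximal_action G Z (\<lambda>g. \<lambda>z\<in>topspace Z. e (\<psi> g (e' z)))"
    (is "minimal_proximal_action G Z ?\<theta>")
proof -
  have ce: "continuous_map Y Z e" and ce': "continuous_map Z Y e'"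
    and e'e: "\<And>y. y \<in> topspace Y \<Longrightarrow> e' (e y) = y"
    and ee': "\<And>z. z \<in> topspace Z \<Longrightarrow> e (e' z) = z"
    using e by (auto simp: homeomorphic_maps_def)
  have eZ: "\<And>y. y \<in> topspace Y \<Longrightarrow> e y \<in> topspace Z"
    and e'Y: "\<And>z. z \<in> topspace Z \<Longrightarrow> e' z \<in> topspace Y"
    using ce ce' continuous_map_image_subset_topspace by blast+
  have hom: "Y homeomorphic_space Z" using e homeomorphic_space_def by blast
  have Yc: "compact_action G Y \<psi>" "minimal_action G Y \<psi>" "proximal_action G Y \<psi>"
    using Y by (auto simp: minimal_proximal_action_def)
  have ga: "group_action G (topspace Y) \<psi>" using Yc by (simp add: compact_action_def)
  then interpret A: group_action G "topspace Y" \<psi> .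
  have grp: "group G" using A.group_hom group_hom.axioms(1) by blast
  have \<psi>Y: "\<psi> g y \<in> topspace Y" if "g \<in> carrier G" "y \<in> topspace Y" for g y
    using A.element_image that by blast
  have bij: "?\<theta> g \<in> Bij (topspace Z)" if g: "g \<in> carrier G" for g
  proof -
    have b1: "bij_betw e' (topspace Z) (topspace Y)"
      by (rule bij_betw_byWitness[where f' = e]) (use ee' e'e eZ e'Y in auto)
    have b2: "bij_betw e (topspace Y) (topspace Z)"
      by (rule bij_betw_byWitness[where f' = e']) (use ee' e'e eZ e'Y in auto)
    have "bij_betw (\<psi> g) (topspace Y) (topspace Y)"
      using A.bij_prop0[OF g] by (simp add: Bij_def)
    from bij_betw_trans[OF bij_betw_trans[OF b1 this] b2]
    have "bij_betw (\<lambda>z. e (\<psi> g (e' z))) (topspace Z) (topspace Z)"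
      by (simp add: comp_def)
    then have "bij_betw (?\<theta> g) (topspace Z) (topspace Z)"
      by (rule bij_betw_cong[THEN iffD1, rotated]) simp
    then show ?thesis by (simp add: Bij_def)
  qed
  have "?\<theta> (g \<otimes>\<^bsub>G\<^esub> h) = compose (topspace Z) (?\<theta> g) (?\<theta> h)"
    if "g \<in> carrier G" "h \<in> carrier G" for g h
    using that by (auto simp: fun_eq_iff compose_def A.composition_rule e'Y eZ e'e \<psi>Y)
  then have "?\<theta> \<in> hom G (BijGroup (topspace Z))"
    by (intro homI) (auto simp: BijGroup_def bij)
  then have ga': "group_action G (topspace Z) ?\<theta>"
    by (simp add: group_action_def group_hom_def group_hom_axioms_def grp group_BijGroup)
  have cont: "continuous_map Z Z (?\<theta> g)" if "g \<in> carrier G" for g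
  proof -
    have "continuous_map Y Y (\<psi> g)" using Yc that by (auto simp: compact_action_def)
    from continuous_map_compose[OF continuous_map_compose[OF ce' this] ce]
    have "continuous_map Z Z (\<lambda>z. e (\<psi> g (e' z)))" by (simp add: comp_def)
    then show ?thesis by (rule continuous_map_eq) simp
  qed
  have "topspace Z \<noteq> {}" "compact_space Z" "Hausdorff_space Z"
    using Yc hom eZ homeomorphic_compact_space homeomorphic_Hausdorff_space
    by (fastforce simp: compact_action_def)+
  then have "compact_action G Z ?\<theta>"
    using ga' cont by (auto simp: compact_action_def)
  moreover have "minimal_action G Z ?\<theta>"
    unfolding minimal_action_def
  proof (intro ballI)
    fix z assume z: "z \<in> topspace Z"
    have hm: "homeomorphic_map Y Z e" using e homeomorphic_map_maps by blast
    have orb: "orbit G ?\<theta> z = e ` orbit G \<psi> (e' z)"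
      using z by (auto simp: orbit_def)
    have sub: "orbit G \<psi> (e' z) \<subseteq> topspace Y"
      using \<psi>Y e'Y z by (auto simp: orbit_def)
    have "Z closure_of (orbit G ?\<theta> z) = e ` (Y closure_of (orbit G \<psi> (e' z)))"
      unfolding orb using homeomorphic_map_closure_of[OF hm sub] by simp
    also have "\<dots> = e ` topspace Y" using Yc(2) e'Y z by (auto simp: minimal_action_def)
    also have "\<dots> = topspace Z" using hm by (simp add: homeomorphic_imp_surjective_map)
    finally show "Z closure_of (orbit G ?\<theta> z) = topspace Z" .
  qed
  moreover have "proximal_action G Z ?\<theta>"
    unfolding proximal_action_def
  proof (intro ballI)
    fix x y assume xy: "x \<in> topspace Z" "y \<in> topspace Z"
    then obtain F w where F: "F \<noteq> bot" "\<forall>\<^sub>F g in F. g \<in> carrier G"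
      "limitin Y (\<lambda>g. \<psi> g (e' x)) w F" "limitin Y (\<lambda>g. \<psi> g (e' y)) w F"
      using Yc(3) e'Y unfolding proximal_action_def by metis
    have "limitin Z (\<lambda>g. e (\<psi> g (e' x))) (e w) F" "limitin Z (\<lambda>g. e (\<psi> g (e' y))) (e w) F"
      using continuous_map_limit[OF ce] F(3,4) by (auto simp: comp_def)
    then show "\<exists>F z. F \<noteq> bot \<and> (\<forall>\<^sub>F g in F. g \<in> carrier G) \<and>
        limitin Z (\<lambda>g. ?\<theta> g x) z F \<and> limitin Z (\<lambda>g. ?\<theta> g y) z F"
      using F xy by auto
  qed
  ultimately show ?thesis by (simp add: minimal_proximal_action_def)
qed

lemma universal_minimal_proximal_actionD:
  fixes X :: "'x topology" and Y :: "'y topology" and G :: "('a, 'm) monoid_scheme"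
  assumes X: "universal_minimal_proximal_action G X \<phi>" and Y: "minimal_proximal_action G Y \<psi>"
  shows "\<exists>p. factor_map G X \<phi> Y \<psi> p"
proof -
  from Y have Yc: "compact_action G Y \<psi>" "minimal_action G Y \<psi>"
    by (auto simp: minimal_proximal_action_def)
  then obtain e :: "'y \<Rightarrow> 'a set set" where inj: "inj_on e (topspace Y)"
    using minimal_action_embeds by blast
  define e' where "e' = inv_into (topspace Y) e"
  define Z where "Z = pullback_topology (e ` topspace Y) e' Y"
  have e'e: "e' (e y) = y" if "y \<in> topspace Y" for y
    using that inj by (simp add: e'_def)
  have tZ: "topspace Z = e ` topspace Y"
    using e'e by (auto simp: Z_def topspace_pullback_topology)
  have c1: "continuous_map Z Y e'"
    unfolding Z_def using continuous_map_pullback[OF continuous_map_id[of Y], of "e ` topspace Y" e'] by simp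
  have "continuous_map Y Y (e' \<circ> e)"
    by (rule continuous_map_eq[OF continuous_map_id]) (simp add: e'e)
  then have c2: "continuous_map Y Z e"
    unfolding Z_def by (intro continuous_map_pullback') auto
  have h: "homeomorphic_maps Y Z e e'"
    unfolding homeomorphic_maps_def using c1 c2 e'e tZ by auto
  define \<theta> where "\<theta> = (\<lambda>g. \<lambda>z\<in>topspace Z. e (\<psi> g (e' z)))"
  have "minimal_proximal_action G Z \<theta>"
    using minimal_proximal_action_transport[OF Y h] by (simp add: \<theta>_def)
  then obtain p where p: "factor_map G X \<phi> Z \<theta> p"
    using X unfolding universal_minimal_proximal_action_def by blast
  interpret A: group_action G "topspace Y" \<psi> using Yc by (simp add: compact_action_def)
  have "factor_map G X \<phi> Y \<psi> (e' \<circ> p)"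
    unfolding factor_map_def
  proof (intro conjI ballI)
    show "continuous_map X Y (e' \<circ> p)"
      using p c1 continuous_map_compose by (auto simp: factor_map_def)
    show "(e' \<circ> p) ` topspace X = topspace Y"
    proof -
      have "(e' \<circ> p) ` topspace X = e' ` e ` topspace Y"
        using p unfolding factor_map_def tZ image_comp[symmetric] by metis
      then show ?thesis using e'e by (simp add: image_image)
    qed
    fix g x assume gx: "g \<in> carrier G" "x \<in> topspace X"
    have px: "p x \<in> topspace Z" using p gx by (auto simp: factor_map_def)
    then have "e' (p x) \<in> topspace Y" using tZ e'e by auto
    then have "\<psi> g (e' (p x)) \<in> topspace Y" using A.element_image gx by blast
    then show "(e' \<circ> p) (\<phi> g x) = \<psi> g ((e' \<circ> p) x)"
      using p gx px e'e by (simp add: factor_map_def \<theta>_def)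
  qed
  then show ?thesis by blast
qed


section \<open>The FC-series\<close>

definition fc_center :: "('a, 'm) monoid_scheme \<Rightarrow> 'a set" where
  "fc_center G =
     {g \<in> carrier G. finite {h \<otimes>\<^bsub>G\<^esub> g \<otimes>\<^bsub>G\<^esub> inv\<^bsub>G\<^esub> h | h. h \<in> carrier G}}"

text \<open>For normal \<open>N\<close>, the subgroup \<open>M \<ge> N\<close> of \<open>G\<close> with \<open>M / N = fc_center (G / N)\<close>.\<close>

definition fc_step :: "('a, 'm) monoid_scheme \<Rightarrow> 'a set \<Rightarrow> 'a set" where
  "fc_step G N = {g \<in> carrier G. N #>\<^bsub>G\<^esub> g \<in> fc_center (G Mod N)}"

text \<open>\<open>F\<close> is the FC-series of \<open>G\<close> indexed by the well-order \<open>r\<close>, whose elements play the role of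
  the ordinals below its order type.  The three clauses treat the least element, successors
  (\<open>\<beta>\<close> is the successor of \<open>\<alpha>\<close> iff its strict predecessors are those \<open>\<le> \<alpha>\<close>) and limits.\<close>

definition fc_series ::
    "('a, 'm) monoid_scheme \<Rightarrow> 'o rel \<Rightarrow> ('o \<Rightarrow> 'a set) \<Rightarrow> bool" where
  "fc_series G r F \<longleftrightarrow> Well_order r \<and>
     (\<forall>\<beta>\<in>Field r. underS r \<beta> = {} \<longrightarrow> F \<beta> = {\<one>\<^bsub>G\<^esub>}) \<and>
     (\<forall>\<alpha>\<in>Field r. \<forall>\<beta>\<in>Field r. underS r \<beta> = under r \<alpha> \<longrightarrow> F \<beta> = fc_step G (F \<alpha>)) \<and>
     (\<forall>\<beta>\<in>Field r. underS r \<beta> \<noteq> {} \<and> (\<nexists>\<alpha>. \<alpha> \<in> Field r \<and> underS r \<beta> = under r \<alpha>) \<longrightarrow>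
        F \<beta> = (\<Union>\<alpha>\<in>underS r \<beta>. F \<alpha>))"

lemma fc_series_exists:
  fixes r :: "'o rel" and G :: "('a, 'm) monoid_scheme"
  assumes r: "Well_order r"
  shows "\<exists>F. fc_series G r F"
proof -
  interpret wo_rel r using r by (simp add: wo_rel_def)
  define H where "H F \<beta> = (if underS \<beta> = {} then {\<one>\<^bsub>G\<^esub>}
      else if \<exists>\<alpha>\<in>Field r. underS \<beta> = under \<alpha>
      then fc_step G (F (SOME \<alpha>. \<alpha> \<in> Field r \<and> underS \<beta> = under \<alpha>))
      else (\<Union>\<alpha>\<in>underS \<beta>. F \<alpha>))" for F and \<beta>
  have inj: "\<alpha> = \<alpha>'" if "\<alpha> \<in> Field r" "\<alpha>' \<in> Field r" "under \<alpha> = under \<alpha>'" for \<alpha> \<alpha>'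
    using that REFL ANTISYM unfolding under_def refl_on_def antisym_def by blast
  have self: "\<alpha> \<in> under \<alpha>" if "\<alpha> \<in> Field r" for \<alpha>
    using that REFL unfolding under_def refl_on_def by blast
  have "adm_wo H"
    unfolding adm_wo_def
  proof (intro allI impI)
    fix f g :: "'o \<Rightarrow> 'a set" and x assume fg: "\<forall>y\<in>underS x. f y = g y"
    show "H f x = H g x"
    proof (cases "\<exists>\<alpha>\<in>Field r. underS x = under \<alpha>")
      case True
      then have "(SOME \<alpha>. \<alpha> \<in> Field r \<and> underS x = under \<alpha>) \<in> underS x"
        using self by (metis (mono_tags, lifting) someI_ex)
      then show ?thesis using fg by (simp add: H_def)
    qed (use fg in \<open>auto simp: H_def\<close>)
  qed
  then have unfold: "worec H \<beta> = H (worec H) \<beta>" for \<beta>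
    using worec_fixpoint by metis
  have "fc_series G r (worec H)"
    unfolding fc_series_def
  proof (intro conjI ballI impI r)
    fix \<beta> assume "underS \<beta> = {}"
    then show "worec H \<beta> = {\<one>\<^bsub>G\<^esub>}"
      using unfold[of \<beta>] by (simp add: H_def)
  next
    fix \<alpha> \<beta> assume ab: "\<alpha> \<in> Field r" "\<beta> \<in> Field r" "underS \<beta> = under \<alpha>"
    have "(SOME \<alpha>'. \<alpha>' \<in> Field r \<and> underS \<beta> = under \<alpha>') = \<alpha>"
      using ab inj by (intro some_equality) auto
    moreover have "underS \<beta> \<noteq> {}" using ab self by blast
    moreover have "\<exists>\<alpha>\<in>Field r. underS \<beta> = under \<alpha>" using ab by blast
    ultimately have "H (worec H) \<beta> = fc_step G (worec H \<alpha>)"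
      unfolding H_def by (simp only: if_True if_False)
    then show "worec H \<beta> = fc_step G (worec H \<alpha>)"
      using unfold[of \<beta>] by (rule trans[rotated])
  next
    fix \<beta> assume l: "underS \<beta> \<noteq> {} \<and> (\<nexists>\<alpha>. \<alpha> \<in> Field r \<and> underS \<beta> = under \<alpha>)"
    then have "H (worec H) \<beta> = (\<Union>\<alpha>\<in>underS \<beta>. worec H \<alpha>)"
      unfolding H_def by (metis (no_types, lifting))
    then show "worec H \<beta> = (\<Union>\<alpha>\<in>underS \<beta>. worec H \<alpha>)"
      using unfold[of \<beta>] by (rule trans[rotated])
  qed
  then show ?thesis by blast
qed

text \<open>The union of all terms of the series.  As the series increases, it is constant from some ordinal
  of cardinality at most \<open>|G|\<close> on; up to isomorphism, the well-orders on the type \<^typ>\<open>'a set\<close>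
  include all ordinals of cardinality at most \<open>2 ^ |G|\<close>, so every term of the series occurs here.\<close>

definition hyper_fc :: "('a, 'm) monoid_scheme \<Rightarrow> 'a set" where
  "hyper_fc G = \<Union> {F \<alpha> | (r :: 'a set rel) F \<alpha>. fc_series G r F \<and> \<alpha> \<in> Field r}"

end

theory Submission
  imports Defs "HOL-Library.Set_Algebras" "HOL-Analysis.Abstract_Topological_Spaces"
    "HOL-Analysis.Function_Topology"
begin

text \<open>Suppose that \<open>N\<close> acts trivially and that \<open>g\<close> has finitely many conjugates modulo \<open>N\<close>.  Proximality
  contracts the finite set of translates of a point under these conjugates to a point, which is fixed by
  all of them; by minimality \<open>g\<close> acts trivially.  Transfinite induction gives one inclusion.

  Conversely, the FC-series becomes stationary at some \<open>N\<close>, and in \<open>\<Gamma> = G / N\<close> all nontrivial conjugacy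
  classes are infinite.  For \<open>a \<notin> N\<close> a minimal proximal action in which \<open>a\<close> moves a point is obtained
  as the orbit closure of a subset \<open>X\<close> of \<open>\<Gamma>\<close> that separates \<open>0\<close> from \<open>- a\<close> and each of whose finite
  patterns recurs at any two places simultaneously, up to a common translation from a finite set.
  It is the union of finite patches.  A patch recurs simultaneously at two places if it occurs
  somewhere in every translate of a finite set \<open>S\<close> and the pattern in which it occurs at every point of \<open>S\<close>
  recurs as well.  Both can be achieved when \<open>S\<close> is sparse, yet contains many conjugated copies of a large
  finite set; such \<open>S\<close> exist because, by a lemma of B. H. Neumann, the elements of a finite set
  can be conjugated away from any finite set.  The occurrences in the translates of \<open>S\<close> are chosen without
  collisions by a counting version of the local lemma.\<close>

section \<open>Groups with infinite conjugacy classes\<close>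

text \<open>The obstacle is that occurrences in all translates of \<open>S\<close> demand many
  copies of a patch, whereas copies with overlapping halos cannot coexist. Only the points
  \<open>c\<close> of a set whose translates \<open>c + Q\<close> are disjoint get a copy of their
  own, at some \<open>c + x\<close> with \<open>x\<close> in \<open>P\<close>. As
  \<open>S = Q - Q + P\<close>, a point \<open>g\<close> for which \<open>g + Q\<close> meets
  \<open>c + Q\<close> finds this copy in \<open>g + S\<close>. Disjointness of the translates
  bounds the number of ways to write a point as \<open>c + x\<close>, which makes collisions rare
  enough for the counting argument. The construction can be iterated because of an invariant: half
  of \<open>P\<close> stays free for every point that has no occurrence yet. An extension may cost
  such a point a quarter of \<open>P\<close> through the old material and a quarter through the new
  copies. Infinite conjugacy classes provide the generic shifts of the pieces of \<open>P\<close>,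
  for which two near coincidences with the same translate are almost always contradictory.
  Countability of the group lets an increasing sequence of finite windows exhaust it.\<close>

definition add_subgroup :: "'b::group_add set \<Rightarrow> bool" where
  "add_subgroup \<Gamma> \<longleftrightarrow> 0 \<in> \<Gamma> \<and> (\<forall>a\<in>\<Gamma>. \<forall>b\<in>\<Gamma>. a + b \<in> \<Gamma>) \<and> (\<forall>a\<in>\<Gamma>. - a \<in> \<Gamma>)"

lemma add_subgroupD:
  assumes "add_subgroup \<Gamma>"
  shows "0 \<in> \<Gamma>" "a \<in> \<Gamma> \<Longrightarrow> b \<in> \<Gamma> \<Longrightarrow> a + b \<in> \<Gamma>" "a \<in> \<Gamma> \<Longrightarrow> - a \<in> \<Gamma>"
    "a \<in> \<Gamma> \<Longrightarrow> b \<in> \<Gamma> \<Longrightarrow> a - b \<in> \<Gamma>"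
  using assms unfolding add_subgroup_def by (auto simp only: diff_conv_add_uminus)

text \<open>The class \<open>group_add\<close> does not assume commutativity, so the order of
  letters matters. These rules flatten a word to a right-nested sum of letters and inverses;
  \<open>add_uminus_conv_diff\<close> is removed where they are used, as it would turn sums back
  into differences.\<close>

lemmas group_word_simps = add.assoc minus_add diff_conv_add_uminus

text \<open>A lemma of B. H. Neumann.  A coset \<open>h + C\<close> missing from the cover is covered by cosets of the other
  subgroups; translating it, so are the cosets of \<open>C\<close> in the cover, and \<open>C\<close> can be eliminated.\<close>

lemma finite_coset_cover:
  fixes \<Gamma> :: "'b::group_add set"
  assumes "add_subgroup \<Gamma>" "finite L" "\<And>g C. (g, C) \<in> L \<Longrightarrow> g \<in> \<Gamma> \<and> add_subgroup C"
    and "\<Gamma> \<subseteq> (\<Union>(g, C)\<in>L. (+) g ` C)"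
  shows "\<exists>C\<in>snd ` L. \<exists>R. finite R \<and> \<Gamma> \<subseteq> (\<Union>r\<in>R. (+) r ` C)"
  using assms(2-)
proof (induction "card (snd ` L)" arbitrary: L rule: less_induct)
  case less
  note \<Gamma> = add_subgroupD[OF assms(1)]
  from less.prems \<Gamma>(1) obtain g0 C where C: "(g0, C) \<in> L" by fastforce
  then have C': "add_subgroup C" using less.prems by blast
  define R where "R = {g. (g, C) \<in> L}"
  have finR: "finite R"
    using finite_imageI[OF less.prems(1), of fst] by (rule finite_subset[rotated]) (force simp: R_def)
  have R\<Gamma>: "r \<in> \<Gamma>" if "r \<in> R" for r using that less.prems(2) by (auto simp: R_def)
  show ?case
  proof (cases "\<Gamma> \<subseteq> (\<Union>r\<in>R. (+) r ` C)")
    case True then show ?thesis using C finR by force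
  next
    case False
    then obtain h where h: "h \<in> \<Gamma>" "\<And>r c. r \<in> R \<Longrightarrow> c \<in> C \<Longrightarrow> h \<noteq> r + c" by blast
    define L' where "L' = {(g, C') \<in> L. C' \<noteq> C}"
    define L'' where "L'' = L' \<union> (\<lambda>(r, (g, C')). (r - h + g, C')) ` (R \<times> L')"
    have L'L: "L' \<subseteq> L" by (auto simp: L'_def)
    have fin': "finite L'" using L'L less.prems(1) finite_subset by blast
    have fin'': "finite L''" using fin' finR by (simp add: L''_def)
    have snd'': "snd ` L'' \<subseteq> snd ` L - {C}" by (force simp: L''_def L'_def)
    have "card (snd ` L'') < card (snd ` L)"
    proof (rule psubset_card_mono)
      show "finite (snd ` L)" using less.prems(1) by simp
      have "C \<in> snd ` L" using imageI[OF C, of snd] by simp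
      moreover have "A \<subset> B" if "A \<subseteq> B - {c}" "c \<in> B" for A B and c :: "'b set" using that by blast
      ultimately show "snd ` L'' \<subset> snd ` L" using snd'' by simp
    qed
    moreover have "g \<in> \<Gamma> \<and> add_subgroup C'" if gC: "(g, C') \<in> L''" for g C'
    proof (cases "(g, C') \<in> L'")
      case True
      then show ?thesis using less.prems(2) L'L by blast
    next
      case False
      then obtain r g1 where "r \<in> R" "(g1, C') \<in> L" "g = r - h + g1"
        using gC L'L by (auto simp: L''_def)
      moreover from this have "g1 \<in> \<Gamma>" "add_subgroup C'" using less.prems(2) by blast+
      ultimately show ?thesis using R\<Gamma> h(1) \<Gamma>(2,4) by simp
    qed
    moreover have "\<Gamma> \<subseteq> (\<Union>(g, C)\<in>L''. (+) g ` C)"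
    proof
      fix x assume x: "x \<in> \<Gamma>"
      then obtain g C' c where gc: "(g, C') \<in> L" "c \<in> C'" "x = g + c" using less.prems(3) by fastforce
      show "x \<in> (\<Union>(g, C)\<in>L''. (+) g ` C)"
      proof (cases "C' = C")
        case False
        then have "(g, C') \<in> L''" using gc by (simp add: L''_def L'_def)
        then show ?thesis using gc by blast
      next
        case True
        then have g: "g \<in> R" and c: "c \<in> C" using gc by (auto simp: R_def)
        have "c = - g + x" using gc by simp
        then have "h + c \<in> \<Gamma>" using \<Gamma> h(1) R\<Gamma>[OF g] x by simp
        then obtain g1 C1 c1 where g1: "(g1, C1) \<in> L" "c1 \<in> C1" "h + c = g1 + c1"
          using less.prems(3) by fastforce
        \<comment> \<open>Otherwise \<open>h\<close> itself would lie in the coset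
          \<open>g1 + C\<close> of the cover, contrary to its choice.\<close>
        have "C1 \<noteq> C"
        proof
          assume "C1 = C"
          then have "g1 \<in> R" "c1 - c \<in> C"
            using g1 c add_subgroupD[OF C'] by (auto simp: R_def)
          moreover have "h = g1 + (c1 - c)"
            using g1(3) by (simp add: add_diff_eq flip: g1(3))
          ultimately show False using h(2) by blast
        qed
        then have "(g - h + g1, C1) \<in> L''" using g g1 by (force simp: L''_def L'_def)
        moreover have "x = (g - h + g1) + c1"
          using g1(3)[symmetric] gc(3) by (simp add: group_word_simps del: add_uminus_conv_diff)
        ultimately show ?thesis using g1(2) by blast
      qed
    qed
    ultimately obtain D where D: "D \<in> snd ` L''" "\<exists>R. finite R \<and> \<Gamma> \<subseteq> (\<Union>r\<in>R. (+) r ` D)"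
      using less.hyps[OF _ fin''] by meson
    have "D \<in> snd ` L" using subsetD[OF snd'' D(1)] by (rule DiffD1)
    then show ?thesis using D(2) by (rule bexI[rotated])
  qed
qed

text \<open>The trivial group qualifies, so infinity of the group is a separate assumption where it
  matters.\<close>

definition icc :: "'b::group_add set \<Rightarrow> bool" where
  "icc \<Gamma> \<longleftrightarrow> add_subgroup \<Gamma> \<and> (\<forall>a\<in>\<Gamma>. a \<noteq> 0 \<longrightarrow> infinite ((\<lambda>y. y + a - y) ` \<Gamma>))"

text \<open>For fixed \<open>a\<close> and \<open>b\<close>, the \<open>y\<close> with
  \<open>y + a - y = b\<close> form a coset of the centralizer of \<open>a\<close>. If every
  \<open>y\<close> failed, such cosets and the points of \<Lambda> would cover the group, and by
  Neumann's lemma \<open>{0}\<close> or the centralizer of some \<open>a \<noteq> 0\<close> would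
  have finite index. The former contradicts infinity, the latter \<open>icc\<close>.\<close>

lemma icc_switching:
  assumes "icc \<Gamma>" "infinite \<Gamma>" "finite \<Lambda>" "\<Lambda> \<subseteq> \<Gamma>"
  obtains y where "y \<in> \<Gamma>" "y \<notin> \<Lambda>" "\<And>a. a \<in> \<Lambda> \<Longrightarrow> a \<noteq> 0 \<Longrightarrow> y + a - y \<notin> \<Lambda>"
proof (rule ccontr)
  assume "\<not> thesis"
  with that have bad: "y \<in> \<Lambda> \<or> (\<exists>a\<in>\<Lambda>. a \<noteq> 0 \<and> y + a - y \<in> \<Lambda>)" if "y \<in> \<Gamma>" for y
    using \<open>y \<in> \<Gamma>\<close> by blast
  have sg: "add_subgroup \<Gamma>" using assms(1) by (simp add: icc_def)
  note \<Gamma> = add_subgroupD[OF sg]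
  define Z where "Z a = {c \<in> \<Gamma>. c + a = a + c}" for a
  have Z: "add_subgroup (Z a)" for a
    unfolding add_subgroup_def
  proof (intro conjI ballI)
    fix c d assume cd: "c \<in> Z a" "d \<in> Z a"
    have "(c + d) + a = c + (a + d)" using cd by (simp add: Z_def add.assoc)
    also have "\<dots> = a + (c + d)" using cd by (simp add: Z_def flip: add.assoc)
    finally show "c + d \<in> Z a" using cd \<Gamma> by (simp add: Z_def)
  next
    fix c assume c: "c \<in> Z a"
    then have "- c + (c + a) + - c = - c + (a + c) + - c" by (simp add: Z_def)
    then have "- c + a = a + - c" by (simp add: group_word_simps del: add_uminus_conv_diff)
    then show "- c \<in> Z a" using c \<Gamma> by (simp add: Z_def)
  qed (use \<Gamma> in \<open>simp add: Z_def\<close>)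
  define P where "P = {(a, b) \<in> \<Lambda> \<times> \<Lambda>. a \<noteq> 0 \<and> (\<exists>y\<in>\<Gamma>. y + a - y = b)}"
  define w where "w a b = (SOME y. y \<in> \<Gamma> \<and> y + a - y = b)" for a b
  have w: "w a b \<in> \<Gamma>" "w a b + a - w a b = b" if "(a, b) \<in> P" for a b
    using someI_ex[of "\<lambda>y. y \<in> \<Gamma> \<and> y + a - y = b"] that by (auto simp: P_def w_def)
  define L where "L = (\<lambda>y. (y, {0})) ` \<Lambda> \<union> (\<lambda>(a, b). (w a b, Z a)) ` P"
  have finP: "finite P" by (rule finite_subset[of _ "\<Lambda> \<times> \<Lambda>"]) (use assms in \<open>auto simp: P_def\<close>)
  have "\<exists>C\<in>snd ` L. \<exists>R. finite R \<and> \<Gamma> \<subseteq> (\<Union>r\<in>R. (+) r ` C)"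
  proof (rule finite_coset_cover[OF sg])
    show "finite L" using finP assms by (simp add: L_def)
    show "g \<in> \<Gamma> \<and> add_subgroup C" if "(g, C) \<in> L" for g C
      using that assms(4) w Z by (fastforce simp: L_def add_subgroup_def[of "{0}"])
    show "\<Gamma> \<subseteq> (\<Union>(g, C)\<in>L. (+) g ` C)"
    proof
      fix y assume y: "y \<in> \<Gamma>"
      show "y \<in> (\<Union>(g, C)\<in>L. (+) g ` C)"
      proof (cases "y \<in> \<Lambda>")
        case True
        then have "(y, {0}) \<in> L" by (simp add: L_def)
        then show ?thesis by force
      next
        case False
        with bad[OF y] obtain a where a: "a \<in> \<Lambda>" "a \<noteq> 0" "y + a - y \<in> \<Lambda>" by blast
        define b where "b = y + a - y"
        have ab: "(a, b) \<in> P" using a y by (auto simp: P_def b_def)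
        note wab = w[OF ab]
        have "- w a b + ((w a b + a - w a b) + y) = - w a b + ((y + a - y) + y)"
          using wab(2) b_def by simp
        then have "- w a b + y \<in> Z a" using wab(1) y \<Gamma>
          by (simp add: Z_def group_word_simps del: add_uminus_conv_diff)
        moreover have "y = w a b + (- w a b + y)" by simp
        moreover have "(w a b, Z a) \<in> L" using ab by (force simp: L_def)
        ultimately show ?thesis by blast
      qed
    qed
  qed
  then obtain C R where C: "C \<in> snd ` L" "finite R" "\<Gamma> \<subseteq> (\<Union>r\<in>R. (+) r ` C)" by blast
  then consider "C = {0}" | a where "C = Z a" "a \<in> \<Lambda>" "a \<noteq> 0" by (force simp: L_def P_def)
  then show False
  proof cases
    case 1
    then have "\<Gamma> \<subseteq> R" using C by auto
    then show False using C assms finite_subset by blast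
  next
    case 2
    \<comment> \<open>Conjugation of \<open>a\<close> by \<open>r + c\<close> with \<open>c\<close>
      in the centralizer depends only on \<open>r\<close>, so finite index makes the conjugacy class
      finite.\<close>
    have "(\<lambda>y. y + a - y) ` \<Gamma> \<subseteq> (\<lambda>y. y + a - y) ` R"
    proof
      fix x assume "x \<in> (\<lambda>y. y + a - y) ` \<Gamma>"
      then obtain y where y: "y \<in> \<Gamma>" "x = y + a - y" by blast
      then obtain r c where rc: "r \<in> R" "c \<in> Z a" "y = r + c" using C 2 by blast
      have "x = r + (c + a) + - c + - r" using y rc by (simp add: group_word_simps del: add_uminus_conv_diff)
      also have "\<dots> = r + a - r" using rc by (simp add: Z_def group_word_simps del: add_uminus_conv_diff)
      finally show "x \<in> (\<lambda>y. y + a - y) ` R" using rc by blast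
    qed
    then have "finite ((\<lambda>y. y + a - y) ` \<Gamma>)" using C(2) finite_subset by blast
    then show False using 2 assms by (auto simp: icc_def)
  qed
qed

text \<open>The bound 12 exceeds the length of all words that occur below.\<close>

definition words :: "'b::group_add set \<Rightarrow> 'b set" where
  "words A = sum_list ` {xs. set xs \<subseteq> A \<and> length xs \<le> 12}"

lemma finite_words: "finite A \<Longrightarrow> finite (words A)"
  unfolding words_def by (intro finite_imageI finite_lists_length_le)

lemma wordsI: "x = sum_list xs \<Longrightarrow> set xs \<subseteq> A \<Longrightarrow> length xs \<le> 12 \<Longrightarrow> x \<in> words A"
  by (auto simp: words_def)

lemma words_subset:
  assumes "add_subgroup \<Gamma>" "A \<subseteq> \<Gamma>"
  shows "words A \<subseteq> \<Gamma>"
proof -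
  have "sum_list xs \<in> \<Gamma>" if "set xs \<subseteq> A" for xs
    using that by (induction xs) (use assms add_subgroupD[OF assms(1)] in auto)
  then show ?thesis by (auto simp: words_def)
qed

text \<open>A substitute for freeness over \<open>E\<close>: the inequalities between short words that are needed below
  can be reduced to these two properties of the last \<open>y n\<close> that occurs.\<close>

definition generic_seq :: "'b::group_add set \<Rightarrow> (nat \<Rightarrow> 'b) \<Rightarrow> bool" where
  "generic_seq E y \<longleftrightarrow> (\<exists>\<Lambda>. (\<forall>n. E \<subseteq> \<Lambda> n \<and> uminus ` \<Lambda> n \<subseteq> \<Lambda> n) \<and> (\<forall>i n. i < n \<longrightarrow> y i \<in> \<Lambda> n) \<and>
     (\<forall>n. y n \<notin> words (\<Lambda> n) \<and> (\<forall>a\<in>words (\<Lambda> n). a \<noteq> 0 \<longrightarrow> y n + a - y n \<notin> words (\<Lambda> n))))"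

text \<open>Each \<open>y n\<close> is a switching element for the words over a set that collects
  \<open>E\<close> and the earlier terms with their inverses. Closure under inverses makes every
  group word in these letters a plain sum of letters.\<close>

lemma generic_seq_exists:
  fixes \<Gamma> :: "'b::group_add set"
  assumes "icc \<Gamma>" "infinite \<Gamma>" "finite E" "E \<subseteq> \<Gamma>" "uminus ` E \<subseteq> E"
  obtains y where "generic_seq E y" "\<And>n. y n \<in> \<Gamma>"
proof -
  have sg: "add_subgroup \<Gamma>" using assms(1) by (simp add: icc_def)
  define P where "P = (\<lambda>(\<Lambda>, y). finite \<Lambda> \<and> \<Lambda> \<subseteq> \<Gamma> \<and> E \<subseteq> \<Lambda> \<and> uminus ` \<Lambda> \<subseteq> \<Lambda> \<and> y \<in> \<Gamma> \<and>
     y \<notin> words \<Lambda> \<and> (\<forall>a\<in>words \<Lambda>. a \<noteq> 0 \<longrightarrow> y + a - y \<notin> words \<Lambda>))"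
  have ex: "\<exists>y. P (\<Lambda>, y)" if \<Lambda>: "finite \<Lambda>" "\<Lambda> \<subseteq> \<Gamma>" "E \<subseteq> \<Lambda>" "uminus ` \<Lambda> \<subseteq> \<Lambda>" for \<Lambda>
  proof -
    obtain y where "y \<in> \<Gamma>" "y \<notin> words \<Lambda>" "\<And>a. a \<in> words \<Lambda> \<Longrightarrow> a \<noteq> 0 \<Longrightarrow> y + a - y \<notin> words \<Lambda>"
      using icc_switching[OF assms(1,2) finite_words[OF \<Lambda>(1)] words_subset[OF sg \<Lambda>(2)]] by metis
    then show ?thesis using \<Lambda> by (auto simp: P_def)
  qed
  have "\<exists>f. \<forall>n. P (f n) \<and> fst (f (Suc n)) = fst (f n) \<union> {snd (f n), - snd (f n)}"
  proof (rule dependent_nat_choice)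
    show "\<exists>x. P x" using ex[of E] assms by blast
  next
    fix x :: "'b set \<times> 'b" and n :: nat
    assume x: "P x"
    let ?\<Lambda> = "fst x \<union> {snd x, - snd x}"
    have "\<exists>y. P (?\<Lambda>, y)"
      by (rule ex) (use x add_subgroupD(3)[OF sg] in \<open>auto simp: P_def split: prod.splits\<close>)
    then show "\<exists>z. P z \<and> fst z = ?\<Lambda>" by force
  qed
  then obtain f where f: "\<And>n. P (f n)" "\<And>n. fst (f (Suc n)) = fst (f n) \<union> {snd (f n), - snd (f n)}"
    by blast
  have mono: "snd (f i) \<in> fst (f n)" if "i < n" for i n
    using that by (induction n) (auto simp: f(2) less_Suc_eq)
  have "generic_seq E (\<lambda>n. snd (f n))"
    unfolding generic_seq_def
  proof (intro exI[of _ "\<lambda>n. fst (f n)"] conjI allI impI ballI)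
  qed (use f(1) mono in \<open>auto simp: P_def split_beta\<close>)
  moreover have "snd (f n) \<in> \<Gamma>" for n using f(1)[of n] by (simp add: P_def split_beta)
  ultimately show thesis by (rule that)
qed

text \<open>An equality could be solved for the term of larger index, making it a short word in
  \<open>E\<close> and an earlier term.\<close>

lemma generic_seq_distinct:
  assumes "generic_seq E y" "i \<noteq> j" "{a, b, c, d} \<subseteq> E"
  shows "a + y i + b \<noteq> c + y j + d"
proof -
  obtain \<Lambda> where \<Lambda>: "\<And>n. E \<subseteq> \<Lambda> n" "\<And>n x. x \<in> \<Lambda> n \<Longrightarrow> - x \<in> \<Lambda> n" "\<And>i n. i < n \<Longrightarrow> y i \<in> \<Lambda> n"
    "\<And>n. y n \<notin> words (\<Lambda> n)"
    using assms(1) unfolding generic_seq_def by (metis image_subset_iff)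
  have *: False if "i < j" "a + y i + b = c + y j + d" "{a, b, c, d} \<subseteq> E" for i j a b c d
  proof -
    have "y j = - c + (c + y j + d) + - d" by (simp add: group_word_simps del: add_uminus_conv_diff)
    also have "\<dots> = sum_list [- c, a, y i, b, - d]"
      unfolding that(2)[symmetric] by (simp add: group_word_simps del: add_uminus_conv_diff)
    finally have "y j \<in> words (\<Lambda> j)"
      by (rule wordsI) (use that \<Lambda>(1)[of j] \<Lambda>(2,3) in auto)
    then show False using \<Lambda>(4) by blast
  qed
  show ?thesis
    using *[of i j a b c d] *[of j i c d a b] assms(2,3) by (metis insert_commute linorder_neqE_nat)
qed

text \<open>The equation says that conjugation by \<open>y i\<close> takes \<open>v\<close> to the
  short word \<open>- b + a\<close>, which switching forbids unless \<open>v\<close>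
  vanishes.\<close>

lemma generic_seq_switch:
  assumes "generic_seq E y" "{a, b, v} \<subseteq> E" "a + y i = b + y i + v"
  shows "v = 0"
proof (rule ccontr)
  assume v: "v \<noteq> 0"
  obtain \<Lambda> where \<Lambda>: "\<And>n. E \<subseteq> \<Lambda> n" "\<And>n x. x \<in> \<Lambda> n \<Longrightarrow> - x \<in> \<Lambda> n"
    "\<And>n a. a \<in> words (\<Lambda> n) \<Longrightarrow> a \<noteq> 0 \<Longrightarrow> y n + a - y n \<notin> words (\<Lambda> n)"
    using assms(1) unfolding generic_seq_def by (metis image_subset_iff)
  have "v \<in> words (\<Lambda> i)" by (rule wordsI[of _ "[v]"]) (use assms \<Lambda>(1) in auto)
  moreover have "y i + v - y i = - b + (b + y i + v) + - y i"
    by (simp add: group_word_simps del: add_uminus_conv_diff)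
  then have "y i + v - y i = sum_list [- b, a]"
    unfolding assms(3)[symmetric] by (simp add: group_word_simps del: add_uminus_conv_diff)
  then have "y i + v - y i \<in> words (\<Lambda> i)"
    by (rule wordsI) (use assms \<Lambda>(1)[of i] \<Lambda>(2) in auto)
  ultimately show False using \<Lambda>(3) v by blast
qed

text \<open>Eliminating \<open>g\<close> leaves one word equation in \<open>y i\<close>,
  \<open>y j\<close>, \<open>y i'\<close>, \<open>y j'\<close>. Its letter of largest index occurs
  once, and is then a word in earlier letters, or twice, around a word that it conjugates into a
  short one. The case \<open>j = i'\<close> is excluded because there \<open>y i'\<close> can occur
  twice with the same sign, which is not a conjugation.\<close>

lemma generic_seq_pair:
  assumes "generic_seq E y" "i < i'" "j \<noteq> i'" "{q, d, v, q', d', v'} \<subseteq> E" "v \<noteq> 0" "v' \<noteq> 0"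
    and "g + q + y i = d + y j + v" "g + q' + y i' = d' + y j' + v'"
  shows False
proof -
  obtain \<Lambda> where \<Lambda>: "\<And>n. E \<subseteq> \<Lambda> n" "\<And>n x. x \<in> \<Lambda> n \<Longrightarrow> - x \<in> \<Lambda> n" "\<And>i n. i < n \<Longrightarrow> y i \<in> \<Lambda> n"
    "\<And>n. y n \<notin> words (\<Lambda> n)"
    "\<And>n a. a \<in> words (\<Lambda> n) \<Longrightarrow> a \<noteq> 0 \<Longrightarrow> y n + a - y n \<notin> words (\<Lambda> n)"
    using assms(1) unfolding generic_seq_def by (metis image_subset_iff)
  have E: "x \<in> \<Lambda> n" if "x \<in> {q, d, v, q', d', v'}" for x n using that assms(4) \<Lambda>(1) by blast
  have g: "g = d + y j + v + - y i + - q"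
    using assms(7) by (metis add.assoc add_minus_cancel eq_neg_iff_add_eq_0 minus_add_cancel right_minus add.right_neutral)
  have eq: "d + y j + v + - y i + - q + q' + y i' = d' + y j' + v'"
    using assms(8) unfolding g .
  consider "j < i'" "j' < i'" | "j < i'" "j' = i'" | "j' > i'" "j < j'" | "j > i'" "j' < j" | "j = j'" "j > i'"
    using assms(3) by linarith
  then show False
  proof cases
    case 1
    have "y i' = - q' + q + y i + - v + - y j + - d + (d + y j + v + - y i + - q + q' + y i')"
      by (simp add: group_word_simps del: add_uminus_conv_diff)
    then have "y i' = sum_list [- q', q, y i, - v, - y j, - d, d', y j', v']"
      unfolding eq by (simp add: group_word_simps del: add_uminus_conv_diff)
    then have "y i' \<in> words (\<Lambda> i')" by (rule wordsI) (use 1 assms(2) E \<Lambda>(2,3) in auto)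
    then show False using \<Lambda>(4) by blast
  next
    case 2
    have "y i' + v' - y i' = - d' + (d' + y j' + v') + - y i'"
      using 2 by (simp add: group_word_simps del: add_uminus_conv_diff)
    then have "y i' + v' - y i' = sum_list [- d', d, y j, v, - y i, - q, q']"
      unfolding eq[symmetric] by (simp add: group_word_simps del: add_uminus_conv_diff)
    then have "y i' + v' - y i' \<in> words (\<Lambda> i')"
      by (rule wordsI) (use 2 assms(2) E \<Lambda>(2,3) in auto)
    moreover have "v' \<in> words (\<Lambda> i')" by (rule wordsI[of _ "[v']"]) (use E in auto)
    ultimately show False using \<Lambda>(5) assms(6) by blast
  next
    case 3
    have "y j' = - d' + (d' + y j' + v') + - v'"
      by (simp add: group_word_simps del: add_uminus_conv_diff)
    then have "y j' = sum_list [- d', d, y j, v, - y i, - q, q', y i', - v']"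
      unfolding eq[symmetric] by (simp add: group_word_simps del: add_uminus_conv_diff)
    then have "y j' \<in> words (\<Lambda> j')" by (rule wordsI) (use 3 assms(2) E \<Lambda>(2,3) in auto)
    then show False using \<Lambda>(4) by blast
  next
    case 4
    have "y j = - d + (d + y j + v + - y i + - q + q' + y i') + - y i' + - q' + q + y i + - v"
      by (simp add: group_word_simps del: add_uminus_conv_diff)
    then have "y j = sum_list [- d, d', y j', v', - y i', - q', q, y i, - v]"
      unfolding eq by (simp add: group_word_simps del: add_uminus_conv_diff)
    then have "y j \<in> words (\<Lambda> j)" by (rule wordsI) (use 4 assms(2) E \<Lambda>(2,3) in auto)
    then show False using \<Lambda>(4) by blast
  next
    case 5
    \<comment> \<open>Here \<open>y j\<close> conjugates \<open>e\<close> to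
      \<open>- d' + d\<close>. Switching forces \<open>e = 0\<close>, and this expresses
      \<open>y i'\<close> by letters available before it.\<close>
    define e where "e = v' + - y i' + - q' + q + y i + - v"
    have "y j + e - y j = - d' + (d' + y j' + v') + - y i' + - q' + q + y i + - v + - y j"
      using 5 by (simp add: e_def group_word_simps del: add_uminus_conv_diff)
    then have conj_e: "y j + e - y j = - d' + d"
      unfolding eq[symmetric] by (simp add: group_word_simps del: add_uminus_conv_diff)
    have "e = sum_list [v', - y i', - q', q, y i, - v]"
      by (simp add: e_def group_word_simps del: add_uminus_conv_diff)
    then have "e \<in> words (\<Lambda> j)" by (rule wordsI) (use 5 assms(2) E \<Lambda>(2,3) in auto)
    moreover have "- d' + d \<in> words (\<Lambda> j)"
      by (rule wordsI[of _ "[- d', d]"]) (use E \<Lambda>(2) in auto)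
    ultimately have "e = 0" using \<Lambda>(5) conj_e by force
    have "y i' = - q' + q + y i + - v + - e + v'"
      by (simp add: e_def group_word_simps del: add_uminus_conv_diff)
    then have "y i' = sum_list [- q', q, y i, - v, v']"
      using \<open>e = 0\<close> by (simp add: group_word_simps del: add_uminus_conv_diff)
    then have "y i' \<in> words (\<Lambda> i')" by (rule wordsI) (use 5 assms(2) E \<Lambda>(2,3) in auto)
    then show False using \<Lambda>(4) by blast
  qed
qed

text \<open>If \<open>j\<close> belongs to the smallest hit, \<open>generic_seq_pair\<close>
  identifies every larger hit with \<open>j\<close>, so there is at most one larger hit.\<close>

lemma generic_seq_hits:
  assumes "generic_seq E y"
  defines "I \<equiv> \<lambda>g. {i. \<exists>q d v j. {q, d, v} \<subseteq> E \<and> v \<noteq> 0 \<and> g + q + y i = d + y j + v}"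
  shows "finite (I g)" "card (I g) \<le> 2"
proof -
  have *: False if "i1 \<in> I g" "i2 \<in> I g" "i3 \<in> I g" "i1 < i2" "i2 < i3" for i1 i2 i3
  proof -
    obtain q d v j where 1: "{q, d, v} \<subseteq> E" "v \<noteq> 0" "g + q + y i1 = d + y j + v"
      using \<open>i1 \<in> I g\<close> by (auto simp: I_def)
    have "j = i'" if "i' \<in> I g" "i1 < i'" for i'
    proof (rule ccontr)
      assume ne: "j \<noteq> i'"
      obtain q' d' v' j' where 2: "{q', d', v'} \<subseteq> E" "v' \<noteq> 0" "g + q' + y i' = d' + y j' + v'"
        using \<open>i' \<in> I g\<close> by (auto simp: I_def)
      show False
        by (rule generic_seq_pair[OF assms(1) \<open>i1 < i'\<close> ne _ 1(2) 2(2) 1(3) 2(3)]) (use 1 2 in auto)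
    qed
    then show False using that by (metis less_trans nat_neq_iff)
  qed
  have le: "card T \<le> 2" if "finite T" "T \<subseteq> I g" for T
  proof (rule ccontr)
    assume "\<not> card T \<le> 2"
    then have c: "3 \<le> card T" by simp
    define a b where "a = Min T" and "b = Max T"
    have T: "T \<noteq> {}" using c by auto
    have "card (T - {a, b}) \<ge> 1"
    proof -
      have "card T \<le> card (T - {a, b}) + card {a, b}"
        using that by (metis card_Un_le card_mono finite.emptyI finite.insertI finite_Diff finite_UnI Un_Diff_cancel2 Un_upper1 order_trans)
      moreover have "card {a, b} \<le> 2" by (simp add: card_insert_le_m1)
      ultimately show ?thesis using c by linarith
    qed
    then obtain m where m: "m \<in> T" "m \<noteq> a" "m \<noteq> b"
      by (metis Diff_iff card.empty equals0I insertCI not_one_le_zero)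
    have "a \<in> T" "b \<in> T" "a \<le> m" "m \<le> b" using that T m by (auto simp: a_def b_def)
    then show False using *[of a m b] m that by force
  qed
  show "finite (I g)"
  proof (rule ccontr)
    assume "infinite (I g)"
    then obtain T where "T \<subseteq> I g" "finite T" "card T = 3" using infinite_arbitrarily_large by blast
    then show False using le[of T] by simp
  qed
  then show "card (I g) \<le> 2" using le by blast
qed

section \<open>Spread selections\<close>

text \<open>A bad set lists pairs of an index and a choice; an admissible selection must not make
  all of these choices at once. Functions are extensional so that selections can be counted.\<close>

definition selections :: "('i \<times> 'o) set set \<Rightarrow> ('i \<Rightarrow> 'o set) \<Rightarrow> 'i set \<Rightarrow> ('i \<Rightarrow> 'o) set" where
  "selections \<B> Opt C = {f \<in> PiE C Opt. \<forall>b\<in>\<B>. \<not> b \<subseteq> (\<lambda>c. (c, f c)) ` C}"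

lemma finite_selections: "finite C \<Longrightarrow> (\<And>c. c \<in> C \<Longrightarrow> finite (Opt c)) \<Longrightarrow> finite (selections \<B> Opt C)"
  unfolding selections_def by (rule finite_subset[OF _ finite_PiE[of C Opt]]) auto

text \<open>Rosenfeld's counting argument, a substitute for the local lemma: by induction each option set
  multiplies the number of admissible selections by \<open>\<beta>\<close>, because the extensions spoilt by a bad set
  \<open>b\<close> are at most as many as the selections that avoid the domain of \<open>b\<close>.\<close>

lemma card_selections_insert:
  fixes \<beta> :: real
  assumes "\<beta> > 0"
    and Opt: "\<And>c. c \<in> U \<Longrightarrow> finite (Opt c)" "\<And>c. c \<in> U \<Longrightarrow> 2 * \<beta> \<le> card (Opt c)"
    and \<B>: "\<And>c x. c \<in> U \<Longrightarrow> x \<in> Opt c \<Longrightarrow> finite {b \<in> \<B>. (c, x) \<in> b}"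
      "\<And>c x. c \<in> U \<Longrightarrow> x \<in> Opt c \<Longrightarrow> (\<Sum>b | b \<in> \<B> \<and> (c, x) \<in> b. (1 / \<beta>) ^ (card b - 1)) \<le> 1 / 2"
    and "finite C" "C \<subseteq> U" "c \<in> U - C"
  shows "\<beta> * card (selections \<B> Opt C) \<le> card (selections \<B> Opt (insert c C))"
  using assms(6-)
proof (induction "card C" arbitrary: C c rule: less_induct)
  case less
  let ?s = "selections \<B> Opt"
  let ?gr = "\<lambda>f. (\<lambda>c. (c, f c)) ` C"
  have cU: "c \<in> U" "c \<notin> C" using less.prems by auto
  have fin: "finite (?s D)" if "D \<subseteq> insert c C" for D
    using that less.prems Opt by (intro finite_selections) (auto intro: finite_subset)
  \<comment> \<open>Iterating the induction hypothesis: deleting the indices in \<open>D\<close>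
    divides the number of selections by at least \<beta> per index.\<close>
  have remove: "\<beta> ^ card D * card (?s (C - D)) \<le> card (?s C)" if "D \<subseteq> C" for D
    using finite_subset[OF that less.prems(1)] that
  proof (induction D rule: finite_induct)
    case (insert d D)
    have "\<beta> * card (?s (C - insert d D)) \<le> card (?s (insert d (C - insert d D)))"
    proof (rule less.hyps)
      show "card (C - insert d D) < card C"
        by (rule psubset_card_mono[OF less.prems(1)]) (use insert.prems in auto)
    qed (use less.prems insert.prems in auto)
    also have "insert d (C - insert d D) = C - D" using insert by auto
    finally have "\<beta> ^ card D * (\<beta> * card (?s (C - insert d D))) \<le> \<beta> ^ card D * card (?s (C - D))"
      using \<open>\<beta> > 0\<close> by (intro mult_left_mono) auto
    also have "\<dots> \<le> card (?s C)" using insert by auto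
    finally show ?case using insert.hyps by (simp add: mult_ac)
  qed simp
  \<comment> \<open>These are the selections that already make all choices of \<open>b\<close> other
    than \<open>x\<close> at \<open>c\<close>; for \<open>(c, x) \<in> b\<close> they are exactly
    those spoilt by \<open>b\<close> when \<open>c\<close> receives \<open>x\<close>.\<close>
  define A where "A x b = {f \<in> ?s C. b - {(c, x)} \<subseteq> ?gr f}" for x b
  have A: "card (A x b) \<le> card (?s C) * (1 / \<beta>) ^ (card b - 1)" if "(c, x) \<in> b" for x b
  proof (cases "A x b = {}")
    case True
    then show ?thesis using \<open>\<beta> > 0\<close> by simp
  next
    case False
    then obtain f0 where f0: "b - {(c, x)} \<subseteq> ?gr f0" by (auto simp: A_def)
    define b' where "b' = b - {(c, x)}"
    define D where "D = fst ` b'"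
    have finb': "finite b'" using f0 less.prems(1) finite_surj unfolding b'_def by blast
    have "inj_on fst (?gr f0)" by (auto simp: inj_on_def)
    then have "inj_on fst b'" using f0 inj_on_subset unfolding b'_def by blast
    then have cardD: "card D = card b - 1"
      using that finb' by (simp add: D_def card_image b'_def)
    have DC: "D \<subseteq> C" using f0 by (auto simp: D_def b'_def)
    \<comment> \<open>On \<open>D\<close> such a selection is dictated by \<open>b\<close>, so it is
      determined by its restriction to \<open>C - D\<close>.\<close>
    have "card (A x b) \<le> card (?s (C - D))"
    proof (rule card_inj_on_le[where f = "\<lambda>f. restrict f (C - D)"])
      show "inj_on (\<lambda>f. restrict f (C - D)) (A x b)"
      proof (rule inj_onI)
        fix f g assume fg: "f \<in> A x b" "g \<in> A x b" "restrict f (C - D) = restrict g (C - D)"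
        have "f z = g z" for z
        proof (cases "z \<in> D")
          case True
          then obtain w where "(z, w) \<in> b'" by (auto simp: D_def)
          then show ?thesis using fg(1,2) by (auto simp: A_def b'_def)
        next
          case False
          show ?thesis
          proof (cases "z \<in> C")
            case True
            then show ?thesis using False fg(3) by (metis Diff_iff restrict_apply')
          next
            case False
            moreover have "f \<in> PiE C Opt" "g \<in> PiE C Opt"
              using fg(1,2) by (simp_all add: A_def selections_def)
            ultimately show ?thesis by (metis PiE_arb)
          qed
        qed
        then show "f = g" by auto
      qed
      show "(\<lambda>f. restrict f (C - D)) ` A x b \<subseteq> ?s (C - D)"
      proof (intro image_subsetI)
        fix f assume f: "f \<in> A x b"
        have gr: "(\<lambda>c. (c, restrict f (C - D) c)) ` (C - D) \<subseteq> ?gr f" by auto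
        have f': "f \<in> PiE C Opt" "\<forall>b\<in>\<B>. \<not> b \<subseteq> ?gr f" using f by (simp_all add: A_def selections_def)
        then have "restrict f (C - D) \<in> PiE (C - D) Opt" by auto
        moreover have "\<forall>b\<in>\<B>. \<not> b \<subseteq> (\<lambda>c. (c, restrict f (C - D) c)) ` (C - D)"
          using f'(2) gr by (meson order_trans)
        ultimately show "restrict f (C - D) \<in> ?s (C - D)" by (simp add: selections_def)
      qed
      show "finite (?s (C - D))" by (rule fin) auto
    qed
    also have "\<dots> \<le> card (?s C) * (1 / \<beta>) ^ card D"
      using remove[OF DC] \<open>\<beta> > 0\<close> by (simp add: power_one_over field_simps)
    finally show ?thesis by (simp add: cardD)
  qed
  define Bad where "Bad = (\<Union>x\<in>Opt c. \<Union>b\<in>{b \<in> \<B>. (c, x) \<in> b}. A x b \<times> {x})"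
  define Good where "Good = ?s C \<times> Opt c - Bad"
  have "card Bad \<le> (\<Sum>x\<in>Opt c. card (\<Union>b\<in>{b \<in> \<B>. (c, x) \<in> b}. A x b \<times> {x}))"
    unfolding Bad_def by (rule card_UN_le[OF Opt(1)[OF cU(1)]])
  also have "\<dots> \<le> (\<Sum>x\<in>Opt c. \<Sum>b | b \<in> \<B> \<and> (c, x) \<in> b. card (A x b \<times> {x}))"
    by (intro sum_mono card_UN_le \<B>(1)[OF cU(1)])
  finally have "real (card Bad) \<le> (\<Sum>x\<in>Opt c. \<Sum>b | b \<in> \<B> \<and> (c, x) \<in> b. real (card (A x b)))"
    unfolding card_cartesian_product_singleton by (simp flip: of_nat_sum add: card_cartesian_product)
  also have "\<dots> \<le> (\<Sum>x\<in>Opt c. \<Sum>b | b \<in> \<B> \<and> (c, x) \<in> b. card (?s C) * (1 / \<beta>) ^ (card b - 1))"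
    by (intro sum_mono A) auto
  also have "\<dots> \<le> (\<Sum>x\<in>Opt c. card (?s C) * (1 / 2))"
    unfolding sum_distrib_left[symmetric] by (intro sum_mono mult_left_mono \<B>(2)[OF cU(1)]) auto
  finally have bad: "real (card Bad) \<le> card (?s C) * real (card (Opt c)) / 2" by (simp add: mult.commute)
  have finprod: "finite (?s C \<times> Opt c)" using fin[of C] Opt(1) cU by auto
  have Badsub: "Bad \<subseteq> ?s C \<times> Opt c" by (auto simp: Bad_def A_def)
  have "real (card Good) = card (?s C) * real (card (Opt c)) - card Bad"
    using card_mono[OF finprod Badsub] card_Diff_subset[OF finite_subset[OF Badsub finprod] Badsub]
    by (simp add: Good_def card_cartesian_product of_nat_diff)
  \<comment> \<open>At most half of the pairs of a selection and an option are spoilt. With at least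
    \<open>2 * \<beta>\<close> options, \<beta> extensions per selection survive on average.\<close>
  then have "card (?s C) * real (card (Opt c)) / 2 \<le> card Good" using bad by linarith
  moreover have "card (?s C) * (2 * \<beta>) \<le> card (?s C) * real (card (Opt c))"
    using Opt(2)[OF cU(1)] by (intro mult_left_mono) auto
  ultimately have "\<beta> * card (?s C) \<le> card Good" by (simp add: mult_ac)
  also have "card Good \<le> card (?s (insert c C))"
  proof (rule card_inj_on_le[where f = "\<lambda>(f, x). f(c := x)"])
    show "inj_on (\<lambda>(f, x). f(c := x)) Good"
    proof (rule inj_onI, clarsimp)
      fix f x g y assume fg: "(f, x) \<in> Good" "(g, y) \<in> Good" "f(c := x) = g(c := y)"
      have "f \<in> PiE C Opt" "g \<in> PiE C Opt" using fg(1,2) by (simp_all add: Good_def selections_def)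
      then have "f c = g c" using cU by (metis PiE_arb)
      then show "f = g \<and> x = y" using fg(3) by (metis fun_upd_eqD fun_upd_triv fun_upd_upd)
    qed
    show "(\<lambda>(f, x). f(c := x)) ` Good \<subseteq> ?s (insert c C)"
    proof (intro image_subsetI, clarify)
      fix f x assume fx: "(f, x) \<in> Good"
      then have f: "f \<in> ?s C" "x \<in> Opt c" by (auto simp: Good_def)
      have gr: "(\<lambda>z. (z, (f(c := x)) z)) ` insert c C = insert (c, x) (?gr f)"
        using cU by (auto simp: image_iff)
      have "\<not> b \<subseteq> insert (c, x) (?gr f)" if b: "b \<in> \<B>" for b
      proof
        assume sub: "b \<subseteq> insert (c, x) (?gr f)"
        have "\<not> b \<subseteq> ?gr f" using f(1) b by (simp add: selections_def)
        with sub have "(c, x) \<in> b" by blast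
        moreover have "f \<in> A x b" using f(1) sub unfolding A_def by blast
        ultimately have "(f, x) \<in> Bad" using f(2) b unfolding Bad_def by blast
        then show False using fx by (simp add: Good_def)
      qed
      moreover have "f(c := x) \<in> PiE (insert c C) Opt"
        using f by (intro PiE_fun_upd) (simp_all add: selections_def)
      ultimately show "f(c := x) \<in> ?s (insert c C)" unfolding selections_def mem_Collect_eq gr by blast
    qed
    show "finite (?s (insert c C))" by (rule fin) auto
  qed
  finally show ?case by simp
qed

lemma selections_nonempty:
  fixes \<beta> :: real
  assumes "\<beta> > 0"
    and Opt: "\<And>c. c \<in> C \<Longrightarrow> finite (Opt c)" "\<And>c. c \<in> C \<Longrightarrow> 2 * \<beta> \<le> card (Opt c)"
    and \<B>: "\<And>c x. c \<in> C \<Longrightarrow> x \<in> Opt c \<Longrightarrow> finite {b \<in> \<B>. (c, x) \<in> b}"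
      "\<And>c x. c \<in> C \<Longrightarrow> x \<in> Opt c \<Longrightarrow> (\<Sum>b | b \<in> \<B> \<and> (c, x) \<in> b. (1 / \<beta>) ^ (card b - 1)) \<le> 1 / 2"
    and "finite C" "{} \<notin> \<B>"
  shows "selections \<B> Opt C \<noteq> {}"
proof -
  have "0 < card (selections \<B> Opt D)" if "D \<subseteq> C" for D
    using finite_subset[OF that \<open>finite C\<close>] that
  proof (induction D rule: finite_induct)
    case empty
    have "selections \<B> Opt {} = {\<lambda>_. undefined}" using \<open>{} \<notin> \<B>\<close> by (auto simp: selections_def)
    then show ?case by simp
  next
    case (insert d D)
    then have "0 < \<beta> * card (selections \<B> Opt D)" using \<open>\<beta> > 0\<close> by simp
    also have "\<dots> \<le> card (selections \<B> Opt (insert d D))"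
      by (rule card_selections_insert[OF \<open>\<beta> > 0\<close> Opt \<B>]) (use insert in auto)
    finally show ?case by simp
  qed
  from this[of C] show ?thesis by force
qed

lemma minus_in_translate:
  fixes V :: "'b::group_add set"
  assumes "uminus ` V \<subseteq> V" "a \<in> (+) b ` V"
  shows "b \<in> (+) a ` V"
proof -
  obtain v where v: "v \<in> V" "a = b + v" using assms(2) by blast
  then have "b = a + - v" by (simp add: group_word_simps del: add_uminus_conv_diff)
  then show ?thesis using assms(1) v(1) by blast
qed

text \<open>Two kinds of bad sets: pairs of choices that are close to each other, and \<open>r + 1\<close> choices that
  are close to a common translate of \<open>O\<close>.\<close>

lemma spread_selection:
  fixes V P :: "'b::group_add set" and Opt :: "'b \<Rightarrow> 'b set"
  assumes "finite C" "finite P" "finite V" "0 \<in> V" "uminus ` V \<subseteq> V"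
    and mult: "\<And>p. card {(c, x) \<in> C \<times> P. c + x = p} \<le> 4"
    and Opt: "\<And>c. c \<in> C \<Longrightarrow> Opt c \<subseteq> P" "\<And>c. c \<in> C \<Longrightarrow> card P \<le> 2 * card (Opt c)"
    and size: "64 * card V \<le> card P" "4 * (r * card V) \<le> card P"
      "real (card P * card V) * (16 * real (card V)) ^ r \<le> fact r / 4"
  obtains f where "\<And>c. c \<in> C \<Longrightarrow> f c \<in> Opt c"
    "\<And>c d. c \<in> C \<Longrightarrow> d \<in> C \<Longrightarrow> c \<noteq> d \<Longrightarrow> c + f c \<notin> (+) (d + f d) ` V"
    "\<And>g. 4 * card {x \<in> P. \<exists>c\<in>C. g + x \<in> (+) (c + f c) ` V} \<le> card P"
proof -
  note sym = minus_in_translate[OF \<open>uminus ` V \<subseteq> V\<close>]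
  have "0 < card V" using \<open>finite V\<close> \<open>0 \<in> V\<close> by (auto simp: card_gt_0_iff)
  then have P0: "0 < card P" using size(1) by linarith
  \<comment> \<open>Option sets have at least \<open>card P / 2\<close> elements, which is
    \<open>2 * \<beta>\<close>.\<close>
  define \<beta> where "\<beta> = real (card P) / 4"
  have "\<beta> > 0" using P0 by (simp add: \<beta>_def)
  define X where "X = C \<times> P"
  have finX: "finite X" using assms by (simp add: X_def)
  have multX: "card {(c, x) \<in> X. c + x \<in> Y} \<le> 4 * card Y" if "finite Y" for Y
  proof -
    have "card {(c, x) \<in> X. c + x \<in> Y} \<le> card (\<Union>p\<in>Y. {(c, x) \<in> X. c + x = p})"
      by (rule card_mono) (use finX that in \<open>auto intro: finite_subset[OF _ finX]\<close>)
    also have "\<dots> \<le> (\<Sum>p\<in>Y. card {(c, x) \<in> X. c + x = p})" by (rule card_UN_le[OF that])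
    also have "\<dots> \<le> (\<Sum>p\<in>Y. 4)" by (intro sum_mono) (use mult in \<open>simp add: X_def\<close>)
    finally show ?thesis by simp
  qed
  define hits where "hits g = {(c, x) \<in> X. \<exists>u\<in>P. g + u \<in> (+) (c + x) ` V}" for g
  have card_hits: "card (hits g) \<le> 4 * (card P * card V)" for g
  proof -
    define Y where "Y = (\<Union>u\<in>P. (+) (g + u) ` V)"
    have "(\<exists>u\<in>P. g + u \<in> (+) p ` V) \<longleftrightarrow> p \<in> Y" for p unfolding Y_def using sym by blast
    then have "hits g = {(c, x) \<in> X. c + x \<in> Y}" by (simp add: hits_def)
    moreover have "finite Y" using assms by (simp add: Y_def)
    ultimately have "card (hits g) \<le> 4 * card Y" using multX[of Y] by simp
    also have "card Y \<le> (\<Sum>u\<in>P. card ((+) (g + u) ` V))" unfolding Y_def by (rule card_UN_le[OF \<open>finite P\<close>])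
    also have "\<dots> \<le> (\<Sum>u\<in>P. card V)" by (intro sum_mono card_image_le \<open>finite V\<close>)
    finally show ?thesis by simp
  qed
  have finhits: "finite (hits g)" for g
    by (rule finite_subset[OF _ finX]) (auto simp: hits_def)
  define \<B>1 where "\<B>1 = {{(c, x), (d, y)} | c x d y.
      (c, x) \<in> X \<and> (d, y) \<in> X \<and> c \<noteq> d \<and> d + y \<in> (+) (c + x) ` V}"
  define \<B>2 where "\<B>2 = {b. b \<subseteq> X \<and> card b = Suc r \<and> (\<exists>g. b \<subseteq> hits g)}"
  have B1: "card {b \<in> \<B>1. (c, x) \<in> b} \<le> 4 * card V" for c x
  proof -
    define Y where "Y = (+) (c + x) ` V"
    have finY: "finite Y" using assms by (simp add: Y_def)
    have "{b \<in> \<B>1. (c, x) \<in> b} \<subseteq> (\<lambda>p. {(c, x), p}) ` {(d, y) \<in> X. d + y \<in> Y}"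
      unfolding \<B>1_def Y_def using sym by fastforce
    then have "card {b \<in> \<B>1. (c, x) \<in> b} \<le> card {(d, y) \<in> X. d + y \<in> Y}"
      by (rule surj_card_le[rotated]) (rule finite_subset[OF _ finX], auto)
    also have "\<dots> \<le> 4 * card Y" by (rule multX[OF finY])
    also have "\<dots> \<le> 4 * card V" unfolding Y_def by (simp add: card_image_le assms)
    finally show ?thesis .
  qed
  \<comment> \<open>Fixing \<open>(c, x)\<close> in \<open>b\<close> leaves at most
    \<open>card P * card V\<close> values of \<open>g\<close>; the other \<open>r\<close> members
    are then chosen from \<open>hits g\<close>, which has at most
    \<open>4 * (card P * card V)\<close> elements.\<close>
  have B2: "card {b \<in> \<B>2. (c, x) \<in> b} \<le> card P * card V * (4 * (card P * card V) choose r)" for c x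
  proof -
    define N where "N g = insert (c, x) ` {b. b \<subseteq> hits g \<and> card b = r}" for g
    define Y where "Y = (\<lambda>(u, v). c + x + v - u) ` (P \<times> V)"
    have "{b \<in> \<B>2. (c, x) \<in> b} \<subseteq> (\<Union>g\<in>Y. N g)"
    proof
      fix b assume "b \<in> {b \<in> \<B>2. (c, x) \<in> b}"
      then obtain g where b: "(c, x) \<in> b" "card b = Suc r" "b \<subseteq> hits g" "b \<subseteq> X" by (auto simp: \<B>2_def)
      then obtain u v where uv: "u \<in> P" "v \<in> V" "g + u = c + x + v" by (auto simp: hits_def)
      then have "g = c + x + v - u" by (metis add_diff_cancel)
      then have "g \<in> Y" using uv by (force simp: Y_def)
      moreover have "finite b" using b(4) finX finite_subset by blast
      then have "card (b - {(c, x)}) = r" "b = insert (c, x) (b - {(c, x)})" using b by auto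
      then have "b \<in> N g" using b(3) unfolding N_def by blast
      ultimately show "b \<in> (\<Union>g\<in>Y. N g)" by blast
    qed
    moreover have finY: "finite Y" using assms by (simp add: Y_def)
    moreover have "finite (N g)" for g
      unfolding N_def by (rule finite_imageI, rule finite_subset[of _ "Pow (hits g)"]) (use finhits in auto)
    ultimately have "card {b \<in> \<B>2. (c, x) \<in> b} \<le> card (\<Union>g\<in>Y. N g)"
      by (intro card_mono) auto
    also have "\<dots> \<le> (\<Sum>g\<in>Y. card (N g))" by (rule card_UN_le[OF finY])
    also have "\<dots> \<le> (\<Sum>g\<in>Y. 4 * (card P * card V) choose r)"
    proof (rule sum_mono)
      fix g
      have "card (N g) \<le> card {b. b \<subseteq> hits g \<and> card b = r}"
        unfolding N_def by (rule card_image_le, rule finite_subset[of _ "Pow (hits g)"]) (use finhits in auto)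
      also have "\<dots> = card (hits g) choose r" by (rule n_subsets[OF finhits])
      also have "\<dots> \<le> 4 * (card P * card V) choose r" by (rule binomial_right_mono[OF card_hits])
      finally show "card (N g) \<le> 4 * (card P * card V) choose r" .
    qed
    also have "\<dots> = card Y * (4 * (card P * card V) choose r)" by simp
    also have "card Y \<le> card (P \<times> V)" unfolding Y_def using assms by (intro card_image_le) auto
    finally show ?thesis by (simp add: card_cartesian_product)
  qed
  have finB: "finite (\<B>1 \<union> \<B>2)"
    by (rule finite_subset[of _ "Pow X"]) (use finX in \<open>auto simp: \<B>1_def \<B>2_def\<close>)
  have "selections (\<B>1 \<union> \<B>2) Opt C \<noteq> {}"
  proof (rule selections_nonempty[OF \<open>\<beta> > 0\<close>])
    show "finite (Opt c)" if "c \<in> C" for c using Opt(1)[OF that] \<open>finite P\<close> finite_subset by blast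
    show "2 * \<beta> \<le> card (Opt c)" if "c \<in> C" for c using Opt(2)[OF that] by (simp add: \<beta>_def)
    show "finite {b \<in> \<B>1 \<union> \<B>2. (c, x) \<in> b}" for c x
      by (rule finite_subset[OF _ finB]) auto
    show "{} \<notin> \<B>1 \<union> \<B>2" by (auto simp: \<B>1_def \<B>2_def)
    fix c x
    let ?w = "\<lambda>b :: ('b \<times> 'b) set. (1 / \<beta>) ^ (card b - 1)"
    \<comment> \<open>Each family is allotted a total weight of 1/4. The condition
      \<open>64 * card V \<le> card P\<close> takes care of the pairs, the factorial bound of the
      larger bad sets.\<close>
    have "(\<Sum>b | b \<in> \<B>1 \<and> (c, x) \<in> b. ?w b) = (\<Sum>b | b \<in> \<B>1 \<and> (c, x) \<in> b. 1 / \<beta>)"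
      by (intro sum.cong) (auto simp: \<B>1_def)
    also have "\<dots> \<le> (4 * card V) * (1 / \<beta>)"
      using B1[of c x] \<open>\<beta> > 0\<close> by (simp add: field_simps)
    also have "\<dots> \<le> 1 / 4" using size(1) P0 by (simp add: \<beta>_def field_simps)
    finally have 1: "(\<Sum>b | b \<in> \<B>1 \<and> (c, x) \<in> b. ?w b) \<le> 1 / 4" .
    have "(\<Sum>b | b \<in> \<B>2 \<and> (c, x) \<in> b. ?w b) = card {b \<in> \<B>2. (c, x) \<in> b} * (1 / \<beta>) ^ r"
      by (simp add: \<B>2_def)
    also have "\<dots> \<le> real (card P * card V * (4 * (card P * card V) choose r)) * (1 / \<beta>) ^ r"
      using B2[of c x] \<open>\<beta> > 0\<close> by (intro mult_right_mono) (simp_all only: of_nat_le_iff, simp)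
    also have "\<dots> \<le> real (card P * card V) * ((4 * (card P * card V)) ^ r / fact r) * (1 / \<beta>) ^ r"
    proof -
      have "real (4 * (card P * card V) choose r) * fact r \<le> real (4 * (card P * card V)) ^ r"
        using binomial_fact_pow[of "4 * (card P * card V)" r]
        by (metis of_nat_fact of_nat_le_iff of_nat_mult of_nat_power)
      then have "real (4 * (card P * card V) choose r) \<le> real (4 * (card P * card V)) ^ r / fact r"
        by (simp add: field_simps)
      then show ?thesis using \<open>\<beta> > 0\<close>
        unfolding of_nat_mult[of "card P * card V"] by (intro mult_right_mono mult_left_mono) auto
    qed
    also have "\<dots> = real (card P * card V) * (4 * (card P * card V) * (1 / \<beta>)) ^ r / fact r"
    proof -
      have "a * (b ^ r / fact r) * d ^ r = a * (b * d) ^ r / fact r" for a b d :: real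
        by (simp add: power_mult_distrib)
      then show ?thesis by (simp only: of_nat_power)
    qed
    also have "4 * (card P * card V) * (1 / \<beta>) = 16 * real (card V)"
      using P0 by (simp add: \<beta>_def)
    also have "real (card P * card V) * (16 * real (card V)) ^ r / fact r \<le> 1 / 4"
      using size(3) by (simp add: field_simps)
    finally have 2: "(\<Sum>b | b \<in> \<B>2 \<and> (c, x) \<in> b. ?w b) \<le> 1 / 4" .
    have "(\<Sum>b | b \<in> \<B>1 \<union> \<B>2 \<and> (c, x) \<in> b. ?w b) \<le>
      (\<Sum>b\<in>{b \<in> \<B>1. (c, x) \<in> b} \<union> {b \<in> \<B>2. (c, x) \<in> b}. ?w b)"
      by (rule eq_refl, rule sum.cong) auto
    also have "\<dots> \<le> (\<Sum>b | b \<in> \<B>1 \<and> (c, x) \<in> b. ?w b) + (\<Sum>b | b \<in> \<B>2 \<and> (c, x) \<in> b. ?w b)"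
    proof -
      have f: "finite {b \<in> \<B>1. (c, x) \<in> b}" "finite {b \<in> \<B>2. (c, x) \<in> b}"
        using finB by (auto intro: finite_subset[OF _ finB])
      have "0 \<le> (\<Sum>b\<in>{b \<in> \<B>1. (c, x) \<in> b} \<inter> {b \<in> \<B>2. (c, x) \<in> b}. ?w b)"
        using \<open>\<beta> > 0\<close> by (intro sum_nonneg) simp
      then show ?thesis using sum.union_inter[OF f, of ?w] by linarith
    qed
    finally show "(\<Sum>b | b \<in> \<B>1 \<union> \<B>2 \<and> (c, x) \<in> b. ?w b) \<le> 1 / 2" using 1 2 by linarith
  qed (use \<open>finite C\<close> in simp)
  then obtain f where f: "f \<in> PiE C Opt" "\<And>b. b \<in> \<B>1 \<union> \<B>2 \<Longrightarrow> \<not> b \<subseteq> (\<lambda>c. (c, f c)) ` C"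
    by (auto simp: selections_def)
  have fX: "(c, f c) \<in> X" if "c \<in> C" for c using that f(1) Opt(1) by (auto simp: X_def)
  show thesis
  proof (rule that[of f])
    show "f c \<in> Opt c" if "c \<in> C" for c using f(1) that by auto
    show "c + f c \<notin> (+) (d + f d) ` V" if "c \<in> C" "d \<in> C" "c \<noteq> d" for c d
    proof
      assume "c + f c \<in> (+) (d + f d) ` V"
      then have "{(d, f d), (c, f c)} \<in> \<B>1" using that fX unfolding \<B>1_def by blast
      then show False using f(2)[of "{(d, f d), (c, f c)}"] that by auto
    qed
    fix g
    define J where "J = {c \<in> C. (c, f c) \<in> hits g}"
    have finJ: "finite J" using \<open>finite C\<close> by (simp add: J_def)
    \<comment> \<open>More than \<open>r\<close> such indices would contain a bad set of the second
      kind. Each index accounts for at most \<open>card V\<close> of the counted \<open>x\<close>,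
      whence the bound \<open>r * card V\<close> below.\<close>
    have "card J \<le> r"
    proof (rule ccontr)
      assume "\<not> card J \<le> r"
      then obtain J' where J': "J' \<subseteq> J" "card J' = Suc r"
        by (metis Suc_leI linorder_not_le obtain_subset_with_card_n)
      have "card ((\<lambda>c. (c, f c)) ` J') = Suc r"
        using J'(2) by (subst card_image) (auto simp: inj_on_def)
      moreover have "(\<lambda>c. (c, f c)) ` J' \<subseteq> hits g" using J'(1) by (auto simp: J_def)
      moreover have "hits g \<subseteq> X" by (auto simp: hits_def)
      ultimately have "(\<lambda>c. (c, f c)) ` J' \<in> \<B>2" unfolding \<B>2_def by blast
      moreover have "(\<lambda>c. (c, f c)) ` J' \<subseteq> (\<lambda>c. (c, f c)) ` C" using J'(1) by (auto simp: J_def)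
      ultimately show False using f(2) by blast
    qed
    have "{x \<in> P. \<exists>c\<in>C. g + x \<in> (+) (c + f c) ` V} \<subseteq> (\<Union>c\<in>J. (\<lambda>v. - g + (c + f c + v)) ` V)"
    proof
      fix x assume "x \<in> {x \<in> P. \<exists>c\<in>C. g + x \<in> (+) (c + f c) ` V}"
      then obtain c v where c: "x \<in> P" "c \<in> C" "v \<in> V" "g + x = c + f c + v" by blast
      then have "c \<in> J" using fX by (auto simp: J_def hits_def)
      moreover have "x = - g + (c + f c + v)" using c(4) by (metis minus_add_cancel)
      ultimately show "x \<in> (\<Union>c\<in>J. (\<lambda>v. - g + (c + f c + v)) ` V)" using c(3) by blast
    qed
    then have "card {x \<in> P. \<exists>c\<in>C. g + x \<in> (+) (c + f c) ` V} \<le> card (\<Union>c\<in>J. (\<lambda>v. - g + (c + f c + v)) ` V)"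
      by (rule card_mono[rotated]) (use finJ assms in auto)
    also have "\<dots> \<le> (\<Sum>c\<in>J. card ((\<lambda>v. - g + (c + f c + v)) ` V))" by (rule card_UN_le[OF finJ])
    also have "\<dots> \<le> (\<Sum>c\<in>J. card V)" by (intro sum_mono card_image_le assms)
    also have "\<dots> \<le> r * card V" using \<open>card J \<le> r\<close> by simp
    finally show "4 * card {x \<in> P. \<exists>c\<in>C. g + x \<in> (+) (c + f c) ` V} \<le> card P" using size(2) by linarith
  qed
qed

text \<open>With \<open>card P = 64 * v * r\<close> this is the last size condition of
  \<open>spread_selection\<close>. Taking \<open>r = Suc n\<close> cancels the linear factor
  \<open>r\<close> against the last factor of \<open>fact r\<close>, so that convergence of the
  exponential series suffices; 256 is 4 times 64.\<close>

lemma spread_parameter: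
  fixes v :: nat
  obtains r where "r \<ge> 1" "real (64 * v * r * v) * (16 * real v) ^ r \<le> fact r / 4"
proof -
  let ?x = "16 * real v"
  have "(\<lambda>n. inverse (fact n) * ?x ^ n) \<longlonglongrightarrow> 0" by (rule summable_LIMSEQ_zero[OF summable_exp])
  then have "(\<lambda>n. (256 * v ^ 2 * ?x) * (inverse (fact n) * ?x ^ n)) \<longlonglongrightarrow> (256 * v ^ 2 * ?x) * 0"
    by (rule tendsto_mult_left)
  then have "\<forall>\<^sub>F n in sequentially. (256 * v ^ 2 * ?x) * (inverse (fact n) * ?x ^ n) < 1"
    by (rule order_tendstoD) simp
  then obtain n where n: "(256 * v ^ 2 * ?x) * (inverse (fact n) * ?x ^ n) < 1"
    by (meson eventually_happens' sequentially_bot)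
  then have "256 * v ^ 2 * ?x * ?x ^ n \<le> fact n" by (simp add: field_simps)
  then have "256 * v ^ 2 * ?x * ?x ^ n * real (Suc n) \<le> fact n * real (Suc n)"
    by (rule mult_right_mono) simp
  moreover have "256 * v ^ 2 * ?x * ?x ^ n * real (Suc n) = 4 * (real (64 * v * Suc n * v) * ?x ^ Suc n)"
  proof -
    have "256 * a ^ 2 * b * p * m = 4 * ((64 * a * m * a) * (b * p))" for a b p m :: real by algebra
    from this[of v ?x "?x ^ n" "real (Suc n)"] show ?thesis
      by (simp only: power_Suc of_nat_mult of_nat_numeral of_nat_power)
  qed
  moreover have "fact (Suc n) = fact n * real (Suc n)" by (simp only: fact_Suc mult.commute)
  ultimately have "real (64 * v * Suc n * v) * ?x ^ Suc n \<le> fact (Suc n) / 4" by linarith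
  then show thesis by (intro that[of "Suc n"]) auto
qed

section \<open>Patch systems\<close>

definition packing :: "'b::group_add set \<Rightarrow> 'b set \<Rightarrow> bool" where
  "packing Q C \<longleftrightarrow> pairwise (\<lambda>c d. disjnt ((+) c ` Q) ((+) d ` Q)) C"

text \<open>The set \<open>S\<close> is sparse relative to \<open>V\<close> although it contains large pieces \<open>Q - Q + Q + y k\<close>.  Four
  pieces are used because a translate of \<open>P\<close> disjoint from \<open>S\<close> comes close to \<open>S\<close> in at most two of them.\<close>

lemma step_parameters:
  fixes \<Gamma> V :: "'b::group_add set"
  assumes "icc \<Gamma>" "infinite \<Gamma>" "finite V" "V \<subseteq> \<Gamma>" "0 \<in> V" "uminus ` V \<subseteq> V"
  obtains Q P S r where "finite Q" "Q \<noteq> {}" "Q \<subseteq> \<Gamma>" "finite P" "P \<noteq> {}" "P \<subseteq> \<Gamma>"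
    "S = {q - q' + x | q q' x. q \<in> Q \<and> q' \<in> Q \<and> x \<in> P}"
    "\<And>C p. finite C \<Longrightarrow> packing Q C \<Longrightarrow> card {(c, x) \<in> C \<times> P. c + x = p} \<le> 4"
    "64 * card V \<le> card P" "4 * (r * card V) \<le> card P"
    "real (card P * card V) * (16 * real (card V)) ^ r \<le> fact r / 4"
    "\<And>s t. s \<in> S \<Longrightarrow> t \<in> S \<Longrightarrow> s \<noteq> t \<Longrightarrow> t \<notin> (+) s ` V"
    "\<And>g. (\<exists>s\<in>S. g + s \<in> S) \<or> 2 * card {x \<in> P. \<exists>s\<in>S. g + x \<in> (+) s ` V} \<le> card P"
proof -
  have sg: "add_subgroup \<Gamma>" using assms(1) by (simp add: icc_def)
  note \<Gamma> = add_subgroupD[OF sg]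
  have V0: "card V > 0" using assms by (auto simp: card_gt_0_iff)
  obtain r where r: "r \<ge> 1" "real (64 * card V * r * card V) * (16 * real (card V)) ^ r \<le> fact r / 4"
    by (rule spread_parameter)
  \<comment> \<open>Chosen so that \<open>card P = 4 * m = 64 * card V * r\<close>, the size treated
    in \<open>spread_parameter\<close>.\<close>
  define m where "m = 16 * card V * r"
  obtain Q where Q: "Q \<subseteq> \<Gamma>" "finite Q" "card Q = m"
    using infinite_arbitrarily_large[OF assms(2)] by blast
  have m0: "m > 0" using r V0 by (simp add: m_def)
  then have Qne: "Q \<noteq> {}" using Q by auto
  \<comment> \<open>This is \<open>Q - Q + Q\<close>, so that every element of \<open>S\<close> has
    the form \<open>d + y k\<close> with \<open>d\<close> in \<open>D\<close>.\<close>
  define D where "D = (\<lambda>(a, b, c). a - b + c) ` (Q \<times> Q \<times> Q)"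
  define E0 where "E0 = insert 0 (Q \<union> D \<union> V)"
  define E where "E = E0 \<union> uminus ` E0"
  have "D \<subseteq> \<Gamma>" using Q(1) unfolding D_def by (auto intro!: \<Gamma>(2,4))
  then have E0\<Gamma>: "E0 \<subseteq> \<Gamma>" using Q(1) assms(4) \<Gamma>(1) by (auto simp: E0_def)
  have "finite E" using Q(2) assms(3) by (simp add: E_def E0_def D_def)
  moreover have "E \<subseteq> \<Gamma>" using E0\<Gamma> \<Gamma>(3) by (auto simp: E_def)
  moreover have "uminus ` E \<subseteq> E" by (auto simp: E_def)
  ultimately obtain y where y: "generic_seq E y" "\<And>n. y n \<in> \<Gamma>"
    by (rule generic_seq_exists[OF assms(1,2)]) blast
  have E: "0 \<in> E" "Q \<subseteq> E" "D \<subseteq> E" "V \<subseteq> E" by (auto simp: E_def E0_def)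
  define R where "R k = (\<lambda>q. q + y k) ` Q" for k
  define P where "P = (\<Union>k<4. R k)"
  define S where "S = {q - q' + x | q q' x. q \<in> Q \<and> q' \<in> Q \<and> x \<in> P}"
  have cardR: "card (R k) = m" for k unfolding R_def by (subst card_image) (use Q in \<open>auto simp: inj_on_def\<close>)
  have finR: "finite (R k)" for k using Q by (simp add: R_def)
  have "card P = (\<Sum>k<4. card (R k))"
    unfolding P_def
  proof (rule card_UN_disjoint; (intro ballI impI)?)
    fix i j :: nat assume "i \<noteq> j"
    then have "q + y i \<noteq> q' + y j" if "q \<in> Q" "q' \<in> Q" for q q'
      using generic_seq_distinct[OF y(1), of i j q 0 q' 0] that E by auto
    then show "R i \<inter> R j = {}" by (auto simp: R_def)
  qed (use finR in auto)
  then have cardP: "card P = 4 * m" by (simp add: cardR)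
  have finP: "finite P" using finR by (simp add: P_def)
  have SD: "\<exists>d\<in>D. \<exists>k. s = d + y k" if "s \<in> S" for s
  proof -
    obtain q q' x where x: "q \<in> Q" "q' \<in> Q" "x \<in> P" "s = q - q' + x"
      using \<open>s \<in> S\<close> by (auto simp: S_def)
    then obtain q'' k where "q'' \<in> Q" "x = q'' + y k" by (auto simp: P_def R_def)
    then have "q - q' + q'' \<in> D" "s = q - q' + q'' + y k"
      using x by (force simp: D_def, simp add: add.assoc)
    then show ?thesis by blast
  qed
  have PS: "x \<in> S" if "x \<in> P" for x
  proof -
    obtain q where "q \<in> Q" using Qne by blast
    then show ?thesis using that unfolding S_def by (intro CollectI exI[of _ q] exI[of _ x]) auto
  qed
  show thesis
  proof (rule that[of Q P S r])
    show "P \<noteq> {}" using cardP m0 by auto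
    show "P \<subseteq> \<Gamma>" using Q(1) y(2) \<Gamma> by (auto simp: P_def R_def)
    show "64 * card V \<le> card P" using r(1) by (simp add: cardP m_def)
    show "4 * (r * card V) \<le> card P" by (simp add: cardP m_def)
    have "card P = 64 * card V * r" by (simp add: cardP m_def)
    then show "real (card P * card V) * (16 * real (card V)) ^ r \<le> fact r / 4" using r(2) by simp
  next
    fix C p assume C: "finite C" "packing Q C"
    define Z where "Z k = {(c, x) \<in> C \<times> R k. c + x = p}" for k
    have finZ: "finite (Z k)" for k
      by (rule finite_subset[of _ "C \<times> R k"]) (use C finR in \<open>auto simp: Z_def\<close>)
    \<comment> \<open>Within one piece, \<open>c + q + y k = p\<close> fixes the point
      \<open>c + q\<close>, and only one of the disjoint translates of \<open>Q\<close> contains it.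
      The four pieces give the bound 4.\<close>
    have "card (Z k) \<le> Suc 0" for k
      unfolding card_le_Suc0_iff_eq[OF finZ]
    proof (intro ballI)
      fix u w assume uw: "u \<in> Z k" "w \<in> Z k"
      obtain c q where u: "u = (c, q + y k)" "c \<in> C" "q \<in> Q" "c + (q + y k) = p"
        using uw(1) by (auto simp: Z_def R_def)
      obtain c' q' where w: "w = (c', q' + y k)" "c' \<in> C" "q' \<in> Q" "c' + (q' + y k) = p"
        using uw(2) by (auto simp: Z_def R_def)
      have "c + q = c' + q'" using u(4) w(4) by (metis add.assoc add_right_cancel)
      then have "\<not> disjnt ((+) c ` Q) ((+) c' ` Q)" using u(3) w(3) unfolding disjnt_def by blast
      then have "c = c'" using C(2) u(2) w(2) by (auto simp: packing_def pairwise_def)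
      then show "u = w" using u w \<open>c + q = c' + q'\<close> by simp
    qed
    moreover have "{(c, x) \<in> C \<times> P. c + x = p} = (\<Union>k<4. Z k)" by (auto simp: Z_def P_def)
    then have "card {(c, x) \<in> C \<times> P. c + x = p} \<le> (\<Sum>k<4. card (Z k))"
      using card_UN_le[of "{..<4::nat}" Z] by simp
    moreover have "(\<Sum>k<4. card (Z k)) \<le> (\<Sum>k<(4::nat). 1)"
      by (rule sum_mono) (use calculation(1) in simp)
    ultimately show "card {(c, x) \<in> C \<times> P. c + x = p} \<le> 4" by simp
  next
    fix s t assume st: "s \<in> S" "t \<in> S" "s \<noteq> t"
    show "t \<notin> (+) s ` V"
    proof
      assume "t \<in> (+) s ` V"
      then obtain v where v: "v \<in> V" "t = s + v" by blast
      obtain d i where d: "d \<in> D" "s = d + y i" using SD[OF st(1)] by blast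
      obtain d' j where d': "d' \<in> D" "t = d' + y j" using SD[OF st(2)] by blast
      have eq: "d' + y j = d + y i + v" using v d d' by simp
      show False
      proof (cases "i = j")
        case True
        then have "v = 0" using generic_seq_switch[OF y(1), of d' d v j] eq d d' v E by auto
        then show False using v st by simp
      next
        case False
        then show False
          using generic_seq_distinct[OF y(1), of j i d' 0 d v] eq d d' v E by auto
      qed
    qed
  next
    fix g
    show "(\<exists>s\<in>S. g + s \<in> S) \<or> 2 * card {x \<in> P. \<exists>s\<in>S. g + x \<in> (+) s ` V} \<le> card P"
    proof (rule disjCI)
      assume neg: "\<not> 2 * card {x \<in> P. \<exists>s\<in>S. g + x \<in> (+) s ` V} \<le> card P"
      show "\<exists>s\<in>S. g + s \<in> S"
      proof (rule ccontr)
        assume uns: "\<not> (\<exists>s\<in>S. g + s \<in> S)"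
        define I where "I = {i. \<exists>q d v j. {q, d, v} \<subseteq> E \<and> v \<noteq> 0 \<and> g + q + y i = d + y j + v}"
        have I: "finite I" "card I \<le> 2" using generic_seq_hits[OF y(1), of g] by (simp_all add: I_def)
        have "{x \<in> P. \<exists>s\<in>S. g + x \<in> (+) s ` V} \<subseteq> (\<Union>i\<in>I. R i)"
        proof
          fix x assume "x \<in> {x \<in> P. \<exists>s\<in>S. g + x \<in> (+) s ` V}"
          then obtain s v where x: "x \<in> P" "s \<in> S" "v \<in> V" "g + x = s + v" by blast
          obtain q i where q: "q \<in> Q" "x = q + y i" using x(1) by (auto simp: P_def R_def)
          obtain d j where d: "d \<in> D" "s = d + y j" using SD[OF x(2)] by blast
          \<comment> \<open>For \<open>v = 0\<close> the point \<open>g + x\<close> would lie in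
            \<open>S\<close>, as would \<open>x\<close>, which is the alternative just excluded. So
            \<open>generic_seq_hits\<close> counts the pieces involved, and two of four pieces make
            up half of \<open>P\<close>.\<close>
          have "v \<noteq> 0" using uns x PS by force
          moreover have "g + q + y i = d + y j + v" using x(4) q d by (simp add: add.assoc)
          ultimately have "i \<in> I" using q d x(3) E unfolding I_def by blast
          then show "x \<in> (\<Union>i\<in>I. R i)" using q by (auto simp: R_def)
        qed
        then have "card {x \<in> P. \<exists>s\<in>S. g + x \<in> (+) s ` V} \<le> card (\<Union>i\<in>I. R i)"
          by (rule card_mono[rotated]) (use I finR in auto)
        also have "\<dots> \<le> (\<Sum>i\<in>I. card (R i))" by (rule card_UN_le[OF I(1)])
        also have "\<dots> \<le> 2 * m" using I(2) by (simp add: cardR)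
        finally show False using neg cardP by linarith
      qed
    qed
  qed (use Q Qne finP S_def in auto)
qed

text \<open>A patch prescribes the subset \<open>config\<close> of a finite \<open>window\<close>; the \<open>halo\<close> is a larger set that must be
  kept free of other patches.\<close>

datatype 'b patch = Patch (window: "'b set") (config: "'b set") (halo: "'b set")

definition shift :: "'b::group_add \<Rightarrow> 'b patch \<Rightarrow> 'b patch" where
  "shift g q = Patch ((+) g ` window q) ((+) g ` config q) ((+) g ` halo q)"

lemma shift_sel [simp]:
  "window (shift g q) = (+) g ` window q" "config (shift g q) = (+) g ` config q"
  "halo (shift g q) = (+) g ` halo q"
  by (simp_all add: shift_def)

text \<open>Halos are not compared: they matter while patches are placed, not when the resulting
  pattern is read.\<close>

definition occurs_at :: "'b::group_add patch \<Rightarrow> 'b \<Rightarrow> 'b patch \<Rightarrow> bool" where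
  "occurs_at q p r \<longleftrightarrow> (+) p ` window q \<subseteq> window r \<and> config r \<inter> (+) p ` window q = (+) p ` config q"

lemma image_add_image: "(+) a ` (+) b ` X = (+) (a + b) ` X" for a :: "'b::group_add"
  by (simp add: image_image add.assoc)

lemma image_add_Int: "(+) a ` (X \<inter> Y) = (+) a ` X \<inter> (+) a ` Y" for a :: "'b::group_add"
  by (rule image_Int) (simp add: inj_on_def)

lemma occurs_at_shift_left: "occurs_at (shift a q) p r \<longleftrightarrow> occurs_at q (p + a) r"
  by (simp add: occurs_at_def image_add_image)

lemma occurs_at_trans:
  assumes "occurs_at q p r" "occurs_at r a u"
  shows "occurs_at q (a + p) u"
  unfolding occurs_at_def
proof
  have 1: "(+) (a + p) ` window q \<subseteq> (+) a ` window r"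
    using assms(1) by (auto simp: occurs_at_def simp flip: image_add_image)
  then show "(+) (a + p) ` window q \<subseteq> window u" using assms(2) by (auto simp: occurs_at_def)
  have "config u \<inter> (+) (a + p) ` window q = (config u \<inter> (+) a ` window r) \<inter> (+) (a + p) ` window q"
    using 1 by blast
  also have "\<dots> = (+) a ` (config r \<inter> (+) p ` window q)"
    using assms(2) by (simp add: occurs_at_def image_add_Int image_add_image)
  also have "\<dots> = (+) (a + p) ` config q" using assms(1) by (simp add: occurs_at_def image_add_image)
  finally show "config u \<inter> (+) (a + p) ` window q = (+) (a + p) ` config q" .
qed

lemma occurs_at_shift_self: "config q \<subseteq> window q \<Longrightarrow> occurs_at q a (shift a q)"
  by (auto simp: occurs_at_def)

lemma occurs_at_shift_right:
  assumes "config r \<subseteq> window r"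
  shows "occurs_at q p (shift a r) \<longleftrightarrow> occurs_at q (- a + p) r"
proof
  assume "occurs_at q (- a + p) r"
  from occurs_at_trans[OF this occurs_at_shift_self[OF assms, of a]] show "occurs_at q p (shift a r)" by simp
next
  assume *: "occurs_at q p (shift a r)"
  have "shift (- a) (shift a r) = r" by (cases r) (simp add: shift_def image_add_image)
  moreover have "config (shift a r) \<subseteq> window (shift a r)" using assms by auto
  ultimately have "occurs_at (shift a r) (- a) r" using occurs_at_shift_self by metis
  from occurs_at_trans[OF * this] show "occurs_at q (- a + p) r" .
qed

text \<open>That the halo of an extension exceeds \<open>N\<close> only by a set \<open>B\<close> independent of \<open>N\<close> is what allows
  further patches to be placed around \<open>N\<close> before extending.\<close>

definition patch_system :: "'b::group_add set \<Rightarrow> 'b patch set \<Rightarrow> 'b set \<Rightarrow> bool" where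
  "patch_system \<Gamma> \<Q> B \<longleftrightarrow> finite B \<and> B \<subseteq> \<Gamma> \<and> 0 \<in> B \<and>
     (\<forall>q\<in>\<Q>. finite (halo q) \<and> config q \<subseteq> window q \<and> window q \<subseteq> halo q \<and> halo q \<subseteq> \<Gamma> \<and> halo q \<noteq> {}) \<and>
     (\<forall>q\<in>\<Q>. \<forall>g\<in>\<Gamma>. shift g q \<in> \<Q>) \<and>
     (\<forall>F N. finite F \<and> F \<subseteq> \<Q> \<and> pairwise (\<lambda>p q. disjnt (halo p) (halo q)) F \<and>
        finite N \<and> N \<subseteq> \<Gamma> \<and> N \<noteq> {} \<and> (\<forall>q\<in>F. halo q \<subseteq> N) \<longrightarrow>
        (\<exists>q\<in>\<Q>. N \<subseteq> window q \<and> halo q \<subseteq> N + B \<and> (\<forall>p\<in>F. occurs_at p 0 q)))"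

lemma patch_systemD:
  assumes "patch_system \<Gamma> \<Q> B"
  shows "finite B" "B \<subseteq> \<Gamma>" "0 \<in> B"
    "q \<in> \<Q> \<Longrightarrow> finite (halo q)" "q \<in> \<Q> \<Longrightarrow> config q \<subseteq> window q" "q \<in> \<Q> \<Longrightarrow> window q \<subseteq> halo q"
    "q \<in> \<Q> \<Longrightarrow> halo q \<subseteq> \<Gamma>" "q \<in> \<Q> \<Longrightarrow> halo q \<noteq> {}" "q \<in> \<Q> \<Longrightarrow> g \<in> \<Gamma> \<Longrightarrow> shift g q \<in> \<Q>"
  using assms by (auto simp: patch_system_def)

lemma patch_system_extend:
  assumes "patch_system \<Gamma> \<Q> B" "finite F" "F \<subseteq> \<Q>" "pairwise (\<lambda>p q. disjnt (halo p) (halo q)) F"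
    "finite N" "N \<subseteq> \<Gamma>" "N \<noteq> {}" "\<And>q. q \<in> F \<Longrightarrow> halo q \<subseteq> N"
  obtains q where "q \<in> \<Q>" "N \<subseteq> window q" "halo q \<subseteq> N + B" "\<And>p. p \<in> F \<Longrightarrow> occurs_at p 0 q"
  using assms unfolding patch_system_def by metis

section \<open>One refinement step of a patch system\<close>

lemma add_eq_add_imp: "a + h = b + k \<Longrightarrow> a = b + (k - h)" for a b h k :: "'b::group_add"
  by (simp add: add_diff_eq eq_diff_eq)

text \<open>The set \<open>V\<close> measures closeness: if \<open>p\<close> is not in
  \<open>a + V\<close>, the copies of \<open>q0\<close> at \<open>a\<close> and \<open>p\<close>
  have disjoint halos, even after the halo at \<open>a\<close> is enlarged by \<open>B\<close>. The
  conditions on \<open>Q\<close>, \<open>P\<close>, \<open>S\<close> and \<open>r\<close> are those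
  delivered by \<open>step_parameters\<close>.\<close>

locale patch_step =
  fixes \<Gamma> :: "'b::group_add set" and \<Q> B q0 V Q P S and r :: nat
  assumes sg: "add_subgroup \<Gamma>" and ps: "patch_system \<Gamma> \<Q> B" and q0: "q0 \<in> \<Q>"
    and V: "finite V" "0 \<in> V" "uminus ` V \<subseteq> V"
      "\<And>h k b. h \<in> halo q0 \<Longrightarrow> k \<in> halo q0 \<Longrightarrow> b \<in> B \<Longrightarrow> h + b - k \<in> V"
    and Q: "finite Q" "Q \<noteq> {}" "Q \<subseteq> \<Gamma>"
    and P: "finite P" "P \<noteq> {}" "P \<subseteq> \<Gamma>"
    and S_def: "S = {q - q' + x | q q' x. q \<in> Q \<and> q' \<in> Q \<and> x \<in> P}"
    and mult: "\<And>C p. finite C \<Longrightarrow> packing Q C \<Longrightarrow> card {(c, x) \<in> C \<times> P. c + x = p} \<le> 4"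
    and size: "64 * card V \<le> card P" "4 * (r * card V) \<le> card P"
      "real (card P * card V) * (16 * real (card V)) ^ r \<le> fact r / 4"
    and S_sep: "\<And>s t. s \<in> S \<Longrightarrow> t \<in> S \<Longrightarrow> s \<noteq> t \<Longrightarrow> t \<notin> (+) s ` V"
    and S_hits: "\<And>g. (\<exists>s\<in>S. g + s \<in> S) \<or> 2 * card {x \<in> P. \<exists>s\<in>S. g + x \<in> (+) s ` V} \<le> card P"
begin

lemmas \<Gamma> = add_subgroupD[OF sg]
lemmas psD = patch_systemD[OF ps]

text \<open>An occurrence of \<open>q0\<close> in \<open>g + S\<close> serves \<open>g\<close>.  To serve \<open>g\<close>, one of the places \<open>g + x\<close> with
  \<open>x \<in> P\<close> is used that is not blocked by the patches already present.\<close>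

definition served :: "'b \<Rightarrow> 'b patch \<Rightarrow> bool" where
  "served g q \<longleftrightarrow> (\<exists>s\<in>S. occurs_at q0 (g + s) q)"

definition blocked :: "'b \<Rightarrow> 'b set \<Rightarrow> 'b set" where
  "blocked g H = {x \<in> P. \<not> disjnt ((+) (g + x) ` halo q0) H}"

text \<open>The free half of \<open>P\<close> gives a later extension enough places to serve
  \<open>g\<close>. Conversely, if all of \<open>P\<close> is blocked, \<open>g\<close> must have
  been served.\<close>

definition good :: "'b patch \<Rightarrow> bool" where
  "good q \<longleftrightarrow> (\<forall>g. served g q \<or> 2 * card (blocked g (halo q)) \<le> card P)"

text \<open>A point \<open>g\<close> with a place blocked by \<open>n + b\<close> has the form
  \<open>n + b - h - x\<close>, and a copy of \<open>q0\<close> placed for it at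
  \<open>g + x'\<close> reaches at most the points \<open>g + x' + h' + b'\<close> after extension.
  These displacements from \<open>n\<close> do not depend on the region to be filled.\<close>

definition B1 :: "'b set" where
  "B1 = B + uminus ` halo q0 + uminus ` P + P + halo q0 + B"

lemma finite_blocked [simp]: "finite (blocked g H)" and blocked_subset: "blocked g H \<subseteq> P"
  using P by (auto simp: blocked_def)

lemma blocked_nonempty: "x \<in> blocked g H \<Longrightarrow> \<exists>n\<in>H. \<exists>h\<in>halo q0. x \<in> P \<and> g = n - h - x"
proof -
  assume "x \<in> blocked g H"
  then obtain h n where "x \<in> P" "h \<in> halo q0" "n \<in> H" "g + x + h = n"
    by (auto simp: blocked_def disjnt_def)
  moreover from this have "g = n - h - x" by (metis add_diff_cancel)
  ultimately show ?thesis by blast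
qed

lemma served_mono: "served g p \<Longrightarrow> occurs_at p 0 q \<Longrightarrow> served g q"
  unfolding served_def using occurs_at_trans by fastforce

lemma finite_B1: "finite B1"
  unfolding B1_def using psD(1) psD(4)[OF q0] P(1) by (intro finite_set_plus finite_imageI)

lemma B1_\<Gamma>: "B1 \<subseteq> \<Gamma>"
  using psD(2) psD(7)[OF q0] P(3) \<Gamma> unfolding B1_def set_plus_def by (auto simp: subset_iff)

lemma B1_I:
  assumes "b \<in> B" "h \<in> halo q0" "x \<in> P" "x' \<in> P" "h' \<in> halo q0" "b' \<in> B"
  shows "b - h - x + x' + h' + b' \<in> B1"
proof -
  have "b + - h + - x + x' + h' + b' \<in> B1" unfolding B1_def using assms by (intro set_plus_intro) auto
  then show ?thesis by simp
qed

lemma B_subset_B1: "B \<subseteq> B1"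
proof
  fix b assume "b \<in> B"
  moreover obtain h x where "h \<in> halo q0" "x \<in> P" using psD(8)[OF q0] P(2) by blast
  ultimately have "b - h - x + x + h + 0 \<in> B1" using psD(3) by (intro B1_I)
  then show "b \<in> B1" by (simp add: group_word_simps del: add_uminus_conv_diff)
qed

text \<open>Serving the points of \<open>C\<close> serves all of \<open>T\<close>: if
  \<open>c + q = g + q'\<close>, then \<open>c + x = g + (q' - q + x)\<close> lies in
  \<open>g + S\<close> for every \<open>x\<close> in \<open>P\<close>.\<close>

lemma maximal_packing:
  assumes "finite T"
  obtains C where "C \<subseteq> T" "packing Q C" "\<And>g. g \<in> T \<Longrightarrow> \<exists>c\<in>C. \<exists>q\<in>Q. \<exists>q'\<in>Q. c + q = g + q'"
proof -
  define \<C> where "\<C> = {C. C \<subseteq> T \<and> packing Q C}"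
  have "finite \<C>" using assms by (simp add: \<C>_def)
  moreover have "{} \<in> \<C>" by (simp add: \<C>_def packing_def)
  ultimately obtain C where C: "C \<in> \<C>" "\<And>D. D \<in> \<C> \<Longrightarrow> C \<subseteq> D \<Longrightarrow> C = D"
    using finite_has_maximal[of \<C>] by blast
  have "\<exists>c\<in>C. \<exists>q\<in>Q. \<exists>q'\<in>Q. c + q = g + q'" if g: "g \<in> T" for g
  proof (rule ccontr)
    assume *: "\<not> ?thesis"
    then have "packing Q (insert g C)"
      using C(1) unfolding \<C>_def packing_def pairwise_insert disjnt_def by fastforce
    then have "insert g C \<in> \<C>" using C(1) g by (simp add: \<C>_def)
    then have "g \<in> C" using C(2) by blast
    then show False using * Q(2) by blast
  qed
  then show thesis using that C(1) by (auto simp: \<C>_def)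
qed

text \<open>The \<open>g\<close> that might get blocked by the extension of \<open>F\<close> are served first.  The copies of \<open>q0\<close> used for
  this are spread so that they block at most a quarter of the places of any other \<open>g\<close>.\<close>

lemma extend_good:
  assumes F: "finite F" "F \<subseteq> \<Q>" "pairwise (\<lambda>p q. disjnt (halo p) (halo q)) F"
    and N: "finite N" "N \<subseteq> \<Gamma>" "N \<noteq> {}" "\<And>q. q \<in> F \<Longrightarrow> halo q \<subseteq> N"
    and free: "\<And>g. (\<exists>p\<in>F. served g p) \<or> 2 * card (blocked g (\<Union>(halo ` F))) \<le> card P"
  shows "\<exists>q\<in>\<Q>. N \<subseteq> window q \<and> halo q \<subseteq> N + B1 \<and> (\<forall>p\<in>F. occurs_at p 0 q) \<and> good q"
proof -
  let ?U = "\<Union>(halo ` F)"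
  \<comment> \<open>The unserved points of which \<open>N + B\<close> blocks more than a quarter of
    the places. The other unserved points can afford to lose another quarter to the new
    copies.\<close>
  define T where "T = {g. \<not> (\<exists>p\<in>F. served g p) \<and> card P < 4 * card (blocked g (N + B))}"
  have T: "\<exists>n\<in>N. \<exists>b\<in>B. \<exists>h\<in>halo q0. \<exists>x\<in>P. g = n + b - h - x" if "g \<in> T" for g
  proof -
    have "blocked g (N + B) \<noteq> {}" using that by (auto simp: T_def)
    then obtain x n h where *: "n \<in> N + B" "h \<in> halo q0" "x \<in> P" "g = n - h - x"
      using blocked_nonempty by blast
    then obtain n' b where "n' \<in> N" "b \<in> B" "n = n' + b" by (auto elim: set_plus_elim)
    then show ?thesis using * by blast
  qed
  have T\<Gamma>: "T \<subseteq> \<Gamma>"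
  proof
    fix g assume "g \<in> T"
    then obtain n b h x where *: "n \<in> N" "b \<in> B" "h \<in> halo q0" "x \<in> P" "g = n + b - h - x" using T by blast
    then have "n \<in> \<Gamma>" "b \<in> \<Gamma>" "h \<in> \<Gamma>" "x \<in> \<Gamma>" using N(2) psD(2) psD(7)[OF q0] P(3) by auto
    then show "g \<in> \<Gamma>" unfolding *(5) by (intro \<Gamma>(2,4))
  qed
  have "T \<subseteq> (\<lambda>(n, b, h, x). n + b - h - x) ` (N \<times> B \<times> halo q0 \<times> P)"
    using T by force
  then have "finite T" by (rule finite_subset) (use N(1) psD(1) psD(4)[OF q0] P(1) in auto)
  then obtain C where C: "C \<subseteq> T" "packing Q C"
    "\<And>g. g \<in> T \<Longrightarrow> \<exists>c\<in>C. \<exists>q\<in>Q. \<exists>q'\<in>Q. c + q = g + q'"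
    by (rule maximal_packing) blast
  have finC: "finite C" using C(1) \<open>finite T\<close> finite_subset by blast
  \<comment> \<open>By the assumption \<open>free\<close>, at least half of the places remain for an
    unserved point, as \<open>spread_selection\<close> requires.\<close>
  define Opt where "Opt c = P - blocked c ?U" for c
  have cardOpt: "card P \<le> 2 * card (Opt c)" if "c \<in> C" for c
  proof -
    have "2 * card (blocked c ?U) \<le> card P" using free[of c] C(1) that by (auto simp: T_def)
    then show ?thesis
      unfolding Opt_def using card_Diff_subset[OF finite_blocked blocked_subset, of c ?U] by simp
  qed
  obtain f where f: "\<And>c. c \<in> C \<Longrightarrow> f c \<in> Opt c"
    "\<And>c d. c \<in> C \<Longrightarrow> d \<in> C \<Longrightarrow> c \<noteq> d \<Longrightarrow> c + f c \<notin> (+) (d + f d) ` V"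
    "\<And>g. 4 * card {x \<in> P. \<exists>c\<in>C. g + x \<in> (+) (c + f c) ` V} \<le> card P"
  proof (rule spread_selection[OF finC P(1) V(1-3), where Opt = Opt and r = r])
    show "Opt c \<subseteq> P" for c by (simp add: Opt_def)
  qed (use mult[OF finC C(2)] cardOpt size in blast)+
  have fP: "f c \<in> P" if "c \<in> C" for c using f(1)[OF that] by (simp add: Opt_def)
  define A where "A = (\<lambda>c. shift (c + f c) q0) ` C"
  define N' where "N' = N \<union> (\<Union>c\<in>C. (+) (c + f c) ` halo q0)"
  have c\<Gamma>: "c + f c \<in> \<Gamma>" if "c \<in> C" for c using that fP C(1) T\<Gamma> P(3) \<Gamma> by blast
  have disj: "disjnt ((+) (c + f c) ` halo q0) ((+) (d + f d) ` halo q0)"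
    if "c \<in> C" "d \<in> C" "c \<noteq> d" for c d
  proof (rule ccontr)
    assume "\<not> ?thesis"
    then obtain h k where hk: "h \<in> halo q0" "k \<in> halo q0" "c + f c + h = d + f d + k"
      by (auto simp: disjnt_def)
    then have "c + f c + h = d + f d + (k + 0)" by simp
    then have "c + f c = d + f d + (k + 0 - h)" by (rule add_eq_add_imp)
    then show False using f(2)[OF that] V(4)[OF hk(2,1) psD(3)] by blast
  qed
  have "pairwise (\<lambda>p q. disjnt (halo p) (halo q)) (F \<union> A)"
    unfolding pairwise_def
  proof (intro ballI impI)
    fix p q assume pq: "p \<in> F \<union> A" "q \<in> F \<union> A" "p \<noteq> q"
    have FA: "disjnt (halo p) (halo q)" if "p \<in> F" "q \<in> A" for p q
    proof -
      obtain c where c: "c \<in> C" "q = shift (c + f c) q0" using \<open>q \<in> A\<close> by (auto simp: A_def)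
      then have "disjnt ((+) (c + f c) ` halo q0) ?U" using f(1)[OF c(1)] by (auto simp: Opt_def blocked_def)
      then show ?thesis using that(1) c(2) by (auto simp: disjnt_def)
    qed
    have AA: "disjnt (halo p) (halo q)" if "p \<in> A" "q \<in> A"
    proof -
      obtain c d where c: "c \<in> C" "p = shift (c + f c) q0" and d: "d \<in> C" "q = shift (d + f d) q0"
        using \<open>p \<in> A\<close> \<open>q \<in> A\<close> by (auto simp: A_def)
      then have "c \<noteq> d" using pq(3) by blast
      then show ?thesis using disj[OF c(1) d(1)] c(2) d(2) by simp
    qed
    have FF: "disjnt (halo p) (halo q)" if "p \<in> F" "q \<in> F"
      using F(3) pq(3) that by (auto simp: pairwise_def)
    show "disjnt (halo p) (halo q)"
      using pq(1,2) AA FF FA[of p q] FA[of q p] disjnt_sym by blast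
  qed
  moreover have "F \<union> A \<subseteq> \<Q>" using F(2) c\<Gamma> psD(9)[OF q0] by (auto simp: A_def)
  moreover have "finite N'" using N(1) finC psD(4)[OF q0] by (simp add: N'_def)
  moreover have "N' \<subseteq> \<Gamma>" using N(2) c\<Gamma> psD(7)[OF q0] \<Gamma> by (auto simp: N'_def)
  moreover have "halo q \<subseteq> N'" if "q \<in> F \<union> A" for q
    using that N(4) by (auto simp: A_def N'_def)
  moreover have "finite (F \<union> A)" "N' \<noteq> {}" using F(1) finC N(3) by (auto simp: A_def N'_def)
  ultimately obtain q where q: "q \<in> \<Q>" "N' \<subseteq> window q" "halo q \<subseteq> N' + B" "\<And>p. p \<in> F \<union> A \<Longrightarrow> occurs_at p 0 q"
    using patch_system_extend[OF ps, of "F \<union> A" N'] by blast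
  show ?thesis
  proof (intro bexI[of _ q] conjI ballI)
    show "N \<subseteq> window q" using q(2) by (simp add: N'_def)
    show "halo q \<subseteq> N + B1"
    proof
      fix z assume "z \<in> halo q"
      then have "z \<in> N' + B" using q(3) by blast
      then obtain n b where z: "n \<in> N'" "b \<in> B" "z = n + b" by (blast elim: set_plus_elim)
      show "z \<in> N + B1"
      proof (cases "n \<in> N")
        case True
        then show ?thesis using z B_subset_B1 by blast
      next
        case False
        then obtain c h where c: "c \<in> C" "h \<in> halo q0" "n = c + f c + h" using z by (auto simp: N'_def)
        obtain n1 b1 h1 x1 where c1: "n1 \<in> N" "b1 \<in> B" "h1 \<in> halo q0" "x1 \<in> P" "c = n1 + b1 - h1 - x1"
          using T C(1) c(1) by blast
        have "z = n1 + (b1 - h1 - x1 + f c + h + b)"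
          using z(3) c(3) c1(5) by (simp add: group_word_simps del: add_uminus_conv_diff)
        then show ?thesis using B1_I[OF c1(2-4) fP[OF c(1)] c(2) z(2)] c1(1) by blast
      qed
    qed
    show "good q"
      unfolding good_def
    proof
      fix g
      show "served g q \<or> 2 * card (blocked g (halo q)) \<le> card P"
      proof (cases "(\<exists>p\<in>F. served g p) \<or> g \<in> T")
        case True
        have "served g q" if "g \<in> T"
        proof -
          obtain c x y where c: "c \<in> C" "x \<in> Q" "y \<in> Q" "c + x = g + y" using C(3)[OF \<open>g \<in> T\<close>] by blast
          then have "c = g + (y - x)" by (intro add_eq_add_imp)
          then have "c + f c = g + (y - x + f c)" by (simp add: add.assoc)
          moreover have "y - x + f c \<in> S" using c fP by (auto simp: S_def)
          moreover have "occurs_at q0 (c + f c) q"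
            using q(4)[of "shift (c + f c) q0"] c(1) by (simp add: A_def occurs_at_shift_left)
          ultimately show ?thesis unfolding served_def by metis
        qed
        then show ?thesis using True q(4) served_mono by blast
      next
        case False
        then have 1: "4 * card (blocked g (N + B)) \<le> card P" by (auto simp: T_def)
        \<comment> \<open>At most a quarter is lost to \<open>N + B\<close>, as \<open>g\<close> is
          not in \<open>T\<close>, and at most a quarter to the copies, by the spread selection.
          Together this is the half allowed by \<open>good\<close>.\<close>
        have "blocked g (halo q) \<subseteq> blocked g (N + B) \<union> {x \<in> P. \<exists>c\<in>C. g + x \<in> (+) (c + f c) ` V}"
        proof
          fix x assume x: "x \<in> blocked g (halo q)"
          then obtain h where h: "x \<in> P" "h \<in> halo q0" "g + x + h \<in> halo q"
            by (auto simp: blocked_def disjnt_def)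
          then have "g + x + h \<in> N' + B" using q(3) by blast
          then obtain n b where nb: "n \<in> N'" "b \<in> B" "g + x + h = n + b" by (blast elim: set_plus_elim)
          show "x \<in> blocked g (N + B) \<union> {x \<in> P. \<exists>c\<in>C. g + x \<in> (+) (c + f c) ` V}"
          proof (cases "n \<in> N")
            case True
            then have "g + x + h \<in> N + B" using nb by auto
            then show ?thesis using h unfolding blocked_def disjnt_def by blast
          next
            case False
            then obtain c k where c: "c \<in> C" "k \<in> halo q0" "n = c + f c + k" using nb by (auto simp: N'_def)
            have "g + x + h = c + f c + (k + b)" using nb(3) c(3) by (simp add: add.assoc)
            then have "g + x = c + f c + (k + b - h)" by (rule add_eq_add_imp)
            then show ?thesis using V(4)[OF c(2) h(2) nb(2)] c(1) h(1) by blast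
          qed
        qed
        then have "card (blocked g (halo q)) \<le>
            card (blocked g (N + B) \<union> {x \<in> P. \<exists>c\<in>C. g + x \<in> (+) (c + f c) ` V})"
          by (rule card_mono[rotated]) (use P(1) in simp)
        also have "\<dots> \<le> card (blocked g (N + B)) + card {x \<in> P. \<exists>c\<in>C. g + x \<in> (+) (c + f c) ` V}"
          by (rule card_Un_le)
        finally show ?thesis using 1 f(3)[of g] by linarith
      qed
    qed
  qed (use q in auto)
qed

text \<open>Besides \<open>H\<close> it contains every \<open>g\<close> that has a place blocked by
  \<open>H\<close>. Patches whose halos have disjoint collars therefore never block places of the
  same \<open>g\<close>, so goodness of the members passes to the whole family.\<close>

definition collar :: "'b set \<Rightarrow> 'b set" where
  "collar H = H \<union> (H + uminus ` halo q0 + uminus ` P)"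

definition widen :: "'b patch \<Rightarrow> 'b patch" where
  "widen q = Patch (window q) (config q) (collar (halo q))"

definition \<Q>1 :: "'b patch set" where "\<Q>1 = widen ` {q \<in> \<Q>. good q}"

lemma widen_sel [simp]: "window (widen q) = window q" "config (widen q) = config q"
  "halo (widen q) = collar (halo q)"
  by (simp_all add: widen_def)

lemma occurs_at_widen [simp]: "occurs_at (widen p) a q \<longleftrightarrow> occurs_at p a q"
  "occurs_at p a (widen q) \<longleftrightarrow> occurs_at p a q"
  by (simp_all add: occurs_at_def)

lemma collar_I: "n \<in> H \<Longrightarrow> h \<in> halo q0 \<Longrightarrow> x \<in> P \<Longrightarrow> n - h - x \<in> collar H"
proof -
  assume "n \<in> H" "h \<in> halo q0" "x \<in> P"
  then have "n + - h + - x \<in> H + uminus ` halo q0 + uminus ` P" by (intro set_plus_intro) auto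
  then show ?thesis by (simp add: collar_def)
qed

lemma subset_collar: "H \<subseteq> collar H" by (simp add: collar_def)

lemma finite_collar: "finite H \<Longrightarrow> finite (collar H)"
  unfolding collar_def using psD(4)[OF q0] P(1) by (intro finite_UnI finite_set_plus finite_imageI)

lemma collar_\<Gamma>: "H \<subseteq> \<Gamma> \<Longrightarrow> collar H \<subseteq> \<Gamma>"
  using psD(7)[OF q0] P(3) \<Gamma> unfolding collar_def set_plus_def by (auto simp: subset_iff)

lemma collar_mono: "H \<subseteq> H' \<Longrightarrow> collar H \<subseteq> collar H'"
  unfolding collar_def by (intro Un_mono set_plus_mono2) auto

lemma collar_plus: "collar (N + H) = N + collar H"
  by (simp add: collar_def set_plus_Un add.assoc)

lemma collar_shift: "collar ((+) g ` H) = (+) g ` collar H"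
proof -
  have "(+) g ` X = {g} + X" for X by (auto simp: set_plus_def)
  then show ?thesis using collar_plus[of "{g}" H] by simp
qed

lemma served_shift: "q \<in> \<Q> \<Longrightarrow> served a (shift g q) \<longleftrightarrow> served (- g + a) q"
  by (simp add: served_def occurs_at_shift_right psD(5) add.assoc)

lemma blocked_shift: "blocked a ((+) g ` H) = blocked (- g + a) H"
proof -
  have "a + x + h \<in> (+) g ` H \<longleftrightarrow> - g + a + x + h \<in> H" for x h
    by (metis (no_types, lifting) add.assoc add_minus_cancel imageE image_eqI minus_add_cancel)
  then show ?thesis unfolding blocked_def disjnt_iff by blast
qed

lemma good_shift: "q \<in> \<Q> \<Longrightarrow> good q \<Longrightarrow> good (shift g q)"
  unfolding good_def by (simp add: served_shift blocked_shift)

lemma free_of_disjoint_collars: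
  assumes "F \<subseteq> \<Q>" "\<And>q. q \<in> F \<Longrightarrow> good q"
    and "pairwise (\<lambda>p q. disjnt (collar (halo p)) (collar (halo q))) F"
  shows "(\<exists>p\<in>F. served g p) \<or> 2 * card (blocked g (\<Union>(halo ` F))) \<le> card P"
proof (cases "\<exists>p\<in>F. blocked g (halo p) \<noteq> {}")
  case False
  then have "blocked g (\<Union>(halo ` F)) = {}" by (auto simp: blocked_def disjnt_def)
  then show ?thesis by simp
next
  case True
  have in_collar: "g \<in> collar (halo p)" if "blocked g (halo p) \<noteq> {}" for p
    using that blocked_nonempty collar_I by blast
  from True obtain p where p: "p \<in> F" "blocked g (halo p) \<noteq> {}" by blast
  have "blocked g (halo q) = {}" if "q \<in> F" "q \<noteq> p" for q
  proof (rule ccontr)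
    assume "blocked g (halo q) \<noteq> {}"
    then have "g \<in> collar (halo q)" by (rule in_collar)
    moreover have "g \<in> collar (halo p)" using p(2) by (rule in_collar)
    moreover have "disjnt (collar (halo q)) (collar (halo p))"
      using assms(3) that p(1) by (auto simp: pairwise_def)
    ultimately show False by (auto simp: disjnt_iff)
  qed
  then have "blocked g (\<Union>(halo ` F)) \<subseteq> blocked g (halo p)"
    unfolding blocked_def disjnt_iff by blast
  then have "card (blocked g (\<Union>(halo ` F))) \<le> card (blocked g (halo p))" by (intro card_mono) auto
  then show ?thesis using assms(2)[OF p(1)] p(1) unfolding good_def by (meson le_trans mult_le_mono2)
qed

text \<open>Extensions are built by \<open>extend_good\<close> from the patches before widening.
  Since \<open>collar (N + B1) = N + collar B1\<close>, the widened halos again exceed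
  \<open>N\<close> only by a fixed finite set.\<close>

lemma patch_system_\<Q>1: "patch_system \<Gamma> \<Q>1 (collar B1)"
  unfolding patch_system_def
proof (intro conjI ballI allI impI; (elim conjE)?)
  show "finite (collar B1)" by (rule finite_collar[OF finite_B1])
  show "collar B1 \<subseteq> \<Gamma>" by (rule collar_\<Gamma>[OF B1_\<Gamma>])
  show "0 \<in> collar B1" using psD(3) B_subset_B1 subset_collar by blast
next
  fix q assume "q \<in> \<Q>1"
  then obtain p where p: "p \<in> \<Q>" "q = widen p" "good p" by (auto simp: \<Q>1_def)
  show "finite (halo q)" using p finite_collar psD(4) by simp
  show "config q \<subseteq> window q" using p psD(5) by simp
  show "window q \<subseteq> halo q" using p psD(6) subset_collar by fastforce
  show "halo q \<subseteq> \<Gamma>" using p collar_\<Gamma> psD(7) by simp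
  show "halo q \<noteq> {}" using p psD(8) subset_collar by fastforce
  fix g assume g: "g \<in> \<Gamma>"
  have "shift g q = widen (shift g p)" using p by (simp add: shift_def widen_def collar_shift)
  then show "shift g q \<in> \<Q>1" using psD(9)[OF p(1) g] good_shift[OF p(1,3)] by (simp add: \<Q>1_def)
next
  fix F N
  assume F: "finite F" "F \<subseteq> \<Q>1" "pairwise (\<lambda>p q. disjnt (halo p) (halo q)) F"
    and N: "finite N" "N \<subseteq> \<Gamma>" "N \<noteq> {}" "\<forall>q\<in>F. halo q \<subseteq> N"
  have "\<forall>q\<in>F. \<exists>p. p \<in> \<Q> \<and> good p \<and> q = widen p" using F(2) by (auto simp: \<Q>1_def)
  then obtain u where u: "\<And>q. q \<in> F \<Longrightarrow> u q \<in> \<Q> \<and> good (u q) \<and> q = widen (u q)" by metis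
  have halo_u: "halo q = collar (halo (u q))" if "q \<in> F" for q using u[OF that] by (metis widen_sel(3))
  have disj: "pairwise (\<lambda>p q. disjnt (collar (halo p)) (collar (halo q))) (u ` F)"
    unfolding pairwise_def using F(3) halo_u by (auto simp: pairwise_def)
  have "disjnt (halo p) (halo q)" if "disjnt (collar (halo p)) (collar (halo q))" for p q
    using that subset_collar by (meson disjnt_subset1 disjnt_subset2)
  then have "pairwise (\<lambda>p q. disjnt (halo p) (halo q)) (u ` F)"
    using disj by (auto simp: pairwise_def)
  moreover have "halo p \<subseteq> N" if "p \<in> u ` F" for p
    using that N(4) halo_u subset_collar by fastforce
  moreover have "(\<exists>p\<in>u ` F. served g p) \<or> 2 * card (blocked g (\<Union>(halo ` u ` F))) \<le> card P" for g
    by (rule free_of_disjoint_collars[OF _ _ disj]) (use u in auto)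
  moreover have "u ` F \<subseteq> \<Q>" using u by auto
  ultimately have "\<exists>q\<in>\<Q>. N \<subseteq> window q \<and> halo q \<subseteq> N + B1 \<and> (\<forall>p\<in>u ` F. occurs_at p 0 q) \<and> good q"
    using F(1) N(1-3) by (intro extend_good) auto
  then obtain q where q: "q \<in> \<Q>" "N \<subseteq> window q" "halo q \<subseteq> N + B1"
      "\<And>p. p \<in> u ` F \<Longrightarrow> occurs_at p 0 q" "good q"
    by blast
  have "occurs_at p 0 (widen q)" if "p \<in> F" for p
    using q(4)[of "u p"] u[OF that] that by (metis occurs_at_widen image_eqI)
  moreover have "halo (widen q) \<subseteq> N + collar B1"
    using collar_mono[OF q(3)] by (simp add: collar_plus)
  ultimately show "\<exists>q\<in>\<Q>1. N \<subseteq> window q \<and> halo q \<subseteq> N + collar B1 \<and> (\<forall>p\<in>F. occurs_at p 0 q)"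
    using q(1,2,5) by (intro bexI[of _ "widen q"]) (auto simp: \<Q>1_def)
qed

lemma S_finite: "finite S" and S_nonempty: "S \<noteq> {}" and S_\<Gamma>: "S \<subseteq> \<Gamma>"
proof -
  have "S = (\<lambda>(q, q', x). q - q' + x) ` (Q \<times> Q \<times> P)" by (force simp: S_def)
  then show "finite S" using Q(1) P(1) by simp
  show "S \<noteq> {}" using Q(2) P(2) by (auto simp: S_def)
  show "S \<subseteq> \<Gamma>" unfolding S_def using Q(3) P(3) by (auto intro!: \<Gamma>(2,4))
qed

text \<open>\<open>S_hits\<close> is the freeness condition for the copies of \<open>q0\<close> at
  the points of \<open>S\<close>: either some \<open>g + s\<close> is again in \<open>S\<close> and
  \<open>g\<close> is served, or at most half of the places of \<open>g\<close> are close to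
  \<open>S\<close>. Hence the cluster extends to a good patch.\<close>

lemma cluster_\<Q>1:
  assumes "finite N" "N \<subseteq> \<Gamma>"
  shows "\<exists>q\<in>\<Q>1. N \<subseteq> window q \<and> (\<forall>s\<in>S. occurs_at q0 s q)"
proof -
  define F where "F = (\<lambda>s. shift s q0) ` S"
  define M where "M = N \<union> (\<Union>s\<in>S. (+) s ` halo q0)"
  have M: "finite M" "M \<noteq> {}"
    using assms S_finite S_nonempty psD(4)[OF q0] psD(8)[OF q0] unfolding M_def by auto
  have M\<Gamma>: "M \<subseteq> \<Gamma>"
    unfolding M_def using assms(2) S_\<Gamma> psD(7)[OF q0] by (auto intro!: \<Gamma>(2))
  have disj: "disjnt ((+) s ` halo q0) ((+) t ` halo q0)" if "s \<in> S" "t \<in> S" "s \<noteq> t" for s t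
  proof (rule ccontr)
    assume "\<not> ?thesis"
    then obtain h k where hk: "h \<in> halo q0" "k \<in> halo q0" "s + h = t + k" by (auto simp: disjnt_def)
    then have "t + k = s + (h + 0)" by simp
    then have "t = s + (h + 0 - k)" by (rule add_eq_add_imp)
    then show False using S_sep[OF that] V(4)[OF hk(1,2) psD(3)] by blast
  qed
  have F1: "pairwise (\<lambda>p q. disjnt (halo p) (halo q)) F"
    unfolding pairwise_def
  proof (intro ballI impI)
    fix p q assume pq: "p \<in> F" "q \<in> F" "p \<noteq> q"
    then obtain s t where st: "s \<in> S" "t \<in> S" "p = shift s q0" "q = shift t q0" by (auto simp: F_def)
    then have "s \<noteq> t" using pq(3) by blast
    then show "disjnt (halo p) (halo q)" using disj[OF st(1,2)] st(3,4) by simp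
  qed
  have F2: "F \<subseteq> \<Q>" using psD(9)[OF q0] S_\<Gamma> by (auto simp: F_def)
  have F3: "finite F" using S_finite by (simp add: F_def)
  have F4: "halo q \<subseteq> M" if "q \<in> F" for q using that by (auto simp: F_def M_def)
  have F5: "(\<exists>p\<in>F. served g p) \<or> 2 * card (blocked g (\<Union>(halo ` F))) \<le> card P" for g
    using S_hits[of g]
  proof
    assume "\<exists>s\<in>S. g + s \<in> S"
    then obtain s where s: "s \<in> S" "g + s \<in> S" by blast
    have "occurs_at q0 (g + s) (shift (g + s) q0)" by (rule occurs_at_shift_self[OF psD(5)[OF q0]])
    then show ?thesis using s unfolding served_def F_def by blast
  next
    assume *: "2 * card {x \<in> P. \<exists>s\<in>S. g + x \<in> (+) s ` V} \<le> card P"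
    have "blocked g (\<Union>(halo ` F)) \<subseteq> {x \<in> P. \<exists>s\<in>S. g + x \<in> (+) s ` V}"
    proof
      fix x assume "x \<in> blocked g (\<Union>(halo ` F))"
      then obtain s h k where x: "x \<in> P" "s \<in> S" "h \<in> halo q0" "k \<in> halo q0" "g + x + h = s + k"
        by (auto simp: blocked_def disjnt_def F_def)
      then have "g + x + h = s + (k + 0)" by simp
      then have "g + x = s + (k + 0 - h)" by (rule add_eq_add_imp)
      then show "x \<in> {x \<in> P. \<exists>s\<in>S. g + x \<in> (+) s ` V}" using V(4)[OF x(4,3) psD(3)] x(1,2) by blast
    qed
    then have "card (blocked g (\<Union>(halo ` F))) \<le> card {x \<in> P. \<exists>s\<in>S. g + x \<in> (+) s ` V}"
      by (rule card_mono[rotated]) (use P(1) in simp)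
    then show ?thesis using * by linarith
  qed
  obtain q where q: "q \<in> \<Q>" "M \<subseteq> window q" "halo q \<subseteq> M + B1" "\<And>p. p \<in> F \<Longrightarrow> occurs_at p 0 q" "good q"
    using extend_good[OF F3 F2 F1 M(1) M\<Gamma> M(2) F4 F5] by blast
  have "occurs_at q0 s (widen q)" if "s \<in> S" for s
    using q(4)[of "shift s q0"] that by (simp add: F_def occurs_at_shift_left)
  then show ?thesis
    using q(1,2,5) by (intro bexI[of _ "widen q"]) (auto simp: \<Q>1_def M_def)
qed

text \<open>Such a window blocks all of \<open>P\<close>, more than a good patch permits for an
  unserved point.\<close>

lemma served_\<Q>1:
  assumes "q \<in> \<Q>1" "(+) g ` (P + halo q0) \<subseteq> window q"
  shows "\<exists>s\<in>S. occurs_at q0 (g + s) q"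
proof -
  obtain p where p: "p \<in> \<Q>" "q = widen p" "good p" using assms(1) by (auto simp: \<Q>1_def)
  obtain h where h: "h \<in> halo q0" using psD(8)[OF q0] by blast
  have "blocked g (halo p) = P"
  proof
    show "P \<subseteq> blocked g (halo p)"
    proof
      fix x assume x: "x \<in> P"
      then have "g + (x + h) \<in> window q" using assms(2) h by blast
      then have "g + x + h \<in> halo p" using p psD(6)[OF p(1)] by (auto simp: add.assoc)
      then show "x \<in> blocked g (halo p)" using x h unfolding blocked_def disjnt_iff by blast
    qed
  qed (rule blocked_subset)
  moreover have "card P > 0" using P by (simp add: card_gt_0_iff)
  ultimately have "served g p" using p(3) unfolding good_def by fastforce
  then show ?thesis by (simp add: served_def p(2))
qed

end

text \<open>The last two properties pull in opposite directions: \<open>q0\<close> has to occur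
  somewhere in every translate of \<open>S\<close>, so far as the window controls it, and yet the
  pattern with \<open>q0\<close> at all points of \<open>S\<close> has to remain available. The set
  \<open>T\<close> says how much of the window the former needs.\<close>

lemma patch_system_step:
  assumes "icc \<Gamma>" "infinite \<Gamma>" "patch_system \<Gamma> \<Q> B" "q0 \<in> \<Q>"
  shows "\<exists>\<Q>' B' S T. patch_system \<Gamma> \<Q>' B' \<and> finite S \<and> S \<noteq> {} \<and> S \<subseteq> \<Gamma> \<and> finite T \<and> T \<subseteq> \<Gamma> \<and>
    (\<forall>q\<in>\<Q>'. \<exists>p\<in>\<Q>. window p = window q \<and> config p = config q) \<and>
    (\<forall>q\<in>\<Q>'. \<forall>g. (+) g ` T \<subseteq> window q \<longrightarrow> (\<exists>s\<in>S. occurs_at q0 (g + s) q)) \<and>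
    (\<forall>N. finite N \<and> N \<subseteq> \<Gamma> \<longrightarrow> (\<exists>q\<in>\<Q>'. N \<subseteq> window q \<and> (\<forall>s\<in>S. occurs_at q0 s q)))"
proof -
  have sg: "add_subgroup \<Gamma>" using assms(1) by (simp add: icc_def)
  note \<Gamma> = add_subgroupD[OF sg]
  note psD = patch_systemD[OF assms(3)]
  define V0 where "V0 = (\<lambda>(h, b, k). h + b - k) ` (halo q0 \<times> B \<times> halo q0)"
  \<comment> \<open>Symmetrized because closeness of two copies must not depend on their
    order.\<close>
  define V where "V = V0 \<union> uminus ` V0"
  have finV: "finite V" using psD(1) psD(4)[OF assms(4)] by (simp add: V_def V0_def)
  have "V0 \<subseteq> \<Gamma>"
    unfolding V0_def using psD(2) psD(7)[OF assms(4)] by (auto intro!: \<Gamma>(2,4))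
  then have V\<Gamma>: "V \<subseteq> \<Gamma>" using \<Gamma>(3) by (auto simp: V_def)
  have symV: "uminus ` V \<subseteq> V" by (auto simp: V_def)
  have V4: "h + b - k \<in> V" if "h \<in> halo q0" "k \<in> halo q0" "b \<in> B" for h k b
    using that by (force simp: V_def V0_def)
  obtain h where "h \<in> halo q0" using psD(8)[OF assms(4)] by blast
  then have V0: "0 \<in> V" using V4[of h h 0] psD(3) by simp
  show ?thesis
  proof (rule step_parameters[OF assms(1,2) finV V\<Gamma> V0 symV])
    fix Q P S r
    assume "finite Q" "Q \<noteq> {}" "Q \<subseteq> \<Gamma>" "finite P" "P \<noteq> {}" "P \<subseteq> \<Gamma>"
      "S = {q - q' + x | q q' x. q \<in> Q \<and> q' \<in> Q \<and> x \<in> P}"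
      "\<And>C p. finite C \<Longrightarrow> packing Q C \<Longrightarrow> card {(c, x) \<in> C \<times> P. c + x = p} \<le> 4"
      "64 * card V \<le> card P" "4 * (r * card V) \<le> card P"
      "real (card P * card V) * (16 * real (card V)) ^ r \<le> fact r / 4"
      "\<And>s t. s \<in> S \<Longrightarrow> t \<in> S \<Longrightarrow> s \<noteq> t \<Longrightarrow> t \<notin> (+) s ` V"
      "\<And>g. (\<exists>s\<in>S. g + s \<in> S) \<or> 2 * card {x \<in> P. \<exists>s\<in>S. g + x \<in> (+) s ` V} \<le> card P"
    note par = this
    interpret patch_step \<Gamma> \<Q> B q0 V Q P S r
      by unfold_locales (fact par sg assms(3,4) finV V0 symV V4)+
    show ?thesis
    proof (rule exI[of _ \<Q>1], rule exI[of _ "collar B1"], rule exI[of _ S], rule exI[of _ "P + halo q0"],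
        intro conjI ballI allI impI; (elim conjE)?)
      show "patch_system \<Gamma> \<Q>1 (collar B1)" by (rule patch_system_\<Q>1)
      show "finite (P + halo q0)" using P(1) psD(4)[OF assms(4)] by (rule finite_set_plus)
      show "P + halo q0 \<subseteq> \<Gamma>"
        using P(3) psD(7)[OF assms(4)] unfolding set_plus_def by (auto intro!: \<Gamma>(2))
      show "\<exists>p\<in>\<Q>. window p = window q \<and> config p = config q" if "q \<in> \<Q>1" for q
        using that by (auto simp: \<Q>1_def)
      show "\<exists>s\<in>S. occurs_at q0 (g + s) q" if "q \<in> \<Q>1" "(+) g ` (P + halo q0) \<subseteq> window q" for q g
        using that by (rule served_\<Q>1)
      show "\<exists>q\<in>\<Q>1. N \<subseteq> window q \<and> (\<forall>s\<in>S. occurs_at q0 s q)" if "finite N" "N \<subseteq> \<Gamma>" for N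
        using that by (rule cluster_\<Q>1)
    qed (fact S_finite S_nonempty S_\<Gamma>)+
  qed
qed

section \<open>The configuration as a limit of patches\<close>

lemma patch_system_all:
  fixes \<Gamma> :: "'b::group_add set"
  assumes "add_subgroup \<Gamma>"
  shows "patch_system \<Gamma> {Patch K A K | K A. finite K \<and> K \<noteq> {} \<and> A \<subseteq> K \<and> K \<subseteq> \<Gamma>} {0}"
    (is "patch_system \<Gamma> ?Q {0}")
  unfolding patch_system_def
proof (intro conjI ballI allI impI; (elim conjE)?)
  fix F :: "'b patch set" and N :: "'b set"
  assume F: "finite F" "F \<subseteq> ?Q" "pairwise (\<lambda>p q. disjnt (halo p) (halo q)) F"
    and N: "finite N" "N \<subseteq> \<Gamma>" "N \<noteq> {}" "\<forall>q\<in>F. halo q \<subseteq> N"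
  \<comment> \<open>Off the given patches the configuration is empty; disjointness of the halos
    prevents interference between them.\<close>
  define q where "q = Patch N (\<Union>(config ` F)) N"
  have FD: "config p \<subseteq> window p" "window p = halo p" if "p \<in> F" for p
  proof -
    have "p \<in> ?Q" using that F(2) by blast
    then show "config p \<subseteq> window p" "window p = halo p" by auto
  qed
  have "q \<in> ?Q" using N FD unfolding q_def by fastforce
  moreover have "occurs_at p 0 q" if p: "p \<in> F" for p
  proof -
    have "config p' \<inter> window p = {}" if "p' \<in> F" "p' \<noteq> p" for p'
      using F(3) FD[OF \<open>p' \<in> F\<close>] FD[OF p] that p unfolding pairwise_def disjnt_def by blast
    then have "\<Union>(config ` F) \<inter> window p = config p" using FD[OF p] p by blast
    then show ?thesis using N(4) FD[OF p] p by (simp add: occurs_at_def q_def)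
  qed
  ultimately show "\<exists>q\<in>?Q. N \<subseteq> window q \<and> halo q \<subseteq> N + {0} \<and> (\<forall>p\<in>F. occurs_at p 0 q)"
    by (intro bexI[of _ q]) (auto simp: q_def set_plus_def)
next
  fix q g assume "q \<in> ?Q" "g \<in> \<Gamma>"
  then obtain K A where "q = Patch K A K" "finite K" "K \<noteq> {}" "A \<subseteq> K" "K \<subseteq> \<Gamma>" by blast
  moreover from this have "(+) g ` K \<subseteq> \<Gamma>" using \<open>g \<in> \<Gamma>\<close> add_subgroupD(2)[OF assms] by auto
  ultimately show "shift g q \<in> ?Q" by (auto simp: shift_def intro!: exI[of _ "(+) g ` K"])
qed (use add_subgroupD(1)[OF assms] in auto)

lemma occurs_at_refl: "config q \<subseteq> window q \<Longrightarrow> occurs_at q 0 q"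
  by (auto simp: occurs_at_def)

lemma occurs_at_cong: "window p = window q \<Longrightarrow> config p = config q \<Longrightarrow> occurs_at r a p \<longleftrightarrow> occurs_at r a q"
  by (simp add: occurs_at_def)

text \<open>If \<open>q (Suc n)\<close> occurs at \<open>p\<close>, then \<open>q n\<close> occurs at all points of \<open>p - \<sigma> n + S n\<close>, whereas it occurs at
  some point of every translate of \<open>S n\<close>.  This yields simultaneous occurrences at two given places.\<close>

lemma icc_proximal_configuration:
  fixes \<Gamma> :: "'b::group_add set"
  assumes "icc \<Gamma>" "countable \<Gamma>" "h \<in> \<Gamma>" "h \<noteq> 0"
  shows "\<exists>X. 0 \<in> X \<and> h \<notin> X \<and> (\<forall>W. finite W \<and> W \<subseteq> \<Gamma> \<longrightarrow>
    (\<exists>F. finite F \<and> F \<subseteq> \<Gamma> \<and> (\<forall>a\<in>\<Gamma>. \<forall>b\<in>\<Gamma>. \<exists>f\<in>F. \<forall>w\<in>W.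
      (a + f + w \<in> X \<longleftrightarrow> w \<in> X) \<and> (b + f + w \<in> X \<longleftrightarrow> w \<in> X))))"
proof -
  have sg: "add_subgroup \<Gamma>" using assms(1) by (simp add: icc_def)
  note \<Gamma> = add_subgroupD[OF sg]
  have "infinite ((\<lambda>y. y + h - y) ` \<Gamma>)" using assms by (simp add: icc_def)
  then have inf: "infinite \<Gamma>" by blast
  define e where "e = from_nat_into \<Gamma>"
  have e: "range e = \<Gamma>" using assms(2) \<Gamma>(1) unfolding e_def by (intro range_from_nat_into) auto
  then have e\<Gamma>: "e n \<in> \<Gamma>" for n by blast
  define Inv where "Inv st \<longleftrightarrow> (\<exists>B. patch_system \<Gamma> (fst st) B) \<and> snd st \<in> fst st" for st :: "'b patch set \<times> 'b patch"
  define Step where "Step n st st' S T \<sigma> \<longleftrightarrow> finite S \<and> S \<subseteq> \<Gamma> \<and> finite T \<and> T \<subseteq> \<Gamma> \<and> \<sigma> \<in> S \<and>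
      (\<forall>q\<in>fst st'. \<exists>p\<in>fst st. window p = window q \<and> config p = config q) \<and>
      (\<forall>q\<in>fst st'. \<forall>g. (+) g ` T \<subseteq> window q \<longrightarrow> (\<exists>s\<in>S. occurs_at (snd st) (g + s) q)) \<and>
      (\<forall>s\<in>S. occurs_at (snd st) (- \<sigma> + s) (snd st')) \<and> e n \<in> window (snd st')"
    for n S T \<sigma> and st st' :: "'b patch set \<times> 'b patch"
  \<comment> \<open>A state is a patch system with a distinguished member. The initial patch forces
    0 into the limit and keeps \<open>h\<close> out.\<close>
  have "\<exists>f. \<forall>n. (Inv (f n) \<and> (n = 0 \<longrightarrow> snd (f n) = Patch {0, h} {0} {0, h})) \<and>
      (\<exists>S T \<sigma>. Step n (f n) (f (Suc n)) S T \<sigma>)"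
  proof (rule dependent_nat_choice)
    let ?Q = "{Patch K A K | K A. finite K \<and> K \<noteq> {} \<and> A \<subseteq> K \<and> K \<subseteq> \<Gamma>}"
    have "Patch {0, h} {0} {0, h} \<in> ?Q" using assms(3) \<Gamma>(1) by blast
    then have "Inv (?Q, Patch {0, h} {0} {0, h})" using patch_system_all[OF sg] unfolding Inv_def by auto
    then show "\<exists>st. Inv st \<and> (0 = 0 \<longrightarrow> snd st = Patch {0, h} {0} {0, h})" by force
  next
    fix st :: "'b patch set \<times> 'b patch" and n :: nat
    assume "Inv st \<and> (n = 0 \<longrightarrow> snd st = Patch {0, h} {0} {0, h})"
    then obtain B where B: "patch_system \<Gamma> (fst st) B" "snd st \<in> fst st" by (auto simp: Inv_def)
    from patch_system_step[OF assms(1) inf B]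
    obtain \<Q>' B' S T where st': "patch_system \<Gamma> \<Q>' B'" "finite S" "S \<noteq> {}" "S \<subseteq> \<Gamma>" "finite T" "T \<subseteq> \<Gamma>"
      "\<forall>q\<in>\<Q>'. \<exists>p\<in>fst st. window p = window q \<and> config p = config q"
      "\<forall>q\<in>\<Q>'. \<forall>g. (+) g ` T \<subseteq> window q \<longrightarrow> (\<exists>s\<in>S. occurs_at (snd st) (g + s) q)"
      "\<forall>N. finite N \<and> N \<subseteq> \<Gamma> \<longrightarrow> (\<exists>q\<in>\<Q>'. N \<subseteq> window q \<and> (\<forall>s\<in>S. occurs_at (snd st) s q))"
      by (elim exE conjE) (rule that)
    obtain \<sigma> where \<sigma>: "\<sigma> \<in> S" using st'(3) by blast
    \<comment> \<open>After the shift by \<open>- \<sigma>\<close> the window contains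
      \<open>e n\<close>, so that the windows exhaust \<Gamma>.\<close>
    have "{\<sigma> + e n} \<subseteq> \<Gamma>" using \<sigma> st'(4) e\<Gamma> \<Gamma>(2) by blast
    then obtain q where q: "q \<in> \<Q>'" "\<sigma> + e n \<in> window q" "\<And>s. s \<in> S \<Longrightarrow> occurs_at (snd st) s q"
      using st'(9)[rule_format, of "{\<sigma> + e n}"] by auto
    define q' where "q' = shift (- \<sigma>) q"
    have "- \<sigma> \<in> \<Gamma>" using \<sigma> st'(4) \<Gamma>(3) by blast
    then have q'1: "q' \<in> \<Q>'" using patch_systemD(9)[OF st'(1) q(1)] by (simp add: q'_def)
    have q'2: "\<forall>s\<in>S. occurs_at (snd st) (- \<sigma> + s) q'"
      using q(3) patch_systemD(5)[OF st'(1) q(1)] by (simp add: q'_def occurs_at_shift_right)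
    have q'3: "e n \<in> window q'" using q(2) by (force simp: q'_def)
    have "Inv (\<Q>', q')" using st'(1) q'1 by (auto simp: Inv_def)
    moreover have "Step n st (\<Q>', q') S T \<sigma>"
      unfolding Step_def fst_conv snd_conv by (intro conjI) (fact st' \<sigma> q'2 q'3)+
    ultimately have "Inv (\<Q>', q')" "Step n st (\<Q>', q') S T \<sigma>" .
    then show "\<exists>st'. (Inv st' \<and> (Suc n = 0 \<longrightarrow> snd st' = Patch {0, h} {0} {0, h})) \<and>
        (\<exists>S T \<sigma>. Step n st st' S T \<sigma>)" by blast
  qed
  then obtain f where f': "\<forall>n. (Inv (f n) \<and> (n = 0 \<longrightarrow> snd (f n) = Patch {0, h} {0} {0, h})) \<and>
      (\<exists>S T \<sigma>. Step n (f n) (f (Suc n)) S T \<sigma>)" by (rule exE)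
  then have f: "Inv (f n)" "snd (f 0) = Patch {0, h} {0} {0, h}" for n by auto
  from f' have "\<forall>n. \<exists>S T \<sigma>. Step n (f n) (f (Suc n)) S T \<sigma>" by blast
  then obtain S T \<sigma> where St: "\<And>n. Step n (f n) (f (Suc n)) (S n) (T n) (\<sigma> n)" by metis
  define q where "q n = snd (f n)" for n
  define X where "X = (\<Union>n. config (q n))"
  \<comment> \<open>The whole configuration as a patch with window \<Gamma>, so that
    \<open>occurs_at\<close> applies to it; the empty halo is a placeholder.\<close>
  define x where "x = Patch \<Gamma> X {}"
  have q: "q n \<in> fst (f n)" for n using f(1)[of n] by (simp add: Inv_def q_def)
  have S\<Gamma>: "finite (S n)" "S n \<subseteq> \<Gamma>" "\<sigma> n \<in> S n" and T: "finite (T n)" "T n \<subseteq> \<Gamma>" for n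
    using St[of n] unfolding Step_def by blast+
  have St1: "\<exists>p\<in>fst (f n). window p = window r \<and> config p = config r" if "r \<in> fst (f (Suc n))" for n r
    using St[of n] that unfolding Step_def by blast
  have St2: "\<exists>s\<in>S n. occurs_at (q n) (g + s) r" if "r \<in> fst (f (Suc n))" "(+) g ` T n \<subseteq> window r" for n g r
    using St[of n] that unfolding Step_def q_def by blast
  have St3: "occurs_at (q n) (- \<sigma> n + s) (q (Suc n))" if "s \<in> S n" for n s
    using St[of n] that unfolding Step_def q_def by blast
  have St4: "e n \<in> window (q (Suc n))" for n
    using St[of n] unfolding Step_def q_def by blast
  have qD: "config (q n) \<subseteq> window (q n)" "window (q n) \<subseteq> \<Gamma>" for n
  proof -
    obtain B where "patch_system \<Gamma> (fst (f n)) B" using f(1)[of n] by (auto simp: Inv_def)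
    note psD = patch_systemD[OF this]
    show "config (q n) \<subseteq> window (q n)" by (rule psD(5)[OF q])
    show "window (q n) \<subseteq> \<Gamma>" using psD(6,7)[OF q] by (rule order_trans)
  qed
  have mono: "occurs_at (q n) 0 (q m)" if "n \<le> m" for n m
    using that
  proof (induction m rule: dec_induct)
    case base then show ?case by (rule occurs_at_refl[OF qD(1)])
  next
    case (step m)
    \<comment> \<open>The point \<open>\<sigma> m\<close> of \<open>S m\<close> gives the
      displacement \<open>- \<sigma> m + \<sigma> m = 0\<close>.\<close>
    have "occurs_at (q m) 0 (q (Suc m))" using St3[OF S\<Gamma>(3)[of m]] by simp
    from occurs_at_trans[OF step.IH this] show ?case by simp
  qed
  have X: "X \<inter> window (q n) = config (q n)" for n
  proof
    show "X \<inter> window (q n) \<subseteq> config (q n)"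
    proof
      fix y assume "y \<in> X \<inter> window (q n)"
      then obtain m where m: "y \<in> config (q m)" "y \<in> window (q n)" by (auto simp: X_def)
      show "y \<in> config (q n)"
      proof (cases "n \<le> m")
        case True then show ?thesis using mono[OF True] m by (auto simp: occurs_at_def)
      next
        case False then show ?thesis using mono[of m n] m by (auto simp: occurs_at_def)
      qed
    qed
  qed (use qD in \<open>auto simp: X_def\<close>)
  have lim: "occurs_at (q n) 0 x" for n using X qD(2) by (simp add: occurs_at_def x_def)
  have wmono: "window (q n) \<subseteq> window (q m)" if "n \<le> m" for n m
    using mono[OF that] by (simp add: occurs_at_def)
  have exhaust: "\<exists>m\<ge>n. W \<subseteq> window (q m)" if W: "finite W" "W \<subseteq> \<Gamma>" for W n
    using W
  proof (induction W rule: finite_induct)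
    case (insert w W)
    then obtain m where m: "m \<ge> n" "W \<subseteq> window (q m)" by blast
    obtain i where "w = e i" using insert.prems e by blast
    then have "w \<in> window (q (Suc i))" using St4[of i] by simp
    then show ?case using m wmono[of m "max m (Suc i)"] wmono[of "Suc i" "max m (Suc i)"]
      by (intro exI[of _ "max m (Suc i)"]) auto
  qed auto
  \<comment> \<open>The serving property of stage \<open>n\<close> is known for the system of stage
    \<open>Suc n\<close>. Up to halos, later systems consist of patches of that system, so the
    property persists.\<close>
  have shape: "\<exists>p\<in>fst (f k). window p = window r \<and> config p = config r" if "k \<le> m" "r \<in> fst (f m)" for k m r
    using that
  proof (induction m arbitrary: r rule: dec_induct)
    case (step m)
    then obtain p where "p \<in> fst (f m)" "window p = window r" "config p = config r"
      using St1[of r m] step.prems by metis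
    then show ?case using step.IH[of p] by simp
  qed auto
  have syndetic: "\<exists>s\<in>S n. occurs_at (q n) (g + s) x" if g: "g \<in> \<Gamma>" for g n
  proof -
    have "finite ((+) g ` T n)" "(+) g ` T n \<subseteq> \<Gamma>" using T[of n] g by (auto intro!: \<Gamma>(2))
    then obtain m where m: "m \<ge> Suc n" "(+) g ` T n \<subseteq> window (q m)" using exhaust by blast
    obtain p where p: "p \<in> fst (f (Suc n))" "window p = window (q m)" "config p = config (q m)"
      using shape[OF m(1) q] by blast
    then obtain s where s: "s \<in> S n" "occurs_at (q n) (g + s) p"
      using St2[OF p(1), of g] m(2) by auto
    then have "occurs_at (q n) (g + s) (q m)" using occurs_at_cong[OF p(2,3)] by blast
    then have "occurs_at (q n) (0 + (g + s)) x" by (rule occurs_at_trans[OF _ lim])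
    then show ?thesis using s(1) by auto
  qed
  have cluster: "occurs_at (q n) (p + (- \<sigma> n + s)) x" if "occurs_at (q (Suc n)) p x" "s \<in> S n" for n p s
  proof -
    from St3[OF that(2)] show ?thesis by (rule occurs_at_trans[OF _ that(1)])
  qed
  show ?thesis
  proof (rule exI[of _ X], intro conjI allI impI; (elim conjE)?)
    have "X \<inter> {0, h} = {0}" using X[of 0] f(2) by (simp add: q_def)
    then show "0 \<in> X" "h \<notin> X" using assms(4) by auto
  next
    fix W :: "'b set" assume W: "finite W" "W \<subseteq> \<Gamma>"
    then obtain n where n: "W \<subseteq> window (q n)" using exhaust by blast
    \<comment> \<open>In \<open>s - \<sigma> n + t\<close>, the term \<open>s\<close> brings
      \<open>q (Suc n)\<close> to \<open>a + s\<close>, and \<open>t\<close> is chosen to serve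
      \<open>b + (s - \<sigma> n)\<close>. The same \<open>t\<close> works at \<open>a\<close>,
      where \<open>q n\<close> occurs at every point of the cluster.\<close>
    define F where "F = (\<lambda>(s, t). s - \<sigma> n + t) ` (S (Suc n) \<times> S n)"
    have "finite F" using S\<Gamma>(1) by (simp add: F_def)
    moreover have "F \<subseteq> \<Gamma>" unfolding F_def using S\<Gamma> by (auto intro!: \<Gamma>(2,4))
    moreover have "\<exists>f\<in>F. \<forall>w\<in>W. (a + f + w \<in> X \<longleftrightarrow> w \<in> X) \<and> (b + f + w \<in> X \<longleftrightarrow> w \<in> X)"
      if ab: "a \<in> \<Gamma>" "b \<in> \<Gamma>" for a b
    proof -
      obtain s where s: "s \<in> S (Suc n)" "occurs_at (q (Suc n)) (a + s) x" using syndetic[OF ab(1)] by blast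
      have "b + (s - \<sigma> n) \<in> \<Gamma>" using ab(2) s(1) S\<Gamma> by (intro \<Gamma>(2,4)) auto
      then obtain t where t: "t \<in> S n" "occurs_at (q n) (b + (s - \<sigma> n) + t) x" using syndetic by blast
      have a': "occurs_at (q n) (a + s + (- \<sigma> n + t)) x" by (rule cluster[OF s(2) t(1)])
      define u where "u = s - \<sigma> n + t"
      have u: "u \<in> F" using s(1) t(1) by (force simp: F_def u_def)
      have "a + s + (- \<sigma> n + t) = a + u" "b + (s - \<sigma> n) + t = b + u"
        by (simp_all add: u_def group_word_simps del: add_uminus_conv_diff)
      then have o: "occurs_at (q n) (a + u) x" "occurs_at (q n) (b + u) x" using a' t(2) by simp_all
      have iff: "c + w \<in> X \<longleftrightarrow> w \<in> X" if "occurs_at (q n) c x" "w \<in> W" for c w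
      proof -
        have "X \<inter> (+) c ` window (q n) = (+) c ` (X \<inter> window (q n))"
          using that(1) X by (simp add: occurs_at_def x_def)
        then have "X \<inter> (+) c ` window (q n) = (+) c ` X \<inter> (+) c ` window (q n)"
          by (simp add: image_add_Int)
        moreover have "c + w \<in> (+) c ` window (q n)" using that(2) n by blast
        ultimately have "c + w \<in> X \<longleftrightarrow> c + w \<in> (+) c ` X" by blast
        then show ?thesis by auto
      qed
      show ?thesis using u iff[OF o(1)] iff[OF o(2)] by (intro bexI[of _ u]) auto
    qed
    ultimately show "\<exists>F. finite F \<and> F \<subseteq> \<Gamma> \<and> (\<forall>a\<in>\<Gamma>. \<forall>b\<in>\<Gamma>. \<exists>f\<in>F. \<forall>w\<in>W.
        (a + f + w \<in> X \<longleftrightarrow> w \<in> X) \<and> (b + f + w \<in> X \<longleftrightarrow> w \<in> X))" by blast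
  qed
qed

section \<open>Minimal proximal actions from configurations\<close>

lemma openin_bool_product_cylinder:
  fixes z :: "'b \<Rightarrow> bool"
  assumes "finite W"
  shows "openin (product_topology (\<lambda>_. discrete_topology UNIV) UNIV) {y. \<forall>k\<in>W. y k = z k}"
  unfolding openin_product_topology_alt
proof (intro conjI allI ballI impI)
  fix x assume x: "x \<in> {y. \<forall>k\<in>W. y k = z k}"
  define U where "U k = (if k \<in> W then {z k} else UNIV)" for k
  have "finite {k \<in> UNIV. U k \<noteq> topspace (discrete_topology UNIV)}"
    by (rule finite_subset[OF _ assms]) (auto simp: U_def)
  moreover have "x \<in> PiE UNIV U" using x by (auto simp: U_def PiE_def)
  moreover have "PiE UNIV U \<subseteq> {y. \<forall>k\<in>W. y k = z k}"
  proof
    fix y assume y: "y \<in> PiE UNIV U"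
    have "y k = z k" if "k \<in> W" for k using PiE_mem[OF y, of k] that by (simp add: U_def)
    then show "y \<in> {y. \<forall>k\<in>W. y k = z k}" by simp
  qed
  ultimately show "\<exists>U. finite {k \<in> UNIV. U k \<noteq> topspace (discrete_topology UNIV)} \<and>
      (\<forall>k\<in>UNIV. openin (discrete_topology UNIV) (U k)) \<and> x \<in> PiE UNIV U \<and>
      PiE UNIV U \<subseteq> {y. \<forall>k\<in>W. y k = z k}"
    by (intro exI[of _ U]) simp
qed

lemma openin_bool_product_contains_cylinder:
  fixes z :: "'b \<Rightarrow> bool"
  assumes "openin (product_topology (\<lambda>_. discrete_topology UNIV) UNIV) S" "z \<in> S"
  obtains W where "finite W" "{y. \<forall>k\<in>W. y k = z k} \<subseteq> S"
proof -
  obtain U where U: "finite {k \<in> UNIV. U k \<noteq> topspace (discrete_topology (UNIV :: bool set))}"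
    "z \<in> PiE UNIV U" "PiE UNIV U \<subseteq> S"
    using assms unfolding openin_product_topology_alt by blast
  define W where "W = {k. U k \<noteq> UNIV}"
  have "y \<in> PiE UNIV U" if "\<forall>k\<in>W. y k = z k" for y
  proof -
    have "y k \<in> U k" for k
    proof (cases "k \<in> W")
      case True
      then show ?thesis using that PiE_mem[OF U(2), of k] by simp
    next
      case False
      then show ?thesis by (simp add: W_def)
    qed
    then show ?thesis by (simp add: PiE_iff)
  qed
  then have "{y. \<forall>k\<in>W. y k = z k} \<subseteq> S" using U(3) by blast
  moreover have "finite W" using U(1) by (simp add: W_def)
  ultimately show thesis by (intro that)
qed

text \<open>The maps are restricted because \<open>Bij\<close> consists of extensional
  functions.\<close>

lemma group_action_restrictI:
  assumes "group G"
    and maps: "\<And>g x. g \<in> carrier G \<Longrightarrow> x \<in> Z \<Longrightarrow> f g x \<in> Z"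
    and mult: "\<And>g h x. g \<in> carrier G \<Longrightarrow> h \<in> carrier G \<Longrightarrow> x \<in> Z \<Longrightarrow> f (g \<otimes>\<^bsub>G\<^esub> h) x = f g (f h x)"
    and one: "\<And>x. x \<in> Z \<Longrightarrow> f \<one>\<^bsub>G\<^esub> x = x"
  shows "group_action G Z (\<lambda>g. restrict (f g) Z)"
proof -
  interpret group G by fact
  have bij: "restrict (f g) Z \<in> Bij Z" if g: "g \<in> carrier G" for g
  proof -
    let ?i = "inv\<^bsub>G\<^esub> g"
    have i: "?i \<in> carrier G" using g by simp
    have "f ?i (f g x) = x" "f g (f ?i x) = x" if "x \<in> Z" for x
      unfolding mult[OF i g that, symmetric] mult[OF g i that, symmetric]
      using one[OF that] g by simp_all
    then have "bij_betw (restrict (f g) Z) Z Z"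
      using maps[OF g] maps[OF i] by (intro bij_betw_byWitness[where f' = "f ?i"]) (simp_all add: image_subset_iff)
    then show ?thesis by (simp add: Bij_def)
  qed
  have "restrict (f (g \<otimes>\<^bsub>G\<^esub> h)) Z = compose Z (restrict (f g) Z) (restrict (f h) Z)"
    if "g \<in> carrier G" "h \<in> carrier G" for g h
    using that maps mult by (auto simp: fun_eq_iff compose_def)
  then have "(\<lambda>g. restrict (f g) Z) \<in> hom G (BijGroup Z)"
    by (intro homI) (auto simp: BijGroup_def bij)
  then show ?thesis
    by (simp add: group_action_def group_hom_def group_hom_axioms_def group_BijGroup is_group)
qed

text \<open>In the orbit closure of the configuration \<open>c\<close>, any two points can be
  brought close to \<open>c\<close> by one group element. For two different points this is
  proximality towards \<open>c\<close>; for a single point it gives minimality.\<close>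

lemma minimal_proximal_action_of_configuration:
  fixes G :: "('a, 'm) monoid_scheme" and \<theta> :: "'a \<Rightarrow> 'b::group_add" and X :: "'b set"
  assumes "group G"
    and hom: "\<And>g h. g \<in> carrier G \<Longrightarrow> h \<in> carrier G \<Longrightarrow> \<theta> (g \<otimes>\<^bsub>G\<^esub> h) = \<theta> g + \<theta> h"
    and X: "\<And>W. finite W \<Longrightarrow> W \<subseteq> \<theta> ` carrier G \<Longrightarrow> \<exists>F. finite F \<and> F \<subseteq> \<theta> ` carrier G \<and>
      (\<forall>a\<in>\<theta> ` carrier G. \<forall>b\<in>\<theta> ` carrier G. \<exists>f\<in>F. \<forall>w\<in>W.
        (a + f + w \<in> X \<longleftrightarrow> w \<in> X) \<and> (b + f + w \<in> X \<longleftrightarrow> w \<in> X))"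
    and a: "a \<in> carrier G" "0 \<in> X" "- \<theta> a \<notin> X"
  shows "\<exists>(Y :: ('b \<Rightarrow> bool) topology) \<psi>. minimal_proximal_action G Y \<psi> \<and> (\<exists>y\<in>topspace Y. \<psi> a y \<noteq> y)"
proof -
  interpret group G by fact
  define \<Gamma> where "\<Gamma> = \<theta> ` carrier G"
  have "\<theta> \<one>\<^bsub>G\<^esub> + \<theta> \<one>\<^bsub>G\<^esub> = \<theta> \<one>\<^bsub>G\<^esub>" using hom[of "\<one>\<^bsub>G\<^esub>" "\<one>\<^bsub>G\<^esub>"] by simp
  then have one: "\<theta> \<one>\<^bsub>G\<^esub> = 0"
    using add_left_cancel[of "\<theta> \<one>\<^bsub>G\<^esub>" "\<theta> \<one>\<^bsub>G\<^esub>" 0] by simp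
  have inv: "\<theta> (inv\<^bsub>G\<^esub> g) = - \<theta> g" if "g \<in> carrier G" for g
    using hom[of g "inv\<^bsub>G\<^esub> g"] that one by (simp add: minus_unique)
  have \<Gamma>0: "0 \<in> \<Gamma>" using one by (force simp: \<Gamma>_def)
  have \<Gamma>add: "x + y \<in> \<Gamma>" if xy: "x \<in> \<Gamma>" "y \<in> \<Gamma>" for x y
  proof -
    obtain g h where "g \<in> carrier G" "h \<in> carrier G" "x = \<theta> g" "y = \<theta> h" using xy by (auto simp: \<Gamma>_def)
    then have "x + y = \<theta> (g \<otimes>\<^bsub>G\<^esub> h)" "g \<otimes>\<^bsub>G\<^esub> h \<in> carrier G" by (simp_all add: hom)
    then show ?thesis by (auto simp: \<Gamma>_def)
  qed
  have \<Gamma>minus: "- x \<in> \<Gamma>" if "x \<in> \<Gamma>" for x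
  proof -
    obtain g where "g \<in> carrier G" "x = \<theta> g" using \<open>x \<in> \<Gamma>\<close> by (auto simp: \<Gamma>_def)
    then have "- x = \<theta> (inv\<^bsub>G\<^esub> g)" "inv\<^bsub>G\<^esub> g \<in> carrier G" by (simp_all add: inv)
    then show ?thesis by (auto simp: \<Gamma>_def)
  qed
  \<comment> \<open>Outside \<open>\<Gamma>\<close> the configuration is constant, so that finite windows need not lie in \<open>\<Gamma>\<close>.\<close>
  define c where "c k \<longleftrightarrow> k \<in> X \<and> k \<in> \<Gamma>" for k
  have cX: "\<exists>F. finite F \<and> F \<subseteq> \<Gamma> \<and> (\<forall>a\<in>\<Gamma>. \<forall>b\<in>\<Gamma>. \<exists>f\<in>F. \<forall>w\<in>W. c (a + f + w) = c w \<and> c (b + f + w) = c w)"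
    if "finite W" for W
  proof -
    have "finite (W \<inter> \<Gamma>)" "W \<inter> \<Gamma> \<subseteq> \<theta> ` carrier G" using that by (auto simp: \<Gamma>_def)
    from X[OF this] obtain F where F: "finite F" "F \<subseteq> \<Gamma>" "\<forall>a\<in>\<Gamma>. \<forall>b\<in>\<Gamma>. \<exists>f\<in>F. \<forall>w\<in>W \<inter> \<Gamma>.
        (a + f + w \<in> X \<longleftrightarrow> w \<in> X) \<and> (b + f + w \<in> X \<longleftrightarrow> w \<in> X)"
      unfolding \<Gamma>_def[symmetric] by blast
    have mem: "a + f + w \<in> \<Gamma> \<longleftrightarrow> w \<in> \<Gamma>" if "a \<in> \<Gamma>" "f \<in> \<Gamma>" for a f w
    proof
      assume "a + f + w \<in> \<Gamma>"
      then have "- (a + f) + (a + f + w) \<in> \<Gamma>" using that \<Gamma>add \<Gamma>minus by blast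
      then show "w \<in> \<Gamma>" by simp
    qed (use that \<Gamma>add in blast)
    have "\<exists>f\<in>F. \<forall>w\<in>W. c (a + f + w) = c w \<and> c (b + f + w) = c w" if ab: "a \<in> \<Gamma>" "b \<in> \<Gamma>" for a b
    proof -
      obtain f where f: "f \<in> F" "\<forall>w\<in>W \<inter> \<Gamma>. (a + f + w \<in> X \<longleftrightarrow> w \<in> X) \<and> (b + f + w \<in> X \<longleftrightarrow> w \<in> X)"
        using F(3) ab by blast
      have "f \<in> \<Gamma>" using f(1) F(2) by blast
      then show ?thesis using f mem ab unfolding c_def by blast
    qed
    then show ?thesis using F(1,2) by blast
  qed
  define act where "act \<gamma> x k = x (- \<gamma> + k)" for \<gamma> :: 'b and x :: "'b \<Rightarrow> bool" and k
  have act_add: "act (\<gamma> + \<delta>) x = act \<gamma> (act \<delta> x)" for \<gamma> \<delta> x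
  proof (rule ext)
    have "- (\<gamma> + \<delta>) + k = - \<delta> + (- \<gamma> + k)" for k by (metis add.assoc minus_add)
    then show "act (\<gamma> + \<delta>) x k = act \<gamma> (act \<delta> x) k" for k unfolding act_def by simp
  qed
  have act_0: "act 0 x = x" for x by (rule ext) (simp add: act_def)
  define P where "P = product_topology (\<lambda>_ :: 'b. discrete_topology (UNIV :: bool set)) UNIV"
  define Z where "Z = P closure_of ((\<lambda>\<gamma>. act \<gamma> c) ` \<Gamma>)"
  have topP: "topspace P = UNIV" by (simp add: P_def)
  have closure_iff: "y \<in> P closure_of S \<longleftrightarrow> (\<forall>W. finite W \<longrightarrow> (\<exists>x\<in>S. \<forall>k\<in>W. x k = y k))" for y S
  proof
    assume y: "y \<in> P closure_of S"
    show "\<forall>W. finite W \<longrightarrow> (\<exists>x\<in>S. \<forall>k\<in>W. x k = y k)"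
    proof (intro allI impI)
      fix W :: "'b set" assume "finite W"
      then have 1: "openin P {x. \<forall>k\<in>W. x k = y k}" unfolding P_def by (rule openin_bool_product_cylinder)
      have 2: "\<exists>x. x \<in> S \<and> x \<in> T" if "y \<in> T" "openin P T" for T
        using y that by (simp add: in_closure_of)
      have "\<exists>x. x \<in> S \<and> x \<in> {x. \<forall>k\<in>W. x k = y k}" by (rule 2[OF _ 1]) simp
      then show "\<exists>x\<in>S. \<forall>k\<in>W. x k = y k" by blast
    qed
  next
    assume *: "\<forall>W. finite W \<longrightarrow> (\<exists>x\<in>S. \<forall>k\<in>W. x k = y k)"
    show "y \<in> P closure_of S"
      unfolding in_closure_of
    proof (intro conjI allI impI)
      fix T assume T: "y \<in> T \<and> openin P T"
      then obtain W where W: "finite W" "{x. \<forall>k\<in>W. x k = y k} \<subseteq> T"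
        using openin_bool_product_contains_cylinder[of T y] unfolding P_def by blast
      then show "\<exists>x. x \<in> S \<and> x \<in> T" using *[rule_format, OF W(1)] by blast
    qed (simp add: topP)
  qed
  have Z: "\<exists>\<gamma>\<in>\<Gamma>. \<forall>k\<in>W. act \<gamma> c k = z k" if "z \<in> Z" "finite W" for z W
    using that unfolding Z_def closure_iff by blast
  have Zact: "act \<gamma> y \<in> Z" if "\<gamma> \<in> \<Gamma>" "y \<in> Z" for \<gamma> y
    unfolding Z_def closure_iff
  proof (intro allI impI)
    fix W :: "'b set" assume "finite W"
    then have "finite ((+) (- \<gamma>) ` W)" by simp
    from Z[OF that(2) this] obtain \<delta> where "\<delta> \<in> \<Gamma>" "\<forall>k\<in>(+) (- \<gamma>) ` W. act \<delta> c k = y k" by blast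
    then have "\<forall>k\<in>W. act (\<gamma> + \<delta>) c k = act \<gamma> y k" "\<gamma> + \<delta> \<in> \<Gamma>"
      using \<Gamma>add that(1) unfolding act_add by (simp_all add: act_def)
    then show "\<exists>x\<in>(\<lambda>\<gamma>. act \<gamma> c) ` \<Gamma>. \<forall>k\<in>W. x k = act \<gamma> y k" by blast
  qed
  have cZ: "c \<in> Z"
  proof -
    have "act 0 c \<in> (\<lambda>\<gamma>. act \<gamma> c) ` \<Gamma>" by (rule imageI[OF \<Gamma>0])
    then show ?thesis unfolding Z_def closure_iff act_0 by blast
  qed
  have return: "\<exists>g\<in>carrier G. \<forall>w\<in>W. act (\<theta> g) y w = c w \<and> act (\<theta> g) z w = c w"
    if yz: "y \<in> Z" "z \<in> Z" and W: "finite W" for y z W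
  proof -
    obtain F where F: "finite F" "F \<subseteq> \<Gamma>"
      "\<forall>a\<in>\<Gamma>. \<forall>b\<in>\<Gamma>. \<exists>f\<in>F. \<forall>w\<in>W. c (a + f + w) = c w \<and> c (b + f + w) = c w" using cX[OF W] by blast
    \<comment> \<open>The points \<open>y\<close> and \<open>z\<close> are only limits of translates
      of \<open>c\<close>. Since the returns use a finite set \<open>F\<close>, agreement with
      translates on \<open>F + W\<close> suffices to transfer them.\<close>
    have K: "finite (F + W)" using F(1) W by (rule finite_set_plus)
    obtain \<gamma> where \<gamma>: "\<gamma> \<in> \<Gamma>" "\<forall>k\<in>F + W. act \<gamma> c k = y k" using Z[OF yz(1) K] by blast
    obtain \<delta> where \<delta>: "\<delta> \<in> \<Gamma>" "\<forall>k\<in>F + W. act \<delta> c k = z k" using Z[OF yz(2) K] by blast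
    obtain f where f: "f \<in> F" "\<forall>w\<in>W. c (- \<gamma> + f + w) = c w \<and> c (- \<delta> + f + w) = c w"
      using F(3) \<gamma>(1) \<delta>(1) \<Gamma>minus by blast
    have "- f \<in> \<Gamma>" using f(1) F(2) \<Gamma>minus by blast
    then obtain g where g: "g \<in> carrier G" "\<theta> g = - f" by (auto simp: \<Gamma>_def)
    have "act (\<theta> g) y w = c w \<and> act (\<theta> g) z w = c w" if "w \<in> W" for w
    proof -
      have "f + w \<in> F + W" using f(1) that by blast
      then have "y (f + w) = c (- \<gamma> + f + w)" "z (f + w) = c (- \<delta> + f + w)"
        using \<gamma>(2) \<delta>(2) by (auto simp: act_def add.assoc)
      then show ?thesis using f(2) that by (simp add: act_def g(2))
    qed
    then show ?thesis using g(1) by blast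
  qed
  define Y where "Y = subtopology P Z"
  define \<psi> where "\<psi> g = restrict (act (\<theta> g)) Z" for g
  have topY: "topspace Y = Z" by (simp add: Y_def topP)
  have \<theta>\<Gamma>: "\<theta> g \<in> \<Gamma>" if "g \<in> carrier G" for g using that by (simp add: \<Gamma>_def)
  have "compact_action G Y \<psi>"
    unfolding compact_action_def topY
  proof (intro conjI ballI)
    show "Z \<noteq> {}" using cZ by blast
    have "compact_space P"
      unfolding P_def by (simp add: compact_space_product_topology compact_space_discrete_topology)
    then show "compact_space Y"
      unfolding Y_def Z_def by (intro compact_space_subtopology closedin_compact_space) simp_all
    show "Hausdorff_space Y"
      unfolding Y_def P_def
      by (intro Hausdorff_space_subtopology) (simp add: Hausdorff_space_product_topology)
    show "group_action G Z \<psi>"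
      unfolding \<psi>_def by (rule group_action_restrictI[OF \<open>group G\<close>]) (use Zact \<theta>\<Gamma> in \<open>simp_all add: hom act_add one act_0\<close>)
    fix g assume g: "g \<in> carrier G"
    have "continuous_map P P (act (\<theta> g))"
      unfolding P_def continuous_map_componentwise_UNIV act_def
      by (intro allI continuous_map_product_projection) simp
    then have "continuous_map Y Y (act (\<theta> g))"
      unfolding Y_def using Zact[OF \<theta>\<Gamma>[OF g]]
      by (auto simp: continuous_map_in_subtopology continuous_map_from_subtopology topP)
    then show "continuous_map Y Y (\<psi> g)"
      by (rule continuous_map_eq) (simp add: \<psi>_def topY)
  qed
  moreover have "minimal_action G Y \<psi>"
    unfolding minimal_action_def topY
  proof (intro ballI)
    fix y assume y: "y \<in> Z"
    have orb: "orbit G \<psi> y \<subseteq> Z" using y Zact \<theta>\<Gamma> by (auto simp: orbit_def \<psi>_def)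
    have "z \<in> P closure_of (orbit G \<psi> y)" if z: "z \<in> Z" for z
      unfolding closure_iff
    proof (intro allI impI)
      fix W :: "'b set" assume W: "finite W"
      obtain \<gamma> where \<gamma>: "\<gamma> \<in> \<Gamma>" "\<forall>k\<in>W. act \<gamma> c k = z k" using Z[OF z W] by blast
      then obtain h where h: "h \<in> carrier G" "\<gamma> = \<theta> h" by (auto simp: \<Gamma>_def)
      have "finite ((+) (- \<gamma>) ` W)" using W by simp
      from return[OF y y this] obtain g where g: "g \<in> carrier G"
        "\<forall>w\<in>(+) (- \<gamma>) ` W. act (\<theta> g) y w = c w \<and> act (\<theta> g) y w = c w" by (rule bexE)
      have "act \<gamma> (act (\<theta> g) y) k = z k" if "k \<in> W" for k using g(2) \<gamma>(2) that by (simp add: act_def)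
      then have "\<psi> (h \<otimes>\<^bsub>G\<^esub> g) y k = z k" if "k \<in> W" for k
        using that y g(1) h by (simp add: \<psi>_def hom act_add)
      moreover have "\<psi> (h \<otimes>\<^bsub>G\<^esub> g) y \<in> orbit G \<psi> y" using g(1) h(1) by (auto simp: orbit_def)
      ultimately show "\<exists>x\<in>orbit G \<psi> y. \<forall>k\<in>W. x k = z k" by blast
    qed
    then show "Y closure_of (orbit G \<psi> y) = Z"
      using orb by (auto simp: Y_def closure_of_subtopology Int_absorb1)
  qed
  moreover have "proximal_action G Y \<psi>"
    unfolding proximal_action_def topY
  proof (intro ballI)
    fix y z assume yz: "y \<in> Z" "z \<in> Z"
    define E where "E W = {g \<in> carrier G. \<forall>w\<in>W. act (\<theta> g) y w = c w \<and> act (\<theta> g) z w = c w}" for W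
    \<comment> \<open>The tails of the net of return elements indexed by finite windows.\<close>
    define F where "F = (INF W\<in>{W. finite W}. principal (E W))"
    have ev: "eventually Q F \<longleftrightarrow> (\<exists>W. finite W \<and> (\<forall>g\<in>E W. Q g))" for Q
      unfolding F_def
    proof (subst eventually_INF_base)
      fix W W' :: "'b set" assume "W \<in> {W. finite W}" "W' \<in> {W. finite W}"
      then show "\<exists>x\<in>{W. finite W}. principal (E x) \<le> inf (principal (E W)) (principal (E W'))"
        by (intro bexI[of _ "W \<union> W'"]) (auto simp: E_def)
    qed (auto simp: eventually_principal)
    have lim: "limitin Y (\<lambda>g. \<psi> g u) c F" if u: "u \<in> {y, z}" for u
      unfolding limitin_def topY
    proof (intro conjI allI impI cZ)
      fix U assume U: "openin Y U \<and> c \<in> U"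
      then obtain V where V: "openin P V" "U = V \<inter> Z" by (auto simp: Y_def openin_subtopology)
      then obtain W where W: "finite W" "{x. \<forall>k\<in>W. x k = c k} \<subseteq> V"
        using openin_bool_product_contains_cylinder[of V c] U unfolding P_def by blast
      have "\<psi> g u \<in> U" if "g \<in> E W" for g
        using that u yz W(2) Zact \<theta>\<Gamma> V(2) by (auto simp: E_def \<psi>_def)
      then show "eventually (\<lambda>g. \<psi> g u \<in> U) F" using W(1) ev by blast
    qed
    have "F \<noteq> bot"
      unfolding trivial_limit_def ev using return[OF yz] by (auto simp: E_def)
    moreover have "eventually (\<lambda>g. g \<in> carrier G) F" unfolding ev by (auto simp: E_def)
    ultimately show "\<exists>F z'. F \<noteq> bot \<and> (\<forall>\<^sub>F g in F. g \<in> carrier G) \<and>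
        limitin Y (\<lambda>g. \<psi> g y) z' F \<and> limitin Y (\<lambda>g. \<psi> g z) z' F"
      using lim by blast
  qed
  \<comment> \<open>At 0 the translate of \<open>c\<close> has the value of \<open>c\<close> at
    \<open>- \<theta> a\<close>, a point outside \<open>X\<close>.\<close>
  moreover have "\<psi> a c 0 \<noteq> c 0"
    using a \<Gamma>0 cZ by (simp add: \<psi>_def act_def c_def)
  then have "\<psi> a c \<noteq> c" by metis
  ultimately show ?thesis
    using cZ unfolding minimal_proximal_action_def topY[symmetric] by blast
qed

section \<open>The FC-series\<close>

context group
begin

lemma conj_closed [simp]: "h \<in> carrier G \<Longrightarrow> g \<in> carrier G \<Longrightarrow> h \<otimes> g \<otimes> inv h \<in> carrier G"
  by simp

lemma conj_mult:
  assumes "g \<in> carrier G" "g' \<in> carrier G" "h \<in> carrier G"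
  shows "h \<otimes> (g \<otimes> g') \<otimes> inv h = (h \<otimes> g \<otimes> inv h) \<otimes> (h \<otimes> g' \<otimes> inv h)"
proof -
  have "inv h \<otimes> (h \<otimes> (g' \<otimes> inv h)) = g' \<otimes> inv h" using assms by (simp flip: m_assoc)
  then show ?thesis using assms by (simp add: m_assoc)
qed

lemma conj_conj:
  assumes "g \<in> carrier G" "k \<in> carrier G" "h \<in> carrier G"
  shows "h \<otimes> (k \<otimes> g \<otimes> inv k) \<otimes> inv h = (h \<otimes> k) \<otimes> g \<otimes> inv (h \<otimes> k)"
  using assms by (simp add: m_assoc inv_mult_group)

lemma fc_step_iff:
  assumes "N \<lhd> G"
  shows "g \<in> fc_step G N \<longleftrightarrow>
    g \<in> carrier G \<and> finite ((\<lambda>h. N #> (h \<otimes> g \<otimes> inv h)) ` carrier G)"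
proof (cases "g \<in> carrier G")
  case True
  interpret normal N G by fact
  have car: "carrier (G Mod N) = (\<lambda>h. N #> h) ` carrier G" by (auto simp: FactGroup_def RCOSETS_def)
  have "(N #> h) \<otimes>\<^bsub>G Mod N\<^esub> (N #> g) \<otimes>\<^bsub>G Mod N\<^esub> inv\<^bsub>G Mod N\<^esub> (N #> h) = N #> (h \<otimes> g \<otimes> inv h)"
    if "h \<in> carrier G" for h
    using that True car by (simp add: inv_FactGroup rcos_inv rcos_sum)
  then have "{C \<otimes>\<^bsub>G Mod N\<^esub> (N #> g) \<otimes>\<^bsub>G Mod N\<^esub> inv\<^bsub>G Mod N\<^esub> C | C. C \<in> carrier (G Mod N)} =
      (\<lambda>h. N #> (h \<otimes> g \<otimes> inv h)) ` carrier G"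
    unfolding car by (auto simp: image_iff)
  then show ?thesis using True car by (simp add: fc_step_def fc_center_def)
qed (simp add: fc_step_def)

lemma subset_fc_step:
  assumes "N \<lhd> G"
  shows "N \<subseteq> fc_step G N"
proof
  interpret normal N G by fact
  fix g assume g: "g \<in> N"
  then have gG: "g \<in> carrier G" by simp
  have "N #> (h \<otimes> g \<otimes> inv h) = N" if "h \<in> carrier G" for h
    by (rule coset_join2) (use that g gG inv_op_closed2 subgroup_axioms in auto)
  then have "(\<lambda>h. N #> (h \<otimes> g \<otimes> inv h)) ` carrier G \<subseteq> {N}" by auto
  then show "g \<in> fc_step G N" using gG finite_subset fc_step_iff[OF assms] by blast
qed

lemma normal_fc_step:
  assumes "N \<lhd> G"
  shows "fc_step G N \<lhd> G"
proof (rule normal_invI)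
  interpret normal N G by fact
  let ?c = "\<lambda>g. (\<lambda>h. N #> (h \<otimes> g \<otimes> inv h)) ` carrier G"
  note iff = fc_step_iff[OF assms]
  show "subgroup (fc_step G N) G"
  proof (rule subgroupI)
    show "fc_step G N \<subseteq> carrier G" by (auto simp: fc_step_def)
    show "fc_step G N \<noteq> {}"
      using subset_fc_step[OF assms] subgroup.one_closed[OF subgroup_axioms] by blast
  next
    fix g assume "g \<in> fc_step G N"
    then have g: "g \<in> carrier G" "finite (?c g)" by (auto simp: iff)
    have "N #> (h \<otimes> inv g \<otimes> inv h) = set_inv (N #> (h \<otimes> g \<otimes> inv h))" if "h \<in> carrier G" for h
      using that g(1) by (simp add: rcos_inv inv_mult_group m_assoc)
    then have "?c (inv g) \<subseteq> (\<lambda>C. set_inv C) ` ?c g" by auto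
    then have "finite (?c (inv g))" by (rule finite_subset) (use g(2) in simp)
    then show "inv g \<in> fc_step G N" using g(1) by (simp add: iff)
  next
    fix g g' assume "g \<in> fc_step G N" "g' \<in> fc_step G N"
    then have g: "g \<in> carrier G" "finite (?c g)" "g' \<in> carrier G" "finite (?c g')" by (auto simp: iff)
    have "N #> (h \<otimes> (g \<otimes> g') \<otimes> inv h) = (N #> (h \<otimes> g \<otimes> inv h)) <#> (N #> (h \<otimes> g' \<otimes> inv h))"
      if "h \<in> carrier G" for h
      using that g by (simp only: conj_mult rcos_sum conj_closed)
    then have "?c (g \<otimes> g') \<subseteq> (\<lambda>(C, D). C <#> D) ` (?c g \<times> ?c g')" by auto
    moreover have "finite ((\<lambda>(C, D). C <#> D) ` (?c g \<times> ?c g'))" using g by blast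
    ultimately have "finite (?c (g \<otimes> g'))" by (rule finite_subset)
    then show "g \<otimes> g' \<in> fc_step G N" using g(1,3) by (simp add: iff)
  qed
  fix k g assume k: "k \<in> carrier G" and "g \<in> fc_step G N"
  then have g: "g \<in> carrier G" "finite (?c g)" by (auto simp: iff)
  have "?c (k \<otimes> g \<otimes> inv k) \<subseteq> ?c g"
  proof
    fix C assume "C \<in> ?c (k \<otimes> g \<otimes> inv k)"
    then obtain h where h: "h \<in> carrier G" "C = N #> (h \<otimes> (k \<otimes> g \<otimes> inv k) \<otimes> inv h)" by blast
    then have "C = N #> ((h \<otimes> k) \<otimes> g \<otimes> inv (h \<otimes> k))" by (simp only: conj_conj[OF g(1) k h(1)])
    moreover have "h \<otimes> k \<in> carrier G" using h(1) k by simp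
    ultimately show "C \<in> ?c g" by blast
  qed
  then have "finite (?c (k \<otimes> g \<otimes> inv k))" using g(2) by (rule finite_subset)
  then show "k \<otimes> g \<otimes> inv k \<in> fc_step G N" using g(1) k by (simp add: iff)
qed

lemma normal_Union_chain:
  assumes "\<C> \<noteq> {}" "\<And>N. N \<in> \<C> \<Longrightarrow> N \<lhd> G" "\<And>M N. M \<in> \<C> \<Longrightarrow> N \<in> \<C> \<Longrightarrow> M \<subseteq> N \<or> N \<subseteq> M"
  shows "\<Union>\<C> \<lhd> G"
proof (rule normal_invI)
  have sub: "subgroup N G" if "N \<in> \<C>" for N using assms(2)[OF that] normal_inv_iff by blast
  show "subgroup (\<Union>\<C>) G"
  proof (rule subgroupI)
    show "\<Union>\<C> \<subseteq> carrier G" using sub subgroup.subset by blast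
    show "\<Union>\<C> \<noteq> {}" using assms(1) sub subgroup.one_closed by blast
    show "inv a \<in> \<Union>\<C>" if "a \<in> \<Union>\<C>" for a
      using that subgroup.m_inv_closed[OF sub] by blast
    fix a b assume "a \<in> \<Union>\<C>" "b \<in> \<Union>\<C>"
    then obtain M N where MN: "M \<in> \<C>" "N \<in> \<C>" "a \<in> M" "b \<in> N" by blast
    then consider "a \<in> N" | "b \<in> M" using assms(3)[OF MN(1,2)] by blast
    then show "a \<otimes> b \<in> \<Union>\<C>"
    proof cases
      case 1
      then show ?thesis using MN(2) subgroup.m_closed[OF sub[OF MN(2)] 1 MN(4)] by blast
    next
      case 2
      then show ?thesis using MN(1) subgroup.m_closed[OF sub[OF MN(1)] MN(3) 2] by blast
    qed
  qed
  show "x \<otimes> h \<otimes> inv x \<in> \<Union>\<C>" if xh: "x \<in> carrier G" "h \<in> \<Union>\<C>" for x h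
  proof -
    obtain N where N: "N \<in> \<C>" "h \<in> N" using xh(2) by blast
    then have "x \<otimes> h \<otimes> inv x \<in> N" using assms(2)[OF N(1)] xh(1) by (simp add: normal_inv_iff)
    then show ?thesis using N(1) by blast
  qed
qed

text \<open>Normality at a limit needs the earlier terms to form a chain, so both claims are proved
  in one induction. The inclusion concerns \<open>fc_step G (F \<alpha>)\<close> rather than
  \<open>F \<alpha>\<close>, so that elements witnessing strict growth at different stages are
  distinct.\<close>

lemma fc_series_normal:
  assumes F: "fc_series G r F" and "\<beta> \<in> Field r"
  shows "F \<beta> \<lhd> G \<and> (\<forall>\<alpha>\<in>underS r \<beta>. fc_step G (F \<alpha>) \<subseteq> F \<beta>)"
proof -
  have "Well_order r" using F by (simp add: fc_series_def)
  then interpret wo_rel r by (simp add: wo_rel_def)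
  have uF: "\<alpha> \<in> Field r" if "\<alpha> \<in> underS \<beta>" for \<alpha> \<beta>
    using that by (auto simp: underS_def Field_def)
  have "\<beta> \<in> Field r \<longrightarrow> F \<beta> \<lhd> G \<and> (\<forall>\<alpha>\<in>underS \<beta>. fc_step G (F \<alpha>) \<subseteq> F \<beta>)"
  proof (induction \<beta> rule: well_order_induct)
    case (1 \<beta>)
    then have IH: "F \<alpha> \<lhd> G" "\<gamma> \<in> underS \<alpha> \<Longrightarrow> fc_step G (F \<gamma>) \<subseteq> F \<alpha>" if "\<alpha> \<in> underS \<beta>" for \<alpha> \<gamma>
      using that uF[OF that] by (auto simp: underS_def)
    show ?case
    proof
      assume \<beta>: "\<beta> \<in> Field r"
      consider "underS \<beta> = {}" | \<alpha> where "\<alpha> \<in> Field r" "underS \<beta> = under \<alpha>"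
        | "underS \<beta> \<noteq> {}" "\<nexists>\<alpha>. \<alpha> \<in> Field r \<and> underS \<beta> = under \<alpha>" by blast
      then show "F \<beta> \<lhd> G \<and> (\<forall>\<alpha>\<in>underS \<beta>. fc_step G (F \<alpha>) \<subseteq> F \<beta>)"
      proof cases
        case 1
        then have "F \<beta> = {\<one>}" using F \<beta> by (simp add: fc_series_def)
        then show ?thesis using 1 one_is_normal by simp
      next
        case (2 \<alpha>)
        then have eq: "F \<beta> = fc_step G (F \<alpha>)" using F \<beta> by (simp add: fc_series_def)
        have \<alpha>: "\<alpha> \<in> underS \<beta>" unfolding 2 using 2(1) REFL by (auto simp: under_def refl_on_def)
        note n = IH(1)[OF \<alpha>]
        have "fc_step G (F \<gamma>) \<subseteq> F \<beta>" if "\<gamma> \<in> underS \<beta>" for \<gamma>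
        proof (cases "\<gamma> = \<alpha>")
          case False
          then have "\<gamma> \<in> underS \<alpha>" using that 2 by (auto simp: underS_def under_def)
          then show ?thesis using IH(2)[OF \<alpha>] subset_fc_step[OF n] eq by blast
        qed (simp add: eq)
        then show ?thesis using normal_fc_step[OF n] eq by simp
      next
        case 3
        then have eq: "F \<beta> = (\<Union>\<alpha>\<in>underS \<beta>. F \<alpha>)" using F \<beta> unfolding fc_series_def by blast
        have step: "fc_step G (F \<alpha>) \<subseteq> F \<beta>" if \<alpha>: "\<alpha> \<in> underS \<beta>" for \<alpha>
        proof -
          have "under \<alpha> \<subseteq> underS \<beta>"
            using \<alpha> TRANS ANTISYM unfolding under_def underS_def trans_def antisym_def by blast
          \<comment> \<open>At a limit \<beta>, some \<gamma> lies strictly between \<alpha> and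
            \<beta>, and the FC-step over \<open>F \<alpha>\<close> is already contained in
            \<open>F \<gamma>\<close>.\<close>
          then obtain \<gamma> where \<gamma>: "\<gamma> \<in> underS \<beta>" "\<gamma> \<notin> under \<alpha>" using 3(2) uF[OF \<alpha>] by blast
          then have "(\<alpha>, \<gamma>) \<in> r" "\<alpha> \<noteq> \<gamma>"
            using TOTALS uF[OF \<alpha>] uF[OF \<gamma>(1)] REFL by (auto simp: under_def refl_on_def)
          then have "\<alpha> \<in> underS \<gamma>" by (auto simp: underS_def)
          then show ?thesis using IH(2)[OF \<gamma>(1)] \<gamma>(1) eq by blast
        qed
        have "F \<alpha> \<subseteq> F \<gamma> \<or> F \<gamma> \<subseteq> F \<alpha>" if "\<alpha> \<in> underS \<beta>" "\<gamma> \<in> underS \<beta>" for \<alpha> \<gamma>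
        proof (cases "\<alpha> = \<gamma>")
          case False
          then have "\<alpha> \<in> underS \<gamma> \<or> \<gamma> \<in> underS \<alpha>" using TOTALS uF that by (auto simp: underS_def)
          then show ?thesis using IH that subset_fc_step by blast
        qed simp
        then have "F \<beta> \<lhd> G"
          unfolding eq by (intro normal_Union_chain) (use 3(1) IH(1) in auto)
        then show ?thesis using step by blast
      qed
    qed
  qed
  then show ?thesis using \<open>\<beta> \<in> Field r\<close> by blast
qed

text \<open>Otherwise, choosing an element of \<open>fc_step G (F \<alpha>)\<close> outside \<open>F \<alpha>\<close> for each \<open>\<alpha>\<close> would inject the
  power set of the group into the group.\<close>

lemma hyper_fc_stable:
  obtains N where "N \<lhd> G" "N \<subseteq> hyper_fc G" "fc_step G N \<subseteq> N"
proof -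
  obtain r :: "'a set rel" where r: "Well_order r" "Field r = UNIV"
    using well_ordering[where 'a = "'a set"] by (elim exE conjE)
  then interpret wo_rel r by (simp add: wo_rel_def)
  obtain F where F: "fc_series G r F" using fc_series_exists[OF r(1)] by blast
  have props: "F \<beta> \<lhd> G" "\<alpha> \<in> underS \<beta> \<Longrightarrow> fc_step G (F \<alpha>) \<subseteq> F \<beta>" for \<alpha> \<beta>
    using fc_series_normal[OF F] r(2) by auto
  have "\<exists>\<alpha>. fc_step G (F \<alpha>) \<subseteq> F \<alpha>"
  proof (rule ccontr)
    assume "\<not> ?thesis"
    then have "\<forall>\<alpha>. \<exists>x. x \<in> fc_step G (F \<alpha>) \<and> x \<notin> F \<alpha>" by blast
    then obtain e where e: "\<And>\<alpha>. e \<alpha> \<in> fc_step G (F \<alpha>)" "\<And>\<alpha>. e \<alpha> \<notin> F \<alpha>" by metis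
    have "inj e"
    proof (rule injI, rule ccontr)
      fix \<alpha> \<beta> assume *: "e \<alpha> = e \<beta>" "\<alpha> \<noteq> \<beta>"
      then have "\<alpha> \<in> underS \<beta> \<or> \<beta> \<in> underS \<alpha>" using TOTALS r(2) by (auto simp: underS_def)
      then show False using props(2) e *(1) by (metis subsetD)
    qed
    then have "range (inv_into UNIV e) = Pow (UNIV :: 'a set)" by (simp add: inj_imp_surj_inv)
    then show False using Cantors_theorem by blast
  qed
  then obtain \<alpha> where \<alpha>: "fc_step G (F \<alpha>) \<subseteq> F \<alpha>" by blast
  have "F \<alpha> \<subseteq> hyper_fc G" unfolding hyper_fc_def using F r(2) by blast
  then show thesis using that[OF props(1) _ \<alpha>] by blast
qed

end

section \<open>Triviality of the action of the hyper-FC-subgroup\<close>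

lemma proximal_contract_finite:
  fixes X :: "'x topology"
  assumes "compact_action G X \<phi>" "proximal_action G X \<phi>" "finite A" "A \<subseteq> topspace X"
  shows "\<exists>z\<in>topspace X. \<forall>U. openin X U \<and> z \<in> U \<longrightarrow> (\<exists>g\<in>carrier G. \<phi> g ` A \<subseteq> U)"
  using assms(3,4)
proof (induction A rule: finite_induct)
  case empty
  interpret group_action G "topspace X" \<phi> using assms(1) by (simp add: compact_action_def)
  interpret group G using group_hom by (rule group_hom.axioms(1))
  have "carrier G \<noteq> {}" using one_closed by blast
  then show ?case using assms(1) unfolding compact_action_def by blast
next
  case (insert b A)
  interpret group_action G "topspace X" \<phi> using assms(1) by (simp add: compact_action_def)
  interpret group G using group_hom by (rule group_hom.axioms(1))
  have closed: "\<phi> g x \<in> topspace X" if "g \<in> carrier G" "x \<in> topspace X" for g x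
    by (rule element_image[OF that refl])
  obtain z where z: "z \<in> topspace X"
    "\<And>U. openin X U \<Longrightarrow> z \<in> U \<Longrightarrow> \<exists>g\<in>carrier G. \<phi> g ` A \<subseteq> U"
    using insert.IH insert.prems by auto
  \<comment> \<open>Compactness yields \<open>w\<close> such that \<open>A\<close> can be moved near
    \<open>z\<close> while \<open>b\<close> is moved near \<open>w\<close>. Otherwise finitely many
    sets \<open>V\<close>, each excluded by its own neighbourhood of \<open>z\<close>, cover the
    space, and moving \<open>A\<close> into the intersection of these neighbourhoods leaves no room
    for \<open>b\<close>. Contracting \<open>z\<close> and \<open>w\<close> afterwards contracts all
    of \<open>insert b A\<close>.\<close>
  have "\<exists>w\<in>topspace X. \<forall>U V. openin X U \<and> z \<in> U \<and> openin X V \<and> w \<in> V \<longrightarrow>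
      (\<exists>g\<in>carrier G. \<phi> g ` A \<subseteq> U \<and> \<phi> g b \<in> V)"
  proof (rule ccontr)
    assume neg: "\<not> ?thesis"
    define \<V> where "\<V> = {V. openin X V \<and> (\<exists>U. openin X U \<and> z \<in> U \<and>
        \<not> (\<exists>g\<in>carrier G. \<phi> g ` A \<subseteq> U \<and> \<phi> g b \<in> V))}"
    have "topspace X \<subseteq> \<Union>\<V>"
    proof
      fix w assume "w \<in> topspace X"
      then obtain U V where "openin X U" "z \<in> U" "openin X V" "w \<in> V"
        "\<not> (\<exists>g\<in>carrier G. \<phi> g ` A \<subseteq> U \<and> \<phi> g b \<in> V)" using neg by blast
      then show "w \<in> \<Union>\<V>" unfolding \<V>_def by blast
    qed
    moreover have "\<forall>V\<in>\<V>. openin X V" by (simp add: \<V>_def)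
    ultimately obtain \<F> where \<F>: "finite \<F>" "\<F> \<subseteq> \<V>" "topspace X \<subseteq> \<Union>\<F>"
      using assms(1) unfolding compact_action_def compact_space_alt by metis
    have "\<forall>V\<in>\<F>. \<exists>U. openin X U \<and> z \<in> U \<and> \<not> (\<exists>g\<in>carrier G. \<phi> g ` A \<subseteq> U \<and> \<phi> g b \<in> V)"
      using \<F>(2) by (auto simp: \<V>_def)
    then obtain u where u: "\<And>V. V \<in> \<F> \<Longrightarrow> openin X (u V) \<and> z \<in> u V \<and>
        \<not> (\<exists>g\<in>carrier G. \<phi> g ` A \<subseteq> u V \<and> \<phi> g b \<in> V)" by metis
    define U where "U = topspace X \<inter> \<Inter>(u ` \<F>)"
    have "openin X U"
      unfolding U_def using \<F>(1) u by (cases "\<F> = {}") (auto intro!: openin_Int openin_Inter)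
    moreover have "z \<in> U" using z(1) u by (simp add: U_def)
    ultimately obtain g where g: "g \<in> carrier G" "\<phi> g ` A \<subseteq> U" using z(2) by blast
    have "\<phi> g b \<in> topspace X" using closed g(1) insert.prems by blast
    then obtain V where V: "V \<in> \<F>" "\<phi> g b \<in> V" using \<F>(3) by blast
    then have "\<phi> g ` A \<subseteq> u V" using g(2) by (auto simp: U_def)
    then show False using u[OF V(1)] g(1) V(2) by blast
  qed
  then obtain w where w: "w \<in> topspace X"
    "\<And>U V. openin X U \<Longrightarrow> z \<in> U \<Longrightarrow> openin X V \<Longrightarrow> w \<in> V \<Longrightarrow>
      \<exists>g\<in>carrier G. \<phi> g ` A \<subseteq> U \<and> \<phi> g b \<in> V" by blast
  obtain E v where E: "E \<noteq> bot" "\<forall>\<^sub>F g in E. g \<in> carrier G"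
    "limitin X (\<lambda>g. \<phi> g z) v E" "limitin X (\<lambda>g. \<phi> g w) v E"
    using assms(2) z(1) w(1) unfolding proximal_action_def by blast
  have "\<exists>g\<in>carrier G. \<phi> g ` insert b A \<subseteq> O'" if O': "openin X O'" "v \<in> O'" for O'
  proof -
    have "\<forall>\<^sub>F g in E. \<phi> g z \<in> O'" "\<forall>\<^sub>F g in E. \<phi> g w \<in> O'" using E(3,4) O' by (auto simp: limitin_def)
    then have "\<forall>\<^sub>F g in E. g \<in> carrier G \<and> \<phi> g z \<in> O' \<and> \<phi> g w \<in> O'" using E(2) by eventually_elim simp
    then obtain h where h: "h \<in> carrier G" "\<phi> h z \<in> O'" "\<phi> h w \<in> O'"
      using eventually_happens'[OF E(1)] by blast
    define U where "U = {x \<in> topspace X. \<phi> h x \<in> O'}"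
    have "continuous_map X X (\<phi> h)" using assms(1) h(1) by (simp add: compact_action_def)
    then have "openin X U" unfolding U_def using O'(1) by (rule openin_continuous_map_preimage)
    moreover have "z \<in> U" "w \<in> U" using z(1) w(1) h by (simp_all add: U_def)
    ultimately obtain g where g: "g \<in> carrier G" "\<phi> g ` A \<subseteq> U" "\<phi> g b \<in> U" using w(2) by blast
    have "\<phi> (h \<otimes>\<^bsub>G\<^esub> g) x \<in> O'" if "x \<in> insert b A" for x
    proof -
      have "x \<in> topspace X" using insert.prems that by blast
      moreover have "\<phi> g x \<in> U" using g(2,3) that by blast
      ultimately show ?thesis using composition_rule g(1) h(1) by (auto simp: U_def)
    qed
    then show ?thesis using g(1) h(1) by (intro bexI[of _ "h \<otimes>\<^bsub>G\<^esub> g"]) auto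
  qed
  moreover have "v \<in> topspace X" using E(3) by (simp add: limitin_def)
  ultimately show ?case by blast
qed

text \<open>If \<open>f\<close> moves a point \<open>x\<close> and all its translates under the conjugates of \<open>g\<close> close to \<open>z\<close>, then
  every conjugate \<open>c\<close> nearly fixes \<open>z\<close>, because \<open>c f x\<close> is \<open>f\<close> applied to such a translate.\<close>

lemma fc_step_acts_trivially:
  fixes X :: "'x topology" and G :: "('a, 'm) monoid_scheme"
  assumes X: "minimal_proximal_action G X \<phi>" and N: "N \<lhd> G"
    "\<And>n x. n \<in> N \<Longrightarrow> x \<in> topspace X \<Longrightarrow> \<phi> n x = x"
    and g: "g \<in> fc_step G N" and y: "y \<in> topspace X"
  shows "\<phi> g y = y"
proof -
  have Xc: "compact_action G X \<phi>" "minimal_action G X \<phi>" "proximal_action G X \<phi>"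
    using X by (simp_all add: minimal_proximal_action_def)
  interpret group_action G "topspace X" \<phi> using Xc by (simp add: compact_action_def)
  interpret group G using group_hom by (rule group_hom.axioms(1))
  interpret normal N G by fact
  have gG: "g \<in> carrier G" and fin: "finite ((\<lambda>h. N #>\<^bsub>G\<^esub> (h \<otimes>\<^bsub>G\<^esub> g \<otimes>\<^bsub>G\<^esub> inv\<^bsub>G\<^esub> h)) ` carrier G)"
    using g fc_step_iff[OF N(1)] by auto
  have closed: "\<phi> h x \<in> topspace X" if "h \<in> carrier G" "x \<in> topspace X" for h x
    by (rule element_image[OF that refl])
  define Cl where "Cl = (\<lambda>h. h \<otimes>\<^bsub>G\<^esub> g \<otimes>\<^bsub>G\<^esub> inv\<^bsub>G\<^esub> h) ` carrier G"
  have ClG: "Cl \<subseteq> carrier G" using gG by (auto simp: Cl_def)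
  have conjCl: "inv\<^bsub>G\<^esub> f \<otimes>\<^bsub>G\<^esub> c \<otimes>\<^bsub>G\<^esub> f \<in> Cl" if f: "f \<in> carrier G" "c \<in> Cl" for f c
  proof -
    obtain h where h: "h \<in> carrier G" "c = h \<otimes>\<^bsub>G\<^esub> g \<otimes>\<^bsub>G\<^esub> inv\<^bsub>G\<^esub> h" using f(2) by (auto simp: Cl_def)
    then have "inv\<^bsub>G\<^esub> f \<otimes>\<^bsub>G\<^esub> c \<otimes>\<^bsub>G\<^esub> f = (inv\<^bsub>G\<^esub> f \<otimes>\<^bsub>G\<^esub> h) \<otimes>\<^bsub>G\<^esub> g \<otimes>\<^bsub>G\<^esub> inv\<^bsub>G\<^esub> (inv\<^bsub>G\<^esub> f \<otimes>\<^bsub>G\<^esub> h)"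
      using conj_conj[OF gG h(1), of "inv\<^bsub>G\<^esub> f"] f(1) by simp
    then show ?thesis using f(1) h(1) by (auto simp: Cl_def)
  qed
  have swap: "\<phi> c (\<phi> f x) = \<phi> f (\<phi> (inv\<^bsub>G\<^esub> f \<otimes>\<^bsub>G\<^esub> c \<otimes>\<^bsub>G\<^esub> f) x)"
    if "c \<in> carrier G" "f \<in> carrier G" "x \<in> topspace X" for c f x
  proof -
    have "f \<otimes>\<^bsub>G\<^esub> (inv\<^bsub>G\<^esub> f \<otimes>\<^bsub>G\<^esub> c \<otimes>\<^bsub>G\<^esub> f) = c \<otimes>\<^bsub>G\<^esub> f"
      using that by (simp flip: m_assoc)
    moreover have "inv\<^bsub>G\<^esub> f \<otimes>\<^bsub>G\<^esub> c \<otimes>\<^bsub>G\<^esub> f \<in> carrier G" using that by simp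
    ultimately show ?thesis using that by (simp flip: composition_rule)
  qed
  have cosets: "\<phi> k x = \<phi> k' x" if "k \<in> carrier G" "k' \<in> carrier G" "N #>\<^bsub>G\<^esub> k = N #>\<^bsub>G\<^esub> k'" "x \<in> topspace X" for k k' x
  proof -
    have "k \<in> N #>\<^bsub>G\<^esub> k'" using that rcos_self[OF that(1) subgroup_axioms] by simp
    then obtain n where n: "n \<in> N" "k = n \<otimes>\<^bsub>G\<^esub> k'" by (auto simp: r_coset_def)
    then show ?thesis
      using that composition_rule[of x n k'] N(2)[OF n(1) closed[OF that(2,4)]] by simp
  qed
  \<comment> \<open>The class \<open>Cl\<close> may be infinite, but \<open>\<phi> c x\<close>
    depends only on the coset of \<open>c\<close> modulo \<open>N\<close>, and these cosets are
    finite in number.\<close>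
  have finA: "finite ((\<lambda>c. \<phi> c x) ` Cl)" if x: "x \<in> topspace X" for x
  proof -
    define R where "R C = (SOME c. c \<in> Cl \<and> N #>\<^bsub>G\<^esub> c = C)" for C
    have "\<phi> c x = \<phi> (R (N #>\<^bsub>G\<^esub> c)) x" if "c \<in> Cl" for c
    proof -
      have "R (N #>\<^bsub>G\<^esub> c) \<in> Cl \<and> N #>\<^bsub>G\<^esub> R (N #>\<^bsub>G\<^esub> c) = N #>\<^bsub>G\<^esub> c"
        unfolding R_def by (rule someI_ex) (use that in blast)
      then show ?thesis using cosets[of c "R (N #>\<^bsub>G\<^esub> c)" x] that ClG x by auto
    qed
    then have "(\<lambda>c. \<phi> c x) ` Cl \<subseteq> (\<lambda>C. \<phi> (R C) x) ` (\<lambda>c. N #>\<^bsub>G\<^esub> c) ` Cl" by auto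
    moreover have "finite ((\<lambda>c. N #>\<^bsub>G\<^esub> c) ` Cl)" using fin by (simp add: Cl_def image_image)
    ultimately show ?thesis using finite_subset finite_imageI by blast
  qed
  obtain x where x: "x \<in> topspace X" using y by blast
  let ?A = "insert x ((\<lambda>c. \<phi> c x) ` Cl)"
  have "finite ?A" "?A \<subseteq> topspace X" using finA[OF x] x closed ClG by auto
  then obtain z where z: "z \<in> topspace X"
    "\<And>U. openin X U \<Longrightarrow> z \<in> U \<Longrightarrow> \<exists>f\<in>carrier G. \<phi> f ` ?A \<subseteq> U"
    using proximal_contract_finite[OF Xc(1,3)] by metis
  have fixz: "\<phi> c z = z" if c: "c \<in> Cl" for c
  proof (rule ccontr)
    assume ne: "\<phi> c z \<noteq> z"
    have cG: "c \<in> carrier G" using c ClG by blast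
    have "Hausdorff_space X" using Xc(1) by (simp add: compact_action_def)
    then obtain U W where UW: "openin X U" "openin X W" "z \<in> U" "\<phi> c z \<in> W" "disjnt U W"
      using ne z(1) closed[OF cG z(1)] unfolding Hausdorff_space_def by metis
    define V where "V = U \<inter> {x \<in> topspace X. \<phi> c x \<in> W}"
    have "continuous_map X X (\<phi> c)" using Xc(1) cG by (simp add: compact_action_def)
    then have "openin X V"
      unfolding V_def using UW(1,2) by (intro openin_Int openin_continuous_map_preimage)
    moreover have "z \<in> V" using z(1) UW by (simp add: V_def)
    ultimately obtain f where f: "f \<in> carrier G" "\<phi> f ` ?A \<subseteq> V" using z(2) by blast
    have "\<phi> f (\<phi> (inv\<^bsub>G\<^esub> f \<otimes>\<^bsub>G\<^esub> c \<otimes>\<^bsub>G\<^esub> f) x) \<in> V" using f(2) conjCl[OF f(1) c] by blast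
    then have "\<phi> c (\<phi> f x) \<in> U" using swap[OF cG f(1) x] by (simp add: V_def)
    moreover have "\<phi> c (\<phi> f x) \<in> W" using f(2) by (simp add: V_def)
    ultimately show False using UW(5) by (auto simp: disjnt_iff)
  qed
  have "g \<in> Cl" using gG by (auto simp: Cl_def intro!: image_eqI[of _ _ "\<one>\<^bsub>G\<^esub>"])
  \<comment> \<open>The conjugate of \<open>g\<close> by \<open>f\<close> fixes \<open>z\<close>, so
    \<open>g\<close> fixes \<open>\<phi> f z\<close>; thus the fixed points of \<open>g\<close>
    contain a dense orbit.\<close>
  have "\<phi> g (\<phi> f z) = \<phi> f z" if "f \<in> carrier G" for f
    using swap[OF gG that z(1)] fixz[OF conjCl[OF that \<open>g \<in> Cl\<close>]] by simp
  then have "orbit G \<phi> z \<subseteq> {x \<in> topspace X. \<phi> g x = x}" using closed z(1) by (auto simp: orbit_def)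
  moreover have "closedin X {x \<in> topspace X. \<phi> g x = x}"
    using closedin_continuous_maps_eq[of X X "\<phi> g" "\<lambda>x. x"] Xc(1) gG by (simp add: compact_action_def)
  ultimately have "X closure_of (orbit G \<phi> z) \<subseteq> {x \<in> topspace X. \<phi> g x = x}"
    by (rule closure_of_minimal)
  moreover have "X closure_of (orbit G \<phi> z) = topspace X" using Xc(2) z(1) by (simp add: minimal_action_def)
  ultimately show ?thesis using y by blast
qed

lemma hyper_fc_acts_trivially:
  fixes X :: "'x topology" and G :: "('a, 'm) monoid_scheme"
  assumes "group G" and X: "minimal_proximal_action G X \<phi>" and g: "g \<in> hyper_fc G"
  shows "g \<in> carrier G \<and> (\<forall>x\<in>topspace X. \<phi> g x = x)"
proof -
  interpret group_action G "topspace X" \<phi>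
    using X by (simp add: minimal_proximal_action_def compact_action_def)
  interpret group G by fact
  let ?K = "{g \<in> carrier G. \<forall>x\<in>topspace X. \<phi> g x = x}"
  obtain r :: "'a set rel" and F \<beta> where F: "fc_series G r F" "\<beta> \<in> Field r" "g \<in> F \<beta>"
    using g by (auto simp: hyper_fc_def)
  have "Well_order r" using F by (simp add: fc_series_def)
  then interpret wo_rel r by (simp add: wo_rel_def)
  have "\<beta> \<in> Field r \<longrightarrow> F \<beta> \<subseteq> ?K" for \<beta>
  proof (induction \<beta> rule: well_order_induct)
    case (1 \<beta>)
    then have IH: "F \<alpha> \<subseteq> ?K" if "\<alpha> \<in> underS \<beta>" for \<alpha>
      using that by (auto simp: underS_def Field_def)
    show ?case
    proof
      assume \<beta>: "\<beta> \<in> Field r"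
      consider "underS \<beta> = {}" | \<alpha> where "\<alpha> \<in> Field r" "underS \<beta> = under \<alpha>"
        | "underS \<beta> \<noteq> {}" "\<nexists>\<alpha>. \<alpha> \<in> Field r \<and> underS \<beta> = under \<alpha>" by blast
      then show "F \<beta> \<subseteq> ?K"
      proof cases
        case 1
        then have "F \<beta> = {\<one>\<^bsub>G\<^esub>}" using F(1) \<beta> by (simp add: fc_series_def)
        moreover have "\<phi> \<one>\<^bsub>G\<^esub> x = x" if "x \<in> topspace X" for x
          using id_eq_one that by (metis restrict_apply')
        ultimately show ?thesis by simp
      next
        case (2 \<alpha>)
        then have eq: "F \<beta> = fc_step G (F \<alpha>)" using F(1) \<beta> by (simp add: fc_series_def)
        have "\<alpha> \<in> underS \<beta>" unfolding 2 using 2(1) REFL by (auto simp: under_def refl_on_def)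
        then have K: "F \<alpha> \<subseteq> ?K" by (rule IH)
        have "F \<alpha> \<lhd> G" using fc_series_normal[OF F(1) 2(1)] by blast
        then have "\<phi> g x = x" if "g \<in> F \<beta>" "x \<in> topspace X" for g x
          using fc_step_acts_trivially[OF X, of "F \<alpha>" g x] K that eq by blast
        then show ?thesis unfolding eq by (auto simp: fc_step_def)
      next
        case 3
        then have "F \<beta> = (\<Union>\<alpha>\<in>underS \<beta>. F \<alpha>)" using F(1) \<beta> unfolding fc_series_def by blast
        then show ?thesis using IH by blast
      qed
    qed
  qed
  then show ?thesis using F by blast
qed

text \<open>A quotient group is represented by bijections of its cosets, in order to have it inside a type of
  class \<^class>\<open>group_add\<close>.\<close>

typedef 'a bijection = "{f :: 'a \<Rightarrow> 'a. bij f}" morphisms apply_bijection Bijection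
  by (rule exI[of _ id]) simp

instantiation bijection :: (type) group_add
begin

definition "0 = Bijection id"
definition "f + g = Bijection (apply_bijection f \<circ> apply_bijection g)"
definition "- f = Bijection (inv_into UNIV (apply_bijection f))"
definition "f - g = f + - g" for f g :: "'a bijection"

lemma bij_apply_bijection: "bij (apply_bijection f)"
  using apply_bijection by blast

lemma apply_bijection_simps:
  "apply_bijection 0 = id" "apply_bijection (f + g) = apply_bijection f \<circ> apply_bijection g"
  "apply_bijection (- f) = inv_into UNIV (apply_bijection f)"
  unfolding zero_bijection_def plus_bijection_def uminus_bijection_def
  by (simp_all add: Bijection_inverse bij_apply_bijection bij_comp bij_imp_bij_inv)

instance
proof
  fix f g h :: "'a bijection"
  show "f + g + h = f + (g + h)" "0 + f = f" "f + 0 = f" "- f + f = 0" "f + - g = f - g"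
    by (simp_all add: apply_bijection_inject[symmetric] apply_bijection_simps comp_assoc minus_bijection_def
        bij_is_inj[OF bij_apply_bijection])
qed

end

section \<open>The quotient group as permutations of cosets\<close>

context normal
begin

text \<open>Left translation of the quotient group, extended by the identity to sets that are not
  cosets, since a \<open>bijection\<close> acts on the whole type.\<close>

definition coset_action :: "'a \<Rightarrow> 'a set bijection" where
  "coset_action g = Bijection (\<lambda>C. if C \<in> rcosets H then (H #> g) <#> C else C)"

lemma rcosetsE:
  assumes "C \<in> rcosets H"
  obtains k where "k \<in> carrier G" "C = H #> k"
  using assms by (auto simp: RCOSETS_def)

lemma apply_coset_action:
  assumes g: "g \<in> carrier G"
  shows "apply_bijection (coset_action g) = (\<lambda>C. if C \<in> rcosets H then (H #> g) <#> C else C)"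
proof -
  let ?f = "\<lambda>g C. if C \<in> rcosets H then (H #> g) <#> C else C"
  have "?f k (?f h C) = C" if "k \<in> carrier G" "h \<in> carrier G" "k \<otimes> h = \<one>" for k h C
  proof (cases "C \<in> rcosets H")
    case True
    then obtain x where x: "x \<in> carrier G" "C = H #> x" by (rule rcosetsE)
    then have "(H #> h) <#> C = H #> (h \<otimes> x)" "H #> (h \<otimes> x) \<in> rcosets H"
      using that by (simp_all add: rcos_sum rcosetsI subset)
    moreover have "(H #> k) <#> (H #> (h \<otimes> x)) = C"
      using that x by (simp add: rcos_sum flip: m_assoc)
    ultimately show ?thesis using True by simp
  qed simp
  from this[of "inv g" g] this[of g "inv g"] have "bij (?f g)"
    using g by (intro o_bij[of "?f (inv g)"]) (simp_all add: fun_eq_iff)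
  then show ?thesis by (simp add: coset_action_def Bijection_inverse)
qed

lemma coset_action_mult:
  assumes "g \<in> carrier G" "h \<in> carrier G"
  shows "coset_action (g \<otimes> h) = coset_action g + coset_action h"
proof -
  have "apply_bijection (coset_action (g \<otimes> h)) C = apply_bijection (coset_action g + coset_action h) C" for C
  proof (cases "C \<in> rcosets H")
    case True
    then obtain x where x: "x \<in> carrier G" "C = H #> x" by (rule rcosetsE)
    then have "(H #> h) <#> C = H #> (h \<otimes> x)" "H #> (h \<otimes> x) \<in> rcosets H"
      using assms by (simp_all add: rcos_sum rcosetsI subset)
    then show ?thesis
      using True assms x by (simp add: apply_coset_action apply_bijection_simps rcos_sum m_assoc)
  qed (simp add: assms apply_coset_action apply_bijection_simps)
  then show ?thesis by (simp add: apply_bijection_inject[symmetric] fun_eq_iff)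
qed

text \<open>Evaluation at the trivial coset makes the action of the quotient faithful and turns a
  finite set of bijections into finitely many cosets.\<close>

lemma coset_action_coset:
  assumes "g \<in> carrier G"
  shows "apply_bijection (coset_action g) H = H #> g"
proof -
  have "H \<in> rcosets H" using rcosetsI[OF subset one_closed] by (simp add: coset_mult_one subset)
  then have "apply_bijection (coset_action g) H = (H #> g) <#> H" using assms by (simp add: apply_coset_action)
  also have "\<dots> = (H #> g) <#> (H #> \<one>)" by (simp add: coset_mult_one subset)
  also have "\<dots> = H #> g" using assms by (simp add: rcos_sum)
  finally show ?thesis .
qed

lemma coset_action_eq_0_iff:
  assumes "g \<in> carrier G"
  shows "coset_action g = 0 \<longleftrightarrow> g \<in> H"
proof
  assume "coset_action g = 0"
  then have "H #> g = H" using coset_action_coset[OF assms] by (simp add: apply_bijection_simps)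
  then show "g \<in> H" using coset_join1 assms subgroup_axioms by blast
next
  assume g: "g \<in> H"
  then have Hg: "H #> g = H" by (rule rcos_const[OF is_group])
  have "apply_bijection (coset_action g) C = C" for C
  proof (cases "C \<in> rcosets H")
    case True
    then obtain x where x: "x \<in> carrier G" "C = H #> x" by (rule rcosetsE)
    have "H <#> C = (H #> \<one>) <#> (H #> x)" using x by (simp add: coset_mult_one subset)
    also have "\<dots> = C" using x by (simp add: rcos_sum)
    finally show ?thesis using True assms by (simp add: apply_coset_action Hg)
  qed (simp add: assms apply_coset_action)
  then show "coset_action g = 0"
    by (simp add: apply_bijection_inject[symmetric] apply_bijection_simps fun_eq_iff)
qed

text \<open>By evaluation at \<open>H\<close>, a finite conjugacy class of the image of some
  \<open>g\<close> outside \<open>H\<close> would give finitely many cosets of conjugates of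
  \<open>g\<close>, placing \<open>g\<close> in \<open>fc_step G H\<close>.\<close>

lemma icc_coset_action:
  assumes "fc_step G H \<subseteq> H"
  shows "icc (coset_action ` carrier G)"
proof -
  let ?\<theta> = coset_action and ?\<Gamma> = "coset_action ` carrier G"
  have one: "?\<theta> \<one> = 0" by (simp add: coset_action_eq_0_iff)
  have inv: "?\<theta> (inv g) = - ?\<theta> g" if "g \<in> carrier G" for g
    using coset_action_mult[of g "inv g"] that one by (simp add: minus_unique)
  have conj: "?\<theta> h + ?\<theta> g - ?\<theta> h = ?\<theta> (h \<otimes> g \<otimes> inv h)" if "g \<in> carrier G" "h \<in> carrier G" for g h
    using that by (simp add: coset_action_mult inv)
  have "add_subgroup ?\<Gamma>"
    unfolding add_subgroup_def
  proof (intro conjI ballI)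
    show "0 \<in> ?\<Gamma>" unfolding one[symmetric] by (intro imageI) simp
  next
    fix a b assume "a \<in> ?\<Gamma>" "b \<in> ?\<Gamma>"
    then obtain g h where "g \<in> carrier G" "h \<in> carrier G" "a = ?\<theta> g" "b = ?\<theta> h" by blast
    then have "a + b = ?\<theta> (g \<otimes> h)" "g \<otimes> h \<in> carrier G" by (simp_all add: coset_action_mult)
    then show "a + b \<in> ?\<Gamma>" by blast
  next
    fix a assume "a \<in> ?\<Gamma>"
    then obtain g where "g \<in> carrier G" "a = ?\<theta> g" by blast
    then have "- a = ?\<theta> (inv g)" "inv g \<in> carrier G" by (simp_all add: inv)
    then show "- a \<in> ?\<Gamma>" by blast
  qed
  moreover have "infinite ((\<lambda>y. y + a - y) ` ?\<Gamma>)" if a: "a \<in> ?\<Gamma>" "a \<noteq> 0" for a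
  proof
    assume fin: "finite ((\<lambda>y. y + a - y) ` ?\<Gamma>)"
    obtain g where g: "g \<in> carrier G" "a = ?\<theta> g" using a(1) by blast
    have "(\<lambda>h. H #> (h \<otimes> g \<otimes> inv h)) ` carrier G \<subseteq> (\<lambda>b. apply_bijection b H) ` (\<lambda>y. y + a - y) ` ?\<Gamma>"
    proof
      fix C assume "C \<in> (\<lambda>h. H #> (h \<otimes> g \<otimes> inv h)) ` carrier G"
      then obtain h where h: "h \<in> carrier G" "C = H #> (h \<otimes> g \<otimes> inv h)" by blast
      then have "C = apply_bijection (?\<theta> h + a - ?\<theta> h) H"
        using g by (simp only: conj coset_action_coset conj_closed)
      then show "C \<in> (\<lambda>b. apply_bijection b H) ` (\<lambda>y. y + a - y) ` ?\<Gamma>" using h(1) by blast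
    qed
    then have "finite ((\<lambda>h. H #> (h \<otimes> g \<otimes> inv h)) ` carrier G)"
      using fin finite_subset finite_imageI by blast
    then have "g \<in> fc_step G H" using fc_step_iff[OF normal_axioms] g(1) by blast
    then have "g \<in> H" using assms by blast
    then show False using a(2) g coset_action_eq_0_iff by blast
  qed
  ultimately show ?thesis by (simp add: icc_def)
qed

end

theorem corollary1p1:
  fixes G :: "('a, 'm) monoid_scheme" and X :: "'x topology" and \<phi> :: "'a \<Rightarrow> 'x \<Rightarrow> 'x"
  assumes "group G" and "countable (carrier G)"
    and "universal_minimal_proximal_action G X \<phi>"
  shows "{g \<in> carrier G. \<forall>x\<in>topspace X. \<phi> g x = x} = hyper_fc G"
proof
  interpret group G by fact
  have X: "minimal_proximal_action G X \<phi>"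
    using assms(3) by (simp add: universal_minimal_proximal_action_def)
  show "hyper_fc G \<subseteq> {g \<in> carrier G. \<forall>x\<in>topspace X. \<phi> g x = x}"
    using hyper_fc_acts_trivially[OF assms(1) X] by blast
  obtain N where N: "N \<lhd> G" "N \<subseteq> hyper_fc G" "fc_step G N \<subseteq> N" by (rule hyper_fc_stable)
  interpret normal N G by fact
  show "{g \<in> carrier G. \<forall>x\<in>topspace X. \<phi> g x = x} \<subseteq> hyper_fc G"
  proof
    fix a assume a: "a \<in> {g \<in> carrier G. \<forall>x\<in>topspace X. \<phi> g x = x}"
    then have aG: "a \<in> carrier G" by simp
    let ?\<Gamma> = "coset_action ` carrier G"
    have icc: "icc ?\<Gamma>" by (rule icc_coset_action[OF N(3)])
    then have sg: "add_subgroup ?\<Gamma>" by (simp add: icc_def)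
    have "a \<in> N"
    proof (rule ccontr)
      assume "a \<notin> N"
      \<comment> \<open>The inverse appears because the translate by \<open>a\<close> takes at 0 the
        value of the configuration at \<open>- coset_action a\<close>.\<close>
      then have "- coset_action a \<noteq> 0" using coset_action_eq_0_iff[OF aG] by simp
      moreover have "- coset_action a \<in> ?\<Gamma>" using add_subgroupD(3)[OF sg] aG by blast
      moreover have "countable ?\<Gamma>" using assms(2) by simp
      ultimately have "\<exists>C. 0 \<in> C \<and> - coset_action a \<notin> C \<and> (\<forall>W. finite W \<and> W \<subseteq> ?\<Gamma> \<longrightarrow>
          (\<exists>F. finite F \<and> F \<subseteq> ?\<Gamma> \<and> (\<forall>a\<in>?\<Gamma>. \<forall>b\<in>?\<Gamma>. \<exists>f\<in>F. \<forall>w\<in>W.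
            (a + f + w \<in> C \<longleftrightarrow> w \<in> C) \<and> (b + f + w \<in> C \<longleftrightarrow> w \<in> C))))"
        using icc_proximal_configuration[OF icc] by simp
      then obtain C where C: "0 \<in> C" "- coset_action a \<notin> C"
        and ret: "\<forall>W. finite W \<and> W \<subseteq> ?\<Gamma> \<longrightarrow>
          (\<exists>F. finite F \<and> F \<subseteq> ?\<Gamma> \<and> (\<forall>a\<in>?\<Gamma>. \<forall>b\<in>?\<Gamma>. \<exists>f\<in>F. \<forall>w\<in>W.
            (a + f + w \<in> C \<longleftrightarrow> w \<in> C) \<and> (b + f + w \<in> C \<longleftrightarrow> w \<in> C)))"
        by (elim exE conjE) (rule that)
      have "\<exists>(Y :: ('a set bijection \<Rightarrow> bool) topology) \<psi>.
          minimal_proximal_action G Y \<psi> \<and> (\<exists>y\<in>topspace Y. \<psi> a y \<noteq> y)"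
      proof (rule minimal_proximal_action_of_configuration[where \<theta> = coset_action and X = C])
        show "\<exists>F. finite F \<and> F \<subseteq> ?\<Gamma> \<and> (\<forall>a\<in>?\<Gamma>. \<forall>b\<in>?\<Gamma>. \<exists>f\<in>F. \<forall>w\<in>W.
            (a + f + w \<in> C \<longleftrightarrow> w \<in> C) \<and> (b + f + w \<in> C \<longleftrightarrow> w \<in> C))"
          if "finite W" "W \<subseteq> ?\<Gamma>" for W
          using ret[rule_format, OF conjI[OF that]] .
      qed (fact assms(1) coset_action_mult C aG)+
      then obtain Y :: "('a set bijection \<Rightarrow> bool) topology" and \<psi> y where
        Y: "minimal_proximal_action G Y \<psi>" "y \<in> topspace Y" "\<psi> a y \<noteq> y" by blast
      \<comment> \<open>\<open>Y\<close> lives on a type other than \<open>'a set set\<close>, hence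
        the transfer lemma for universality. An element acting trivially on \<open>X\<close> acts
        trivially on every factor.\<close>
      obtain p where "factor_map G X \<phi> Y \<psi> p"
        using universal_minimal_proximal_actionD[OF assms(3) Y(1)] by blast
      then have p: "p ` topspace X = topspace Y" "\<And>x. x \<in> topspace X \<Longrightarrow> p (\<phi> a x) = \<psi> a (p x)"
        using aG by (auto simp: factor_map_def)
      obtain x where x: "x \<in> topspace X" "y = p x" using Y(2) p(1) by blast
      then have "\<psi> a y = y" using p(2)[OF x(1)] a by simp
      then show False using Y(3) by contradiction
    qed
    then show "a \<in> hyper_fc G" using N(2) by blast
  qed
qed

end
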